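(* Let $k\in\{1,2\}$ and let $G$ be an outerplanar graph on $n$ vertices. One can decide in polynomial time whether $\chi_{CF}(G)\le k$. Moreover, one can compute in $\mathcal{O}(n^{4k+1})$ time a conflict-free $k$-coloring of $G$ that minimizes the number of colored vertices (when such a coloring exists).
   Context: For a vertex $v$ of a simple graph $G$, $N[v]$ is the set consisting of $v$ and its neighbors. A conflict-free $k$-coloring of $G$ is a map $\chi: V'\to\{1,\dots,k\}$ defined on a subset $V'\subseteq V(G)$ (the colored vertices; others are uncolored) such that for every $v\in V(G)$ there is $w\in N[v]\cap V'$ whose color is different from the colors of all other vertices in $N[v]\cap V'$. $\chi_{CF}(G)$ is the least $k$ for which $G$ has a conflict-free $k$-coloring. *)

theory Defs
  imports "HOL-Analysis.Analysis" "HOL-Library.Landau_Symbols"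
begin

section \<open>Conflict-free colorings of simple graphs\<close>

definition simple_graph :: "'a set \<Rightarrow> 'a set set \<Rightarrow> bool" where
  "simple_graph V E \<longleftrightarrow> finite V \<and> (\<forall>e\<in>E. e \<subseteq> V \<and> card e = 2)"

definition closed_nbhd :: "'a set set \<Rightarrow> 'a \<Rightarrow> 'a set" where
  "closed_nbhd E v = insert v {u. {u, v} \<in> E}"

text \<open>The colored vertices are the domain of the partial map \<open>col\<close>.\<close>

definition cf_coloring :: "nat \<Rightarrow> 'a set \<Rightarrow> 'a set set \<Rightarrow> ('a \<Rightarrow> nat option) \<Rightarrow> bool" where
  "cf_coloring k V E col \<longleftrightarrow>
     dom col \<subseteq> V \<and> ran col \<subseteq> {1..k} \<and>
     (\<forall>v\<in>V. \<exists>w \<in> closed_nbhd E v \<inter> dom col.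
        \<forall>u \<in> closed_nbhd E v \<inter> dom col. u \<noteq> w \<longrightarrow> col u \<noteq> col w)"

definition cf_chromatic :: "'a set \<Rightarrow> 'a set set \<Rightarrow> nat" where
  "cf_chromatic V E = (LEAST k. \<exists>col. cf_coloring k V E col)"

definition min_cf_coloring :: "nat \<Rightarrow> 'a set \<Rightarrow> 'a set set \<Rightarrow> ('a \<Rightarrow> nat option) \<Rightarrow> bool" where
  "min_cf_coloring k V E col \<longleftrightarrow>
     cf_coloring k V E col \<and>
     (\<forall>col'. cf_coloring k V E col' \<longrightarrow> card (dom col) \<le> card (dom col'))"


section \<open>Outerplanar graphs\<close>

text \<open>A plane drawing: vertices are distinct points, edges are arcs between their end points that
  meet the vertices and each other only at common end points.\<close>

definition plane_drawing ::
  "'a set \<Rightarrow> 'a set set \<Rightarrow> ('a \<Rightarrow> complex) \<Rightarrow> ('a set \<Rightarrow> real \<Rightarrow> complex) \<Rightarrow> bool" where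
  "plane_drawing V E pos \<gamma> \<longleftrightarrow>
     inj_on pos V \<and>
     (\<forall>e\<in>E. arc (\<gamma> e) \<and> {pathstart (\<gamma> e), pathfinish (\<gamma> e)} = pos ` e \<and>
        path_image (\<gamma> e) \<inter> pos ` V = pos ` e) \<and>
     (\<forall>e\<in>E. \<forall>f\<in>E. e \<noteq> f \<longrightarrow> path_image (\<gamma> e) \<inter> path_image (\<gamma> f) \<subseteq> pos ` (e \<inter> f))"

definition drawing_image ::
  "'a set \<Rightarrow> 'a set set \<Rightarrow> ('a \<Rightarrow> complex) \<Rightarrow> ('a set \<Rightarrow> real \<Rightarrow> complex) \<Rightarrow> complex set" where
  "drawing_image V E pos \<gamma> = pos ` V \<union> (\<Union>e\<in>E. path_image (\<gamma> e))"

text \<open>Since the drawing is compact, the set \<^const>\<open>outside\<close> of its image is the unique unbounded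
  component of the complement, i.e. the outer face.\<close>

definition outerplanar :: "'a set \<Rightarrow> 'a set set \<Rightarrow> bool" where
  "outerplanar V E \<longleftrightarrow>
     (\<exists>pos \<gamma>. plane_drawing V E pos \<gamma> \<and>
        (\<forall>v\<in>V. pos v \<in> frontier (outside (drawing_image V E pos \<gamma>))))"


section \<open>Random access machine\<close>

text \<open>Structured programs for a word RAM with memory cells indexed by natural numbers.\<close>

type_synonym mem = "nat \<Rightarrow> nat"

datatype aexp =
    Lit nat
  | Cell aexp
  | Add aexp aexp
  | Sub aexp aexp
  | Mul aexp aexp
  | Quot aexp aexp

datatype prog =
    Skip
  | Store aexp aexp
  | Seq prog prog
  | Cond aexp prog prog
  | Loop aexp prog

text \<open>\<^const>\<open>Cell\<close> is indirect addressing. Subtraction is truncated, and division by zero gives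
  zero.\<close>

fun aval :: "aexp \<Rightarrow> mem \<Rightarrow> nat" where
  "aval (Lit m) s = m"
| "aval (Cell a) s = s (aval a s)"
| "aval (Add a b) s = aval a s + aval b s"
| "aval (Sub a b) s = aval a s - aval b s"
| "aval (Mul a b) s = aval a s * aval b s"
| "aval (Quot a b) s = aval a s div aval b s"

text \<open>All values arising in the evaluation, including addresses, are machine words below \<open>B\<close>.\<close>

fun fits :: "nat \<Rightarrow> aexp \<Rightarrow> mem \<Rightarrow> bool" where
  "fits B (Lit m) s \<longleftrightarrow> m < B"
| "fits B (Cell a) s \<longleftrightarrow> fits B a s \<and> s (aval a s) < B"
| "fits B (Add a b) s \<longleftrightarrow> fits B a s \<and> fits B b s \<and> aval a s + aval b s < B"
| "fits B (Sub a b) s \<longleftrightarrow> fits B a s \<and> fits B b s"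
| "fits B (Mul a b) s \<longleftrightarrow> fits B a s \<and> fits B b s \<and> aval a s * aval b s < B"
| "fits B (Quot a b) s \<longleftrightarrow> fits B a s \<and> fits B b s"

text \<open>Unit cost for every operation.\<close>

fun acost :: "aexp \<Rightarrow> nat" where
  "acost (Lit m) = 1"
| "acost (Cell a) = acost a + 1"
| "acost (Add a b) = acost a + acost b + 1"
| "acost (Sub a b) = acost a + acost b + 1"
| "acost (Mul a b) = acost a + acost b + 1"
| "acost (Quot a b) = acost a + acost b + 1"

text \<open>\<open>exec B p s t s'\<close>: started in memory \<open>s\<close>, the program \<open>p\<close> halts after \<open>t\<close> operations in
  memory \<open>s'\<close>, using only words below \<open>B\<close>. Conditions are true iff they are nonzero. A program that
  overflows has no execution.\<close>

inductive exec :: "nat \<Rightarrow> prog \<Rightarrow> mem \<Rightarrow> nat \<Rightarrow> mem \<Rightarrow> bool" for B where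
  Skip: "exec B Skip s 1 s"
| Store: "fits B a s \<Longrightarrow> fits B e s \<Longrightarrow>
    exec B (Store a e) s (acost a + acost e + 1) (s(aval a s := aval e s))"
| Seq: "exec B p s t s' \<Longrightarrow> exec B q s' u s'' \<Longrightarrow> exec B (Seq p q) s (t + u) s''"
| CondTrue: "fits B e s \<Longrightarrow> aval e s \<noteq> 0 \<Longrightarrow> exec B p s t s' \<Longrightarrow>
    exec B (Cond e p q) s (acost e + 1 + t) s'"
| CondFalse: "fits B e s \<Longrightarrow> aval e s = 0 \<Longrightarrow> exec B q s t s' \<Longrightarrow>
    exec B (Cond e p q) s (acost e + 1 + t) s'"
| LoopFalse: "fits B e s \<Longrightarrow> aval e s = 0 \<Longrightarrow> exec B (Loop e p) s (acost e + 1) s"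
| LoopTrue: "fits B e s \<Longrightarrow> aval e s \<noteq> 0 \<Longrightarrow> exec B p s t s' \<Longrightarrow> exec B (Loop e p) s' u s'' \<Longrightarrow>
    exec B (Loop e p) s (acost e + 1 + t + u) s''"

inductive_cases exec_SkipE: "exec B Skip s t s'"
  and exec_StoreE: "exec B (Store a e) s t s'"
  and exec_SeqE: "exec B (Seq p q) s t s'"
  and exec_CondE: "exec B (Cond e p q) s t s'"
  and exec_LoopE: "exec B (Loop e p) s t s'"

lemma exec_deterministic:
  "exec B p s t s' \<Longrightarrow> exec B p s u s'' \<Longrightarrow> t = u \<and> s' = s''"
proof (induction arbitrary: u s'' rule: exec.induct)
  case (Skip s)
  then show ?case by (elim exec_SkipE) simp
next
  case (Store a s e)
  from Store.prems show ?case by (elim exec_StoreE) simp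
next
  case (Seq p s t s' q t' r)
  from Seq.prems obtain t1 s1 t2 where
    *: "exec B p s t1 s1" "exec B q s1 t2 s''" "u = t1 + t2" by (rule exec_SeqE)
  from Seq.IH(1)[OF *(1)] Seq.IH(2) * show ?case by simp
next
  case (CondTrue e s p t s' q)
  from CondTrue.prems show ?case
  proof (rule exec_CondE)
    fix t1 assume *: "exec B p s t1 s''" "u = Suc (acost e + t1)"
    from CondTrue.IH[OF *(1)] *(2) show ?case by simp
  qed (use CondTrue.hyps in simp)
next
  case (CondFalse e s q t s' p)
  from CondFalse.prems show ?case
  proof (rule exec_CondE)
    fix t1 assume *: "exec B q s t1 s''" "u = Suc (acost e + t1)"
    from CondFalse.IH[OF *(1)] *(2) show ?case by simp
  qed (use CondFalse.hyps in simp)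
next
  case (LoopFalse e s p)
  from LoopFalse.prems show ?case
    by (rule exec_LoopE) (use LoopFalse.hyps in simp_all)
next
  case (LoopTrue e s p t s' t' r)
  from LoopTrue.prems show ?case
  proof (rule exec_LoopE)
    fix t1 s1 t2
    assume *: "exec B p s t1 s1" "exec B (Loop e p) s1 t2 s''" "u = Suc (acost e + t1 + t2)"
    from LoopTrue.IH(1)[OF *(1)] LoopTrue.IH(2) * show ?case by simp
  qed (use LoopTrue.hyps in simp)
qed


section \<open>Graph algorithms\<close>

text \<open>A graph with vertex set \<open>{..<n}\<close> is given by \<open>n\<close> in cell \<open>0\<close>, followed by its
  adjacency matrix row by row.\<close>

definition graph_input :: "nat \<Rightarrow> nat set set \<Rightarrow> mem" where
  "graph_input n E a =
     (if a = 0 then n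
      else if a \<le> n * n \<and> {(a - 1) div n, (a - 1) mod n} \<in> E then 1
      else 0)"

text \<open>Cell \<open>v\<close> holds the color of vertex \<open>v\<close>, where \<open>0\<close> means uncolored.\<close>

definition output_coloring :: "nat \<Rightarrow> mem \<Rightarrow> nat \<Rightarrow> nat option" where
  "output_coloring n s v = (if v < n \<and> s v \<noteq> 0 then Some (s v) else None)"

text \<open>On every graph on \<open>n\<close> vertices satisfying the promise \<open>P\<close>, the program \<open>p\<close> halts within
  \<open>T n\<close> operations in a memory satisfying \<open>Q\<close>. The word length is \<open>O(log n)\<close> bits, with a constant
  depending on the program.\<close>

definition solves_within ::
  "(nat \<Rightarrow> nat) \<Rightarrow> prog \<Rightarrow> (nat set \<Rightarrow> nat set set \<Rightarrow> bool) \<Rightarrow>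
     (nat \<Rightarrow> nat set set \<Rightarrow> mem \<Rightarrow> bool) \<Rightarrow> bool" where
  "solves_within T p P Q \<longleftrightarrow>
     (\<exists>c. \<forall>n E. simple_graph {..<n} E \<and> P {..<n} E \<longrightarrow>
        (\<exists>t s. exec ((n + 2) ^ c) p (graph_input n E) t s \<and> t \<le> T n \<and> Q n E s))"

end

theory Submission
  imports Defs
begin

text \<open>Let every vertex \<open>v\<close> choose its color, a witness \<open>w\<close> in its closed neighborhood and a value \<open>d\<close> for
  the color of \<open>w\<close>. A choice describes a conflict-free coloring iff for all adjacent or equal \<open>u\<close> and
  \<open>v\<close> the color of \<open>u\<close> equals \<open>d\<close> exactly when \<open>u\<close> is the witness of \<open>v\<close>. With a penalty for
  every violation, minimizing the number of colored vertices becomes a weighted constraint problem on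
  the edges of the graph with \<open>9n\<close> values per variable. It is solved by variable elimination: a vertex
  of degree at most two is deleted, its neighbors are joined by an edge, and the optimal contribution of
  the deleted vertex is added to the weights of that edge. This takes \<open>O(n\<^sup>4)\<close> steps.

  Deleting such a vertex and joining its neighbors keeps a graph outerplanar, so it remains to find a
  vertex of degree at most two in every outerplanar graph. If there is none, a longest path whose first
  vertex has a shortest possible chord yields a cycle with two crossing chords, a subdivision of
  \<open>K\<^sub>4\<close>. In the plane both chords would have to run inside the cycle, and they would cross there.\<close>

section \<open>Arcs in the plane\<close>

text \<open>The conflict-free condition concerns a whole closed neighborhood. It becomes pairwise
  because each vertex announces its witness color, so that a neighbor can be checked against it
  without regard to the others. Degree at most two keeps the problem pairwise: the optimal
  contribution of a deleted vertex is a function of the values of its neighbors, and for two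
  neighbors this function fits on a single edge. Each elimination minimizes over triples of values,
  of which there are O(n^3), and the number of colors enters only through the penalties. So O(n^4)
  serves both values of \<open>k\<close> and lies within the exponent \<open>4 * k + 1\<close>.

  Penalties replace infinite weights: an instance without a coloring still has a finite optimum,
  recognized by exceeding \<open>n\<close>. On a machine with words of O(log n) bits the weights
  must also survive repeated additions to the same edge. They do, since each weight between
  remaining vertices equals a summand of the total of some assignment, and totals never exceed the
  original ones.\<close>

definition arc_between :: "complex \<Rightarrow> complex \<Rightarrow> complex set \<Rightarrow> bool" where
  "arc_between a b P \<longleftrightarrow> (\<exists>g. arc g \<and> pathstart g = a \<and> pathfinish g = b \<and> path_image g = P)"

lemma arc_between_sym: "arc_between a b P \<Longrightarrow> arc_between b a P"
  unfolding arc_between_def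
  by (metis arc_reversepath path_image_reversepath pathfinish_reversepath pathstart_reversepath)

lemma arc_between_ends: "arc_between a b P \<Longrightarrow> a \<in> P \<and> b \<in> P \<and> a \<noteq> b"
  unfolding arc_between_def
  by (metis arc_distinct_ends pathfinish_in_path_image pathstart_in_path_image)

lemma arc_between_compact: "arc_between a b P \<Longrightarrow> compact P"
  unfolding arc_between_def by (metis arc_imp_path compact_path_image)

lemma arc_between_connected: "arc_between a b P \<Longrightarrow> connected P"
  unfolding arc_between_def by (metis arc_imp_path connected_path_image)

lemma arc_between_join:
  assumes "arc_between a b P" "arc_between b c Q" "P \<inter> Q = {b}"
  shows "arc_between a c (P \<union> Q)"
proof -
  obtain g h where "arc g" "pathstart g = a" "pathfinish g = b" "path_image g = P"
    "arc h" "pathstart h = b" "pathfinish h = c" "path_image h = Q"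
    using assms(1,2) unfolding arc_between_def by blast
  then show ?thesis
    unfolding arc_between_def using assms(3)
    by (intro exI[of _ "g +++ h"]) (simp add: arc_join path_image_join)
qed

lemma arc_between_open_connected:
  assumes "arc_between a b P"
  shows "connected (P - {a, b})" "P - {a, b} \<noteq> {}"
  using assms unfolding arc_between_def
  by (metis arc_imp_simple_path connected_simple_path_endless,
      metis arc_imp_simple_path nonempty_simple_path_endless)

text \<open>The end point is a limit of interior points, by continuity at the parameter 1. So an arc
  whose interior lies in a region has its ends in the closure of that region.\<close>

lemma arc_between_closure:
  assumes "arc_between a b P" "P - {a, b} \<subseteq> S"
  shows "b \<in> closure S"
proof -
  obtain g where g: "arc g" "pathstart g = a" "pathfinish g = b" "path_image g = P"
    using assms(1) unfolding arc_between_def by blast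
  have inj: "inj_on g {0..1}" and cont: "continuous_on {0..1} g"
    using g(1) by (auto simp: arc_def path_def)
  have "g t \<in> S" if "t \<in> {0<..<1}" for t
  proof -
    have "g t \<in> P" using g(4) that by (auto simp: path_image_def)
    moreover have "g t \<noteq> a" "g t \<noteq> b"
      using inj that g(2,3) unfolding pathstart_def pathfinish_def
      by (auto dest: inj_onD[OF inj])
    ultimately show ?thesis using assms(2) by auto
  qed
  then have "g ` {0<..<1} \<subseteq> S" by auto
  moreover have "g ` closure {0<..<1::real} \<subseteq> closure (g ` {0<..<1})"
    using cont closure_subset[of "g ` {0<..<1}"] by (intro image_closure_subset) simp_all
  moreover have "(1::real) \<in> closure {0<..<1}" by simp
  ultimately have "g 1 \<in> closure S" using closure_mono by blast
  then show ?thesis using g(3) by (simp add: pathfinish_def)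
qed

section \<open>Jordan curves, theta curves and the outer face\<close>

lemma arc_between_Jordan:
  assumes "arc_between a b P" "arc_between a b Q" "P \<inter> Q = {a, b}"
  defines "C \<equiv> P \<union> Q"
  shows "inside C \<noteq> {}" "open (inside C)" "connected (inside C)"
    "open (outside C)" "connected (outside C)" "frontier (inside C) = C"
    "closure (inside C) = inside C \<union> C"
proof -
  obtain g h where g: "arc g" "pathstart g = a" "pathfinish g = b" "path_image g = P"
    and h: "arc h" "pathstart h = a" "pathfinish h = b" "path_image h = Q"
    using assms(1,2) unfolding arc_between_def by blast
  let ?c = "g +++ reversepath h"
  have c: "simple_path ?c" "pathfinish ?c = pathstart ?c" "path_image ?c = C"
    using g h assms(3) unfolding C_def
    by (auto simp: path_image_join intro!: simple_path_join_loop arc_reversepath)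
  note J = Jordan_inside_outside[OF c(1,2), unfolded c(3)]
  show "inside C \<noteq> {}" "open (inside C)" "connected (inside C)"
    "open (outside C)" "connected (outside C)" and fr: "frontier (inside C) = C"
    using J by auto
  show "closure (inside C) = inside C \<union> C"
    using fr closure_Un_frontier by metis
qed

lemma connected_inside_or_outside:
  assumes "arc_between a b P" "arc_between a b Q" "P \<inter> Q = {a, b}"
    and "connected S" "S \<inter> (P \<union> Q) = {}"
  shows "S \<subseteq> inside (P \<union> Q) \<or> S \<subseteq> outside (P \<union> Q)"
proof -
  note J = arc_between_Jordan[OF assms(1-3)]
  have "S \<subseteq> inside (P \<union> Q) \<union> outside (P \<union> Q)"
    using assms(5) inside_Un_outside by blast
  moreover have "inside (P \<union> Q) \<inter> outside (P \<union> Q) \<inter> S = {}"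
    by (simp add: inside_Int_outside)
  ultimately show ?thesis
    using connectedD[OF assms(4) J(2,4)] by blast
qed

text \<open>Otherwise \<open>inside (Q \<union> R)\<close> would, by Janiszewski's theorem applied to \<open>P \<union> Q\<close> and
  \<open>P \<union> R\<close>, lie in one of the other two bounded regions, whose closure misses the
  interior of the third arc.\<close>

lemma theta_curve:
  assumes P: "arc_between a b P" and Q: "arc_between a b Q" and R: "arc_between a b R"
    and PQ: "P \<inter> Q = {a, b}" and PR: "P \<inter> R = {a, b}" and QR: "Q \<inter> R = {a, b}"
  shows "R - {a, b} \<subseteq> inside (P \<union> Q) \<or> Q - {a, b} \<subseteq> inside (P \<union> R)
    \<or> P - {a, b} \<subseteq> inside (Q \<union> R)"
proof (rule ccontr)
  assume neg: "\<not> ?thesis"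
  have Rout: "R - {a, b} \<subseteq> outside (P \<union> Q)"
    using connected_inside_or_outside[OF P Q PQ arc_between_open_connected(1)[OF R]] neg PR QR
    by blast
  have Qout: "Q - {a, b} \<subseteq> outside (P \<union> R)"
    using connected_inside_or_outside[OF P R PR arc_between_open_connected(1)[OF Q]] neg PQ QR
    by blast
  have Pout: "P - {a, b} \<subseteq> outside (Q \<union> R)"
    using connected_inside_or_outside[OF Q R QR arc_between_open_connected(1)[OF P]] neg PQ PR
    by blast
  note JPQ = arc_between_Jordan[OF P Q PQ] and JPR = arc_between_Jordan[OF P R PR]
    and JQR = arc_between_Jordan[OF Q R QR]
  have comp: "compact (P \<union> Q)" "compact (P \<union> R)" "compact (P \<union> Q \<union> R)"
    using P Q R by (auto dest: arc_between_compact)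
  let ?I = "inside (Q \<union> R)"
  have disj: "?I \<inter> (P \<union> Q \<union> R) = {}"
  proof -
    have "?I \<inter> (Q \<union> R) = {}" by (simp add: inside_no_overlap)
    moreover have "?I \<inter> (P - {a, b}) = {}" using Pout inside_Int_outside by blast
    moreover have "{a, b} \<subseteq> Q" using PQ by blast
    ultimately show ?thesis by blast
  qed
  \<comment> \<open>\<open>q\<close> is a point beyond all three arcs. If \<open>p\<close> lay in
    neither of the other two insides, it could be joined to \<open>q\<close> off
    \<open>P \<union> Q\<close> and also off \<open>P \<union> R\<close>. These two closed curves
    meet in the connected set \<open>P\<close>, so Janiszewski would join \<open>p\<close> to
    \<open>q\<close> off all three arcs.\<close>
  obtain q where q: "q \<in> outside (P \<union> Q \<union> R)"
    using comp(3) by (metis compact_imp_bounded ex_in_conv outside_bounded_nonempty)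
  have cover: "?I \<subseteq> inside (P \<union> Q) \<union> inside (P \<union> R)"
  proof
    fix p assume p: "p \<in> ?I"
    show "p \<in> inside (P \<union> Q) \<union> inside (P \<union> R)"
    proof (rule ccontr)
      assume n: "p \<notin> inside (P \<union> Q) \<union> inside (P \<union> R)"
      have pP: "p \<in> outside (P \<union> Q)" "p \<in> outside (P \<union> R)"
        using n disj p inside_Un_outside by blast+
      have qP: "q \<in> outside (P \<union> Q)" "q \<in> outside (P \<union> R)" "q \<in> outside (Q \<union> R)"
        by (auto intro: subsetD[OF outside_mono q])
      have "connected_component (- (P \<union> Q)) p q"
        using JPQ(5) pP qP outside_no_overlap
        unfolding connected_component_def
        by (intro exI[of _ "outside (P \<union> Q)"] conjI) blast+
      moreover have "connected_component (- (P \<union> R)) p q"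
        using JPR(5) pP qP outside_no_overlap
        unfolding connected_component_def
        by (intro exI[of _ "outside (P \<union> R)"] conjI) blast+
      moreover have "connected ((P \<union> Q) \<inter> (P \<union> R))"
      proof -
        have "(P \<union> Q) \<inter> (P \<union> R) = P" using PQ PR QR by blast
        then show ?thesis using arc_between_connected[OF P] by simp
      qed
      ultimately have "connected_component (- ((P \<union> Q) \<union> (P \<union> R))) p q"
        using Janiszewski comp compact_imp_closed by blast
      then have "connected_component (- (Q \<union> R)) p q"
        by (rule connected_component_of_subset) blast
      then have "q \<in> ?I" using p inside_same_component by blast
      then show False using qP(3) inside_Int_outside by blast
    qed
  qed
  have "?I \<inter> (P \<union> Q) = {}" using disj by blast
  then consider "?I \<subseteq> inside (P \<union> Q)" | "?I \<subseteq> outside (P \<union> Q)"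
    using connected_inside_or_outside[OF P Q PQ JQR(3)] by blast
  then show False
  proof cases
    case 1
    then have "closure ?I \<subseteq> closure (inside (P \<union> Q))" by (rule closure_mono)
    then have "R \<subseteq> inside (P \<union> Q) \<union> (P \<union> Q)" using JPQ(7) JQR(7) by blast
    then have "R - {a, b} \<subseteq> inside (P \<union> Q)" using PR QR by blast
    then show False using neg by blast
  next
    case 2
    then have "?I \<subseteq> inside (P \<union> R)" using cover inside_Int_outside by blast
    then have "closure ?I \<subseteq> closure (inside (P \<union> R))" by (rule closure_mono)
    then have "Q \<subseteq> inside (P \<union> R) \<union> (P \<union> R)" using JPR(7) JQR(7) by blast
    then have "Q - {a, b} \<subseteq> inside (P \<union> R)" using PQ QR by blast
    then show False using neg by blast
  qed
qed

text \<open>The open set \<open>inside X\<close> around a frontier point would meet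
  \<open>outside K\<close>, which is contained in \<open>outside X\<close>. This is the only use
  made of the outer face: no vertex is enclosed by a cycle of the drawing.\<close>

lemma frontier_outside_not_inside:
  fixes K X :: "complex set"
  assumes "p \<in> frontier (outside K)" "X \<subseteq> K" "compact X"
  shows "p \<notin> inside X"
proof
  assume "p \<in> inside X"
  then have "inside X \<inter> outside K \<noteq> {}"
    using assms(1) open_inside[OF compact_imp_closed[OF assms(3)]]
    using open_Int_closure_eq_empty[of "inside X" "outside K"] unfolding frontier_def by blast
  then show False using outside_mono[OF assms(2)] inside_Int_outside by blast
qed

text \<open>The diagonals of the quadrilateral must run inside it, where they cross.\<close>

lemma K4_not_on_outer_face:
  assumes AB: "arc_between a b AB" and BC: "arc_between b c BC"
    and CD: "arc_between c d CD" and DA: "arc_between d a DA"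
    and AC: "arc_between a c AC" and BD: "arc_between b d BD"
    and int: "AB \<inter> BC = {b}" "BC \<inter> CD = {c}" "CD \<inter> DA = {d}" "DA \<inter> AB = {a}"
      "AB \<inter> CD = {}" "BC \<inter> DA = {}"
      "AC \<inter> AB = {a}" "AC \<inter> BC = {c}" "AC \<inter> CD = {c}" "AC \<inter> DA = {a}"
      "BD \<inter> AB = {b}" "BD \<inter> BC = {b}" "BD \<inter> CD = {d}" "BD \<inter> DA = {d}" "AC \<inter> BD = {}"
    and sub: "AB \<union> BC \<union> CD \<union> DA \<union> AC \<union> BD \<subseteq> K"
    and front: "{a, b, c, d} \<subseteq> frontier (outside K)"
  shows False
proof -
  note comp = arc_between_compact[OF AB] arc_between_compact[OF BC] arc_between_compact[OF CD]
    arc_between_compact[OF DA] arc_between_compact[OF AC] arc_between_compact[OF BD]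
  note ends = arc_between_ends[OF AB] arc_between_ends[OF BC] arc_between_ends[OF CD]
    arc_between_ends[OF DA] arc_between_ends[OF AC] arc_between_ends[OF BD]
  have out: "p \<notin> inside X" if "p \<in> {a, b, c, d}" "X \<subseteq> K" "compact X" for p X
    using frontier_outside_not_inside[of p K X] that front by blast
  define ABC ADC BAD BCD where "ABC = AB \<union> BC" and "ADC = DA \<union> CD" and "BAD = AB \<union> DA"
    and "BCD = BC \<union> CD"
  have P: "arc_between a c ABC" unfolding ABC_def using arc_between_join[OF AB BC] int by simp
  have Q: "arc_between a c ADC" unfolding ADC_def
    using arc_between_join[OF arc_between_sym[OF DA] arc_between_sym[OF CD]] int by (simp add: Int_commute)
  have P': "arc_between b d BAD" unfolding BAD_def
    using arc_between_join[OF arc_between_sym[OF AB] arc_between_sym[OF DA]] int by (simp add: Int_commute)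
  have Q': "arc_between b d BCD" unfolding BCD_def using arc_between_join[OF BC CD] int by simp
  have PQ: "ABC \<inter> ADC = {a, c}" unfolding ABC_def ADC_def using int(2,4,5,6) by blast
  have PQ': "BAD \<inter> BCD = {b, d}" unfolding BAD_def BCD_def using int(1,3,5,6) by blast
  have PR: "ABC \<inter> AC = {a, c}" unfolding ABC_def using int(7,8) by blast
  have QR: "ADC \<inter> AC = {a, c}" unfolding ADC_def using int(9,10) by blast
  have PR': "BAD \<inter> BD = {b, d}" unfolding BAD_def using int(11,14) by blast
  have QR': "BCD \<inter> BD = {b, d}" unfolding BCD_def using int(12,13) by blast
  have cyc: "BAD \<union> BCD = ABC \<union> ADC" unfolding ABC_def ADC_def BAD_def BCD_def by blast
  have bin: "b \<in> ABC - {a, c}" and din: "d \<in> ADC - {a, c}" and ain: "a \<in> BAD - {b, d}"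
    and cin: "c \<in> BCD - {b, d}"
    unfolding ABC_def ADC_def BAD_def BCD_def using ends by auto
  \<comment> \<open>Each of the other outcomes of \<open>theta_curve\<close> would put one of the
    four corners inside a cycle of the drawing. Hence it is the diagonal that runs inside.\<close>
  have "b \<notin> inside (ADC \<union> AC)" "d \<notin> inside (ABC \<union> AC)" "a \<notin> inside (BCD \<union> BD)" "c \<notin> inside (BAD \<union> BD)"
    by (rule out; use sub comp in \<open>auto simp: ABC_def ADC_def BAD_def BCD_def\<close>)+
  then have ACin: "AC - {a, c} \<subseteq> inside (ABC \<union> ADC)" and BDin: "BD - {b, d} \<subseteq> inside (ABC \<union> ADC)"
    using theta_curve[OF P Q AC PQ PR QR] theta_curve[OF P' Q' BD PQ' PR' QR'] bin din ain cin cyc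
    by auto
  have simple: "\<And>x y S. arc_between x y S \<Longrightarrow>
    \<exists>g. simple_path g \<and> pathstart g = x \<and> pathfinish g = y \<and> path_image g = S"
    unfolding arc_between_def using arc_imp_simple_path by blast
  obtain c1 where c1: "simple_path c1" "pathstart c1 = a" "pathfinish c1 = c" "path_image c1 = ABC"
    using simple[OF P] by blast
  obtain c2 where c2: "simple_path c2" "pathstart c2 = a" "pathfinish c2 = c" "path_image c2 = ADC"
    using simple[OF Q] by blast
  obtain c3 where c3: "simple_path c3" "pathstart c3 = a" "pathfinish c3 = c" "path_image c3 = AC"
    using simple[OF AC] by blast
  have "AC \<inter> inside (ABC \<union> ADC) \<noteq> {}"
    using ACin arc_between_open_connected(2)[OF AC] by blast
  \<comment> \<open>The diagonal \<open>AC\<close> cuts the inside of the quadrilateral into two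
    regions. The connected interior of \<open>BD\<close> stays in one of them, whose closure would
    then contain both \<open>b\<close> and \<open>d\<close>; but one region's closure misses
    \<open>d\<close> and the other's misses \<open>b\<close>.\<close>
  then have split: "inside (ABC \<union> AC) \<union> inside (ADC \<union> AC) \<union> (AC - {a, c}) = inside (ABC \<union> ADC)"
    using split_inside_simple_closed_curve[OF c1(1-3) c2(1-3) c3(1-3)]
      PQ PR QR ends(5) c1(4) c2(4) c3(4) by metis
  have BDsub: "BD - {b, d} \<subseteq> inside (ABC \<union> AC) \<union> inside (ADC \<union> AC)"
    using BDin split int(15) by blast
  note conn = arc_between_open_connected[OF BD]
  have BDdis: "(BD - {b, d}) \<inter> (ABC \<union> AC) = {}" "(BD - {b, d}) \<inter> (ADC \<union> AC) = {}"
    unfolding ABC_def ADC_def using int(11-15) by blast+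
  have BDcases: "BD - {b, d} \<subseteq> inside (ABC \<union> AC) \<or> BD - {b, d} \<subseteq> inside (ADC \<union> AC)"
    using connected_inside_or_outside[OF P AC PR conn(1) BDdis(1)] BDsub inside_Int_outside by blast
  then show False
  proof
    assume "BD - {b, d} \<subseteq> inside (ABC \<union> AC)"
    then have "d \<in> inside (ABC \<union> AC) \<union> (ABC \<union> AC)"
      using arc_between_closure[OF BD] arc_between_Jordan(7)[OF P AC PR] by blast
    moreover have "d \<notin> ABC \<union> AC" unfolding ABC_def using int(5,6,15) ends(3,4,6) by auto
    ultimately show False using \<open>d \<notin> inside (ABC \<union> AC)\<close> by blast
  next
    assume "BD - {b, d} \<subseteq> inside (ADC \<union> AC)"
    then have "b \<in> inside (ADC \<union> AC) \<union> (ADC \<union> AC)"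
      using arc_between_closure[OF arc_between_sym[OF BD], of "inside (ADC \<union> AC)"]
        arc_between_Jordan(7)[OF Q AC QR] by (auto simp: insert_commute)
    moreover have "b \<notin> ADC \<union> AC" unfolding ADC_def using int(5,6,15) ends(1,2,6) by auto
    ultimately show False using \<open>b \<notin> inside (ADC \<union> AC)\<close> by blast
  qed
qed

section \<open>Low degree vertices of outerplanar graphs\<close>

fun path_edges :: "'a list \<Rightarrow> 'a set set" where
  "path_edges (x # y # xs) = insert {x, y} (path_edges (y # xs))"
| "path_edges _ = {}"

lemma path_edges_append:
  "xs \<noteq> [] \<Longrightarrow> ys \<noteq> [] \<Longrightarrow>
    path_edges (xs @ ys) = insert {last xs, hd ys} (path_edges xs \<union> path_edges ys)"
proof (induction xs rule: path_edges.induct)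
  case ("2_2" x)
  then show ?case by (cases ys) auto
qed auto

lemma path_edges_rev: "path_edges (rev xs) = path_edges xs"
proof (induction xs rule: path_edges.induct)
  case (1 x y xs)
  have "path_edges (rev (x # y # xs)) = path_edges (rev (y # xs) @ [x])" by simp
  also have "\<dots> = insert {y, x} (path_edges (rev (y # xs)))"
    by (subst path_edges_append) (auto simp: last_rev)
  finally show ?case using 1 by (simp add: insert_commute)
qed auto

lemma Union_path_edges: "2 \<le> length xs \<Longrightarrow> \<Union> (path_edges xs) = set xs"
proof (induction xs rule: path_edges.induct)
  case (1 x y xs)
  then show ?case by (cases xs) auto
qed auto

lemma path_edges_card: "distinct xs \<Longrightarrow> e \<in> path_edges xs \<Longrightarrow> card e = 2"
  by (induction xs rule: path_edges.induct) auto

locale drawn_graph =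
  fixes V :: "'a set" and E and pos :: "'a \<Rightarrow> complex" and \<gamma>
  assumes simple: "simple_graph V E" and drawing: "plane_drawing V E pos \<gamma>"
begin

definition img :: "'a set set \<Rightarrow> complex set" where
  "img F = (\<Union>e\<in>F. path_image (\<gamma> e))"

lemma edge_arc: "{x, y} \<in> E \<Longrightarrow> arc_between (pos x) (pos y) (path_image (\<gamma> {x, y}))"
proof -
  assume e: "{x, y} \<in> E"
  then have "arc (\<gamma> {x, y})" "{pathstart (\<gamma> {x, y}), pathfinish (\<gamma> {x, y})} = {pos x, pos y}"
    using drawing by (auto simp: plane_drawing_def)
  then have "arc_between (pos x) (pos y) (path_image (\<gamma> {x, y})) \<or>
    arc_between (pos y) (pos x) (path_image (\<gamma> {x, y}))"
    unfolding arc_between_def by (auto simp: doubleton_eq_iff)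
  then show ?thesis using arc_between_sym by blast
qed

lemma edge_vertices: "e \<in> E \<Longrightarrow> pos ` e \<subseteq> path_image (\<gamma> e)"
  using drawing unfolding plane_drawing_def by blast

text \<open>Intersections of drawn subgraphs become a combinatorial matter: different edges meet
  only at common end points, and a drawn edge contains its end points.\<close>

lemma img_Int:
  assumes "F \<subseteq> E" "G \<subseteq> E" "F \<inter> G = {}"
  shows "img F \<inter> img G = pos ` (\<Union> F \<inter> \<Union> G)"
proof (intro equalityI subsetI)
  fix z assume "z \<in> img F \<inter> img G"
  then obtain e f where ef: "e \<in> F" "f \<in> G" "z \<in> path_image (\<gamma> e) \<inter> path_image (\<gamma> f)"
    unfolding img_def by blast
  then have "e \<noteq> f" "e \<in> E" "f \<in> E" using assms by auto
  then have "path_image (\<gamma> e) \<inter> path_image (\<gamma> f) \<subseteq> pos ` (e \<inter> f)"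
    using drawing unfolding plane_drawing_def by blast
  then show "z \<in> pos ` (\<Union> F \<inter> \<Union> G)" using ef by blast
next
  fix z assume "z \<in> pos ` (\<Union> F \<inter> \<Union> G)"
  then obtain x e f where "z = pos x" "x \<in> e" "x \<in> f" "e \<in> F" "f \<in> G" by blast
  then show "z \<in> img F \<inter> img G"
    unfolding img_def using edge_vertices assms by blast
qed

text \<open>An edge has two vertices, so paths sharing at most one vertex \<open>p\<close> have no
  edge in common.\<close>

lemma path_img_Int:
  assumes "distinct xs" "2 \<le> length xs" "path_edges xs \<subseteq> E" "2 \<le> length ys" "path_edges ys \<subseteq> E"
    and "set xs \<inter> set ys \<subseteq> {p}"
  shows "img (path_edges xs) \<inter> img (path_edges ys) = pos ` (set xs \<inter> set ys)"
proof -
  have "path_edges xs \<inter> path_edges ys = {}"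
  proof (rule ccontr)
    assume "\<not> ?thesis"
    then obtain e where e: "e \<in> path_edges xs" "e \<in> path_edges ys" by blast
    then have "e \<subseteq> set xs \<inter> set ys" using Union_path_edges assms by blast
    then have "e \<subseteq> {p}" using assms by blast
    then have "card e \<le> 1" using card_mono[of "{p}" e] by simp
    then show False using path_edges_card[OF assms(1) e(1)] by simp
  qed
  then show ?thesis using img_Int assms Union_path_edges by metis
qed

lemma path_arc:
  assumes "distinct xs" "2 \<le> length xs" "path_edges xs \<subseteq> E"
  shows "arc_between (pos (hd xs)) (pos (last xs)) (img (path_edges xs))"
  using assms
proof (induction xs rule: path_edges.induct)
  case (1 x y xs)
  have e: "{x, y} \<in> E" using 1 by simp
  show ?case
  proof (cases "xs = []")
    case True
    then show ?thesis using edge_arc[OF e] by (simp add: img_def)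
  next
    case False
    have IH: "arc_between (pos y) (pos (last xs)) (img (path_edges (y # xs)))"
      using 1 False by (cases xs) auto
    have "img (path_edges [x, y]) \<inter> img (path_edges (y # xs)) = pos ` (set [x, y] \<inter> set (y # xs))"
      using 1 False e by (intro path_img_Int[where p = y]) (auto simp: Suc_le_eq)
    moreover have "set [x, y] \<inter> set (y # xs) = {y}" using 1 by auto
    moreover have "img (path_edges [x, y]) = path_image (\<gamma> {x, y})" by (simp add: img_def)
    ultimately have "path_image (\<gamma> {x, y}) \<inter> img (path_edges (y # xs)) = {pos y}"
      by (metis image_empty image_insert)
    from arc_between_join[OF edge_arc[OF e] IH this] show ?thesis
      using False by (simp add: img_def)
  qed
qed auto

end

text \<open>The cycle runs through \<open>A\<close>, \<open>C\<close>, \<open>D\<close> and closes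
  from \<open>last D\<close> to \<open>hd A\<close>. Its corners \<open>hd A\<close>,
  \<open>last A\<close>, \<open>hd C\<close>, \<open>hd D\<close> appear in this cyclic order, and
  the two chords join opposite corners: a subdivision of the complete graph on four vertices, with
  \<open>A\<close>, the edge from \<open>last A\<close> to \<open>hd C\<close>, \<open>C\<close> and
  \<open>D\<close> as sides. Length at least two separates the first two corners.\<close>

lemma no_crossing_chords:
  assumes "simple_graph V E" "outerplanar V E"
    and ne: "2 \<le> length A" "C \<noteq> []" "D \<noteq> []"
    and dist: "distinct (A @ C @ D)" and "set (A @ C @ D) \<subseteq> V"
    and path: "path_edges (A @ C @ D) \<subseteq> E"
    and chords: "{last D, hd A} \<in> E" "{hd A, hd C} \<in> E" "{last A, hd D} \<in> E"
  shows False
proof -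
  obtain pos \<gamma> where pg: "plane_drawing V E pos \<gamma>"
    and front: "\<forall>v\<in>V. pos v \<in> frontier (outside (drawing_image V E pos \<gamma>))"
    using assms(2) unfolding outerplanar_def by blast
  interpret drawn_graph V E pos \<gamma> by unfold_locales fact+
  obtain a A' b where A: "A = a # A' @ [b]"
    using ne(1) by (metis One_nat_def Suc_1 Suc_le_length_iff append_butlast_last_id list.distinct(1) length_0_conv not_less_eq_eq zero_le)
  obtain c C' where C: "C = c # C'" using ne by (cases C) auto
  obtain d D' where D: "D = d # D'" using ne by (cases D) auto
  let ?P = "\<lambda>xs. img (path_edges xs)"
  have edges: "path_edges A \<subseteq> E" "{b, c} \<in> E" "path_edges (C @ [d]) \<subseteq> E" "path_edges (D @ [a]) \<subseteq> E"
    "{a, c} \<in> E" "{b, d} \<in> E"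
    using path chords unfolding A C D
    by (auto simp: path_edges_append insert_commute simp del: append_Cons)
  have arcs: "arc_between (pos a) (pos b) (?P A)" "arc_between (pos b) (pos c) (?P [b, c])"
    "arc_between (pos c) (pos d) (?P (C @ [d]))" "arc_between (pos d) (pos a) (?P (D @ [a]))"
    "arc_between (pos a) (pos c) (?P [a, c])" "arc_between (pos b) (pos d) (?P [b, d])"
    using path_arc[of A] path_arc[of "[b, c]"] path_arc[of "C @ [d]"] path_arc[of "D @ [a]"]
      path_arc[of "[a, c]"] path_arc[of "[b, d]"] edges dist
    unfolding A C D by auto
  have I: "?P xs \<inter> ?P ys = pos ` S"
    if "set xs \<inter> set ys = S" "S \<subseteq> {p}" "xs \<in> {A, [b, c], C @ [d], D @ [a], [a, c], [b, d]}"
      "ys \<in> {A, [b, c], C @ [d], D @ [a], [a, c], [b, d]}" for xs ys p S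
    unfolding that(1)[symmetric] using that dist edges
    by (intro path_img_Int[of _ _ p]) (auto simp: A C D)
  have sets: "set A \<inter> set [b, c] = {b}" "set [b, c] \<inter> set (C @ [d]) = {c}"
    "set (C @ [d]) \<inter> set (D @ [a]) = {d}" "set (D @ [a]) \<inter> set A = {a}"
    "set A \<inter> set (C @ [d]) = {}" "set [b, c] \<inter> set (D @ [a]) = {}"
    "set [a, c] \<inter> set A = {a}" "set [a, c] \<inter> set [b, c] = {c}"
    "set [a, c] \<inter> set (C @ [d]) = {c}" "set [a, c] \<inter> set (D @ [a]) = {a}"
    "set [b, d] \<inter> set A = {b}" "set [b, d] \<inter> set [b, c] = {b}"
    "set [b, d] \<inter> set (C @ [d]) = {d}" "set [b, d] \<inter> set (D @ [a]) = {d}"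
    "set [a, c] \<inter> set [b, d] = {}"
    using dist unfolding A C D by auto
  have mem: "A \<in> {A, [b, c], C @ [d], D @ [a], [a, c], [b, d]}" "[b, c] \<in> {A, [b, c], C @ [d], D @ [a], [a, c], [b, d]}" "C @ [d] \<in> {A, [b, c], C @ [d], D @ [a], [a, c], [b, d]}" "D @ [a] \<in> {A, [b, c], C @ [d], D @ [a], [a, c], [b, d]}" "[a, c] \<in> {A, [b, c], C @ [d], D @ [a], [a, c], [b, d]}" "[b, d] \<in> {A, [b, c], C @ [d], D @ [a], [a, c], [b, d]}"
    by blast+
  \<comment> \<open>All fifteen pairs, in the order in which \<open>K4_not_on_outer_face\<close>
    expects them. For an empty intersection any vertex may serve as \<open>p\<close>.\<close>
  note ints = I[OF sets(1) _ mem(1) mem(2), of b, unfolded image_insert image_empty, OF subset_refl]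
    I[OF sets(2) _ mem(2) mem(3), of c, unfolded image_insert image_empty, OF subset_refl]
    I[OF sets(3) _ mem(3) mem(4), of d, unfolded image_insert image_empty, OF subset_refl]
    I[OF sets(4) _ mem(4) mem(1), of a, unfolded image_insert image_empty, OF subset_refl]
    I[OF sets(5) _ mem(1) mem(3), of a, unfolded image_empty, OF empty_subsetI]
    I[OF sets(6) _ mem(2) mem(4), of a, unfolded image_empty, OF empty_subsetI]
    I[OF sets(7) _ mem(5) mem(1), of a, unfolded image_insert image_empty, OF subset_refl]
    I[OF sets(8) _ mem(5) mem(2), of c, unfolded image_insert image_empty, OF subset_refl]
    I[OF sets(9) _ mem(5) mem(3), of c, unfolded image_insert image_empty, OF subset_refl]
    I[OF sets(10) _ mem(5) mem(4), of a, unfolded image_insert image_empty, OF subset_refl]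
    I[OF sets(11) _ mem(6) mem(1), of b, unfolded image_insert image_empty, OF subset_refl]
    I[OF sets(12) _ mem(6) mem(2), of b, unfolded image_insert image_empty, OF subset_refl]
    I[OF sets(13) _ mem(6) mem(3), of d, unfolded image_insert image_empty, OF subset_refl]
    I[OF sets(14) _ mem(6) mem(4), of d, unfolded image_insert image_empty, OF subset_refl]
    I[OF sets(15) _ mem(5) mem(6), of a, unfolded image_empty, OF empty_subsetI]
  have "?P A \<union> ?P [b, c] \<union> ?P (C @ [d]) \<union> ?P (D @ [a]) \<union> ?P [a, c] \<union> ?P [b, d]
    \<subseteq> drawing_image V E pos \<gamma>"
    using edges unfolding img_def drawing_image_def by auto
  moreover have "{pos a, pos b, pos c, pos d} \<subseteq> frontier (outside (drawing_image V E pos \<gamma>))"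
    using front assms(7) unfolding A C D by simp
  ultimately show False
    using K4_not_on_outer_face[OF arcs ints] by blast
qed

text \<open>Minimality of the chord index \<open>i\<close> ranges over all longest paths. It
  therefore also constrains the path obtained by reversing the segment before \<open>w ! i\<close>,
  and so both ends of that segment have a neighbor strictly beyond \<open>w ! i\<close>.\<close>

lemma outerplanar_low_degree:
  assumes sg: "simple_graph V E" and op: "outerplanar V E" and "V \<noteq> {}"
  shows "\<exists>v\<in>V. card {u. {u, v} \<in> E} \<le> 2"
proof (rule ccontr)
  assume "\<not> ?thesis"
  then have deg: "card {u. {u, v} \<in> E} > 2" if "v \<in> V" for v using that by force
  have finV: "finite V" and edge: "\<And>u v. {u, v} \<in> E \<Longrightarrow> u \<in> V \<and> v \<in> V \<and> u \<noteq> v"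
    using sg unfolding simple_graph_def by (auto dest!: bspec)
  define paths where "paths = {w. w \<noteq> [] \<and> distinct w \<and> set w \<subseteq> V \<and> path_edges w \<subseteq> E}"
  define longest where "longest w \<longleftrightarrow> w \<in> paths \<and> (\<forall>w'\<in>paths. length w' \<le> length w)" for w
  have bnd: "length w \<le> card V" if "w \<in> paths" for w
    using that finV card_mono[of V "set w"] distinct_card[of w] unfolding paths_def by simp
  obtain v0 where "v0 \<in> V" using \<open>V \<noteq> {}\<close> by blast
  then have "[v0] \<in> paths" unfolding paths_def by simp
  then obtain w0 where "longest w0"
    using ex_has_greatest_nat[of "\<lambda>w. w \<in> paths" "[v0]" length "Suc (card V)"] bnd
    unfolding longest_def by (auto simp: less_Suc_eq_le)
  have nbrs: "u \<in> set w" if "longest w" "{u, hd w} \<in> E" for u w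
  proof (rule ccontr)
    assume "u \<notin> set w"
    then have "u # w \<in> paths"
      using that edge[OF that(2)] unfolding longest_def paths_def by (cases w) auto
    then show False using that(1) unfolding longest_def by fastforce
  qed
  \<comment> \<open>The head has at least three neighbors, all on the path by maximality, so one of
    them avoids the two positions 1 and \<open>i\<close>.\<close>
  have third: "\<exists>j<length w. j \<noteq> 0 \<and> j \<noteq> 1 \<and> j \<noteq> i \<and> {w ! 0, w ! j} \<in> E" if "longest w" for w i
  proof (rule ccontr)
    assume n: "\<not> ?thesis"
    have w: "w \<noteq> []" "hd w \<in> V" using that unfolding longest_def paths_def by (cases w; auto)+
    have "{u. {u, hd w} \<in> E} \<subseteq> {w ! 1, w ! i}"
    proof
      fix u assume "u \<in> {u. {u, hd w} \<in> E}"
      then have e: "{u, hd w} \<in> E" by simp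
      then obtain j where j: "j < length w" "w ! j = u" using nbrs[OF \<open>longest w\<close> e] by (meson in_set_conv_nth)
      have "j \<noteq> 0" using edge[OF e] j w by (metis hd_conv_nth)
      then show "u \<in> {w ! 1, w ! i}" using n j e w by (auto simp: hd_conv_nth insert_commute)
    qed
    then have "card {u. {u, hd w} \<in> E} \<le> card {w ! 1, w ! i}" by (intro card_mono) auto
    also have "\<dots> \<le> 2" by (simp add: card_insert_if)
    finally show False using deg[OF w(2)] by simp
  qed
  define chord where "chord w i \<longleftrightarrow> longest w \<and> 2 \<le> i \<and> i < length w \<and> {w ! 0, w ! i} \<in> E" for w i
  have "\<exists>i w. chord w i"
    using third[OF \<open>longest w0\<close>, of 1] \<open>longest w0\<close> unfolding chord_def
    by (metis One_nat_def Suc_1 less_2_cases_iff not_less)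
  then obtain i w where iw: "chord w i" and min: "\<And>i' w'. chord w' i' \<Longrightarrow> i \<le> i'"
    using exists_least_iff[of "\<lambda>i. \<exists>w. chord w i"] by (meson not_less)
  have lw: "longest w" and i: "2 \<le> i" "i < length w" "{w ! 0, w ! i} \<in> E"
    using iw unfolding chord_def by auto
  have wp: "distinct w" "set w \<subseteq> V" "path_edges w \<subseteq> E" "w \<noteq> []"
    using lw unfolding longest_def paths_def by auto
  define A where "A = take i w"
  have A: "length A = i" "2 \<le> length A" "A \<noteq> []" "hd A = w ! 0" "last A = w ! (i - 1)"
    using i wp(4) unfolding A_def by (auto simp: hd_conv_nth last_conv_nth)
  have splitw: "w = A @ drop i w" unfolding A_def by simp
  have hdw: "hd (drop i w) = w ! i" "drop i w \<noteq> []" using i by (auto simp: hd_drop_conv_nth)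
  have pe: "path_edges A \<subseteq> E" "{w ! (i - 1), w ! i} \<in> E" "path_edges (drop i w) \<subseteq> E"
    using wp(3) path_edges_append[OF A(3) hdw(2)] hdw A(5) splitw by auto
  \<comment> \<open>A Posa rotation: the chord to \<open>w ! i\<close> permits the initial segment
    to be traversed backwards. From index \<open>i\<close> on the path is unchanged, so chord
    indices of \<open>w\<close> and \<open>w'\<close> refer to the same vertices.\<close>
  define w' where "w' = rev A @ drop i w"
  have hr: "hd (rev A) = w ! (i - 1)" "last (rev A) = w ! 0" "rev A \<noteq> []"
    using A by (auto simp: hd_rev last_rev)
  have wA: "distinct A" "set A \<subseteq> V" "distinct (drop i w)" "set (drop i w) \<subseteq> V" "set A \<inter> set (drop i w) = {}"
    using wp(1,2) unfolding A_def
    by (auto simp: set_take_disj_set_drop_if_distinct dest: in_set_takeD in_set_dropD)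
  have "path_edges w' = insert {w ! 0, w ! i} (path_edges A \<union> path_edges (drop i w))"
    unfolding w'_def path_edges_append[OF hr(3) hdw(2)] hr hdw path_edges_rev ..
  then have "w' \<in> paths"
    unfolding paths_def w'_def using wA pe i(3) A(3) by simp
  then have lw': "longest w'" using lw splitw unfolding longest_def w'_def
    by (metis length_append length_rev)
  have w'n: "w' ! 0 = w ! (i - 1)" "\<And>l. i \<le> l \<Longrightarrow> l < length w \<Longrightarrow> w' ! l = w ! l" "length w' = length w"
    using hr A i splitw unfolding w'_def
    by (auto simp: nth_append hd_conv_nth)
  obtain j where j: "j < length w" "j \<noteq> 0" "j \<noteq> 1" "j \<noteq> i" "{w ! 0, w ! j} \<in> E"
    using third[OF lw] by blast
  then have "chord w j" unfolding chord_def using lw by auto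
  then have ij: "i < j" using min j by force
  obtain l where l: "l < length w'" "l \<noteq> 0" "l \<noteq> 1" "l \<noteq> i" "{w' ! 0, w' ! l} \<in> E"
    using third[OF lw'] by blast
  then have "chord w' l" unfolding chord_def using lw' by auto
  then have il: "i < l" using min l by force
  have le: "{w ! (i - 1), w ! l} \<in> E" using l w'n il by auto
  \<comment> \<open>The farther neighbor \<open>w ! q\<close> closes the cycle at
    \<open>hd B\<close>, and the nearer one \<open>w ! p\<close> is the chord end of
    \<open>last B\<close>. The strict \<open>i < p\<close> leaves a nonempty \<open>C\<close>
    between them; for \<open>p = q\<close> the part \<open>D\<close> is a single vertex.\<close>
  have mid: "False" if "i < p" "p \<le> q" "q < length w" "B = A \<or> B = rev A"
    "{hd B, w ! q} \<in> E" "{last B, w ! p} \<in> E" for p q B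
  proof -
    define C where "C = take (p - i) (drop i w)"
    define D where "D = take (q + 1 - p) (drop p w)"
    have CD: "C @ D = take (q + 1 - i) (drop i w)"
      unfolding C_def D_def using that take_add[of "p - i" "q + 1 - p" "drop i w"] by simp
    have ne: "C \<noteq> []" "D \<noteq> []" unfolding C_def D_def using that i by auto
    have hds: "hd C = w ! i" "hd D = w ! p" "last D = w ! q"
      unfolding C_def D_def using that i
      by (auto simp: hd_drop_conv_nth last_conv_nth)
    have B: "distinct B" "set B = set A" "2 \<le> length B" "B \<noteq> []" "path_edges B \<subseteq> E" "{last B, w ! i} \<in> E" "{hd B, w ! i} \<in> E"
      using that(4) A hr pe i(3) path_edges_rev[of A] wp(1) by (auto simp: A_def)
    have sub: "set (C @ D) \<subseteq> set (drop i w)" unfolding CD by (rule set_take_subset)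
    have dis: "set A \<inter> set (drop i w) = {}" unfolding A_def
      using set_take_disj_set_drop_if_distinct wp(1) by blast
    have "path_edges (drop i w) = path_edges ((C @ D) @ drop (q + 1 - i) (drop i w))"
      unfolding CD by (simp only: append_take_drop_id)
    then have "path_edges (C @ D) \<subseteq> E"
      using pe(3) ne path_edges_append[of "C @ D" "drop (q + 1 - i) (drop i w)"]
      by (cases "drop (q + 1 - i) (drop i w) = []") auto
    then have p: "path_edges (B @ C @ D) \<subseteq> E"
      using path_edges_append[of B "C @ D"] ne B hds by auto
    have "distinct (C @ D)" unfolding CD using wp(1) by simp
    then have d: "distinct (B @ C @ D)" using B sub dis by auto
    have "set A \<subseteq> V" "set (drop i w) \<subseteq> V" using wp(2) unfolding A_def
      by (meson set_take_subset set_drop_subset subset_trans)+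
    then have "set (B @ C @ D) \<subseteq> V" using B sub by auto
    then show False
      using no_crossing_chords[OF sg op B(3) ne d _ p] that(5,6) B hds by (simp add: insert_commute)
  qed
  show False
  \<comment> \<open>The end of the segment with the farther neighbor has to be the head of the
    cycle, so the segment is reversed if \<open>w ! (i - 1)\<close> reaches beyond
    \<open>w ! j\<close>.\<close>
  proof (cases "l \<le> j")
    case True
    then show ?thesis using mid[of l j A] il j A le by simp
  next
    case False
    then show ?thesis using mid[of j l "rev A"] ij l hr le w'n j by simp
  qed
qed

text \<open>The new edge follows the two old arcs through the place of \<open>v\<close>. The drawing
  thus only loses points and its outer face only grows; a remaining vertex stays in the closure of
  that face and lies on the drawing, hence on the frontier.\<close>

lemma outerplanar_eliminate:
  assumes sg: "simple_graph V E" and op: "outerplanar V E"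
    and F: "F \<subseteq> {e \<in> E. v \<notin> e} \<union> {e. \<exists>a b. e = {a, b} \<and> a \<noteq> b \<and> {u. {u, v} \<in> E} = {a, b}}"
  shows "outerplanar (V - {v}) F"
proof -
  obtain pos \<gamma> where pd: "plane_drawing V E pos \<gamma>"
    and front: "\<forall>v\<in>V. pos v \<in> frontier (outside (drawing_image V E pos \<gamma>))"
    using op unfolding outerplanar_def by blast
  interpret drawn_graph V E pos \<gamma> by unfold_locales fact+
  have edge: "\<And>u v. {u, v} \<in> E \<Longrightarrow> u \<in> V \<and> v \<in> V \<and> u \<noteq> v"
    using sg unfolding simple_graph_def by (auto dest!: bspec)
  define N where "N = {u. {u, v} \<in> E}"
  have new: "\<exists>g. arc g \<and> {pathstart g, pathfinish g} = pos ` e \<and>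
      path_image g = img {f \<in> E. v \<in> f} \<and> e \<subseteq> V - {v} \<and> \<Union>{f \<in> E. v \<in> f} = insert v e"
    if e: "e \<in> F" "e \<notin> E" for e
  proof -
    from e F obtain a b where ab: "e = {a, b}" "a \<noteq> b" "N = {a, b}" unfolding N_def by blast
    have E: "{a, v} \<in> E" "{b, v} \<in> E" using ab(3) unfolding N_def by blast+
    have fe: "{f \<in> E. v \<in> f} = {{a, v}, {b, v}}"
    proof (intro equalityI subsetI)
      fix f assume f: "f \<in> {f \<in> E. v \<in> f}"
      then have "card f = 2" using sg unfolding simple_graph_def by blast
      then obtain u where "f = {u, v}" using f by (auto simp: card_2_iff insert_commute)
      then have "u \<in> N" using f unfolding N_def by simp
      then show "f \<in> {{a, v}, {b, v}}" using ab \<open>f = {u, v}\<close> by auto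
    qed (use E in auto)
    have "distinct [a, v, b]" using ab(2) edge[OF E(1)] edge[OF E(2)] by auto
    then have "arc_between (pos a) (pos b) (img (path_edges [a, v, b]))"
      using path_arc[of "[a, v, b]"] E by (simp add: insert_commute)
    moreover have "path_edges [a, v, b] = {f \<in> E. v \<in> f}"
      unfolding fe by (simp add: insert_commute)
    ultimately obtain g where "arc g" "pathstart g = pos a" "pathfinish g = pos b"
      "path_image g = img {f \<in> E. v \<in> f}"
      unfolding arc_between_def by metis
    moreover have "e \<subseteq> V - {v}" using ab(1) edge[OF E(1)] edge[OF E(2)] by blast
    moreover have "\<Union>{f \<in> E. v \<in> f} = insert v e" unfolding fe ab(1) by blast
    ultimately show ?thesis using ab(1) by (intro exI[of _ g]) simp
  qed
  \<comment> \<open>If the neighbors of \<open>v\<close> were adjacent before, their edge keeps its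
    old arc; only a missing edge takes the detour.\<close>
  define \<delta> where "\<delta> e = (if e \<in> E then \<gamma> e else SOME g. arc g \<and> {pathstart g, pathfinish g} = pos ` e \<and>
      path_image g = img {f \<in> E. v \<in> f})" for e
  have old: "\<delta> e = \<gamma> e" if "e \<in> E" for e using that by (simp add: \<delta>_def)
  have \<delta>: "arc (\<delta> e)" "{pathstart (\<delta> e), pathfinish (\<delta> e)} = pos ` e" "path_image (\<delta> e) = img {f \<in> E. v \<in> f}"
     "e \<subseteq> V - {v}" "\<Union>{f \<in> E. v \<in> f} = insert v e"
    if e: "e \<in> F" "e \<notin> E" for e
    using someI_ex[of "\<lambda>g. arc g \<and> {pathstart g, pathfinish g} = pos ` e \<and>
      path_image g = img {f \<in> E. v \<in> f}"] new[OF e] e(2) by (auto simp: \<delta>_def)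
  have Fold: "v \<notin> e" if "e \<in> F" "e \<in> E" for e
    using that F edge by blast
  have subV: "e \<subseteq> V - {v}" if "e \<in> F" for e
    using that Fold \<delta>(4) sg unfolding simple_graph_def by (cases "e \<in> E") auto
  have injp: "inj_on pos V" using pd unfolding plane_drawing_def by blast
  have meet: "path_image (\<gamma> e) \<inter> pos ` V = pos ` e" if "e \<in> E" for e
    using pd that unfolding plane_drawing_def by blast
  have "plane_drawing (V - {v}) F pos \<delta>"
    unfolding plane_drawing_def
  proof (intro conjI ballI impI)
    show "inj_on pos (V - {v})" using injp by (rule inj_on_subset) blast
  next
    fix e assume e: "e \<in> F"
    show "arc (\<delta> e)" using e \<delta> old pd unfolding plane_drawing_def by (cases "e \<in> E") auto
    show "{pathstart (\<delta> e), pathfinish (\<delta> e)} = pos ` e"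
      using e \<delta> old pd unfolding plane_drawing_def by (cases "e \<in> E") auto
    show "path_image (\<delta> e) \<inter> pos ` (V - {v}) = pos ` e"
    proof (cases "e \<in> E")
      case True
      have "pos ` e \<subseteq> pos ` (V - {v})" using subV[OF e] by (rule image_mono)
      then show ?thesis unfolding old[OF True] using meet[OF True] by blast
    next
      case False
      \<comment> \<open>The detour also passes through \<open>pos v\<close>, which injectivity keeps
        apart from the remaining vertices.\<close>
      have "path_image (\<delta> e) \<inter> pos ` V = (\<Union>f\<in>{f \<in> E. v \<in> f}. path_image (\<gamma> f) \<inter> pos ` V)"
        unfolding \<delta>(3)[OF e False] img_def by blast
      also have "\<dots> = (\<Union>f\<in>{f \<in> E. v \<in> f}. pos ` f)"
        by (rule SUP_cong) (use meet in auto)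
      also have "\<dots> = pos ` insert v e"
        unfolding \<delta>(5)[OF e False, symmetric] by blast
      finally have "path_image (\<delta> e) \<inter> pos ` V = pos ` insert v e" .
      moreover have "pos v \<notin> pos ` (V - {v})"
      proof -
        have "insert v e \<subseteq> V"
          unfolding \<delta>(5)[OF e False, symmetric] using sg unfolding simple_graph_def by blast
        then show ?thesis using inj_on_image_mem_iff[OF injp, of v "V - {v}"] by simp
      qed
      moreover have "pos ` e \<subseteq> pos ` (V - {v})" using subV[OF e] by (rule image_mono)
      moreover have "pos ` (V - {v}) \<subseteq> pos ` V" by blast
      moreover have "X \<inter> A' = B" if "X \<inter> A = insert q B" "q \<notin> A'" "B \<subseteq> A'" "A' \<subseteq> A"
        for X A A' B :: "complex set" and q
        using that(2-4) equalityD1[OF that(1)] equalityD2[OF that(1)] by blast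
      ultimately show ?thesis unfolding image_insert by meson
    qed
  next
    fix e f assume ef: "e \<in> F" "f \<in> F" "e \<noteq> f"
    have mix: "path_image (\<delta> e) \<inter> path_image (\<delta> f) \<subseteq> pos ` (e \<inter> f)"
      if "e \<in> F" "f \<in> F" "e \<in> E" "f \<notin> E" for e f
    proof -
      have "img {e} \<inter> img {f \<in> E. v \<in> f} = pos ` (\<Union>{e} \<inter> \<Union>{f \<in> E. v \<in> f})"
        by (rule img_Int) (use that(3) Fold[OF that(1,3)] in auto)
      moreover have "img {e} = path_image (\<delta> e)" unfolding img_def old[OF that(3)] by simp
      moreover have "\<Union>{e} \<inter> \<Union>{f \<in> E. v \<in> f} = e \<inter> f"
        unfolding \<delta>(5)[OF that(2,4)] using Fold[OF that(1,3)] by simp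
      ultimately show ?thesis unfolding \<delta>(3)[OF that(2,4)] by simp
    qed
    show "path_image (\<delta> e) \<inter> path_image (\<delta> f) \<subseteq> pos ` (e \<inter> f)"
    proof (cases "e \<in> E"; cases "f \<in> E")
      assume "e \<in> E" "f \<in> E"
      then show ?thesis using ef(3) old pd unfolding plane_drawing_def by metis
    next
      assume "e \<in> E" "f \<notin> E"
      then show ?thesis using mix ef by blast
    next
      assume "e \<notin> E" "f \<in> E"
      then show ?thesis using mix[of f e] ef by (simp add: Int_commute)
    next
      assume "e \<notin> E" "f \<notin> E"
      \<comment> \<open>Two new edges would both consist of the neighbors of \<open>v\<close>, so
        they coincide.\<close>
      then have "insert v e = insert v f" using \<delta>(5) ef(1,2) by metis
      moreover have "v \<notin> e" "v \<notin> f" using subV ef(1,2) by blast+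
      ultimately show ?thesis using ef(3) by (metis insert_ident)
    qed
  qed
  moreover have "pos u \<in> frontier (outside (drawing_image (V - {v}) F pos \<delta>))" if u: "u \<in> V - {v}" for u
  proof -
    let ?K = "drawing_image V E pos \<gamma>" and ?L = "drawing_image (V - {v}) F pos \<delta>"
    have "path_image (\<delta> e) \<subseteq> \<Union>(path_image ` \<gamma> ` E)" if "e \<in> F" for e
      using old[of e] \<delta>(3)[OF that] unfolding img_def by (cases "e \<in> E") auto
    then have "?L \<subseteq> ?K" unfolding drawing_image_def by blast
    then have "outside ?K \<subseteq> outside ?L" by (rule outside_mono)
    then have "pos u \<in> closure (outside ?L)"
      using front u closure_mono[of "outside ?K" "outside ?L"] unfolding frontier_def by blast
    moreover have "pos u \<in> ?L" using u unfolding drawing_image_def by blast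
    ultimately show ?thesis
      unfolding frontier_def using interior_subset[of "outside ?L"] outside_no_overlap[of ?L] by blast
  qed
  ultimately show ?thesis unfolding outerplanar_def by blast
qed

section \<open>Programs over bounded arrays\<close>

text \<open>An intermediate language with separate arrays, so that address arithmetic, overflow and
  timing are settled once, for the compiler, instead of in each program.\<close>

datatype hexp =
    Num nat
  | Size
  | Inp hexp
  | Arr nat hexp hexp hexp hexp
  | Plus hexp hexp
  | Minus hexp hexp
  | Times hexp hexp
  | Div hexp hexp

datatype cmd =
    Assign nat hexp hexp hexp hexp hexp
  | Output hexp hexp
  | Nop
  | Then cmd cmd
  | If hexp cmd cmd
  | For nat nat cmd

type_synonym arrays = "nat \<times> nat \<times> nat \<times> nat \<times> nat \<Rightarrow> nat"

text \<open>Array \<open>t < 32\<close> has four indices below \<open>index_bound n\<close>. Array \<open>32\<close> stands for the input cells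
  \<open>1, \<dots>, n\<^sup>2\<close>, above which all other arrays are stored. \<open>For r q c\<close> runs \<open>c\<close> with counter \<open>r\<close> from
  \<open>0\<close> to \<open>q * n - 1\<close>, so that the running time depends on \<open>n\<close> only.\<close>

definition index_bound :: "nat \<Rightarrow> nat" where
  "index_bound n = 9 * n + 9"

text \<open>Bounds the contents of cells; intermediate results are bounded by powers of it. Stored
  numbers are of order n^4, and sixteen further factors of at least 2 absorb the constants, even for
  small \<open>n\<close>.\<close>

definition value_bound :: "nat \<Rightarrow> nat" where
  "value_bound n = (n + 2) ^ 20"

definition address :: "nat \<Rightarrow> nat \<Rightarrow> nat \<Rightarrow> nat \<Rightarrow> nat \<Rightarrow> nat \<Rightarrow> nat" where
  "address n t a b c d = n * n + 1 +
     (t + 32 * (a + index_bound n * (b + index_bound n * (c + index_bound n * d))))"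

text \<open>The bound is imposed on every cell, so a read stays within the word size whatever its
  address.\<close>

definition represents :: "nat \<Rightarrow> mem \<Rightarrow> arrays \<Rightarrow> bool" where
  "represents n s h \<longleftrightarrow> s 0 = n \<and> (\<forall>i. s i < value_bound n) \<and>
     (\<forall>i\<in>{1..n * n}. s i = h (32, i, 0, 0, 0)) \<and>
     (\<forall>t<32. \<forall>a<index_bound n. \<forall>b<index_bound n. \<forall>c<index_bound n. \<forall>d<index_bound n.
        s (address n t a b c d) = h (t, a, b, c, d))"

fun hval :: "nat \<Rightarrow> hexp \<Rightarrow> arrays \<Rightarrow> nat" where
  "hval n (Num m) h = m"
| "hval n Size h = n"
| "hval n (Inp e) h = h (32, hval n e h, 0, 0, 0)"
| "hval n (Arr t a b c d) h = h (t, hval n a h, hval n b h, hval n c h, hval n d h)"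
| "hval n (Plus a b) h = hval n a h + hval n b h"
| "hval n (Minus a b) h = hval n a h - hval n b h"
| "hval n (Times a b) h = hval n a h * hval n b h"
| "hval n (Div a b) h = hval n a h div hval n b h"

fun hsafe :: "nat \<Rightarrow> hexp \<Rightarrow> arrays \<Rightarrow> bool" where
  "hsafe n (Num m) h \<longleftrightarrow> True"
| "hsafe n Size h \<longleftrightarrow> True"
| "hsafe n (Inp e) h \<longleftrightarrow> hsafe n e h \<and> hval n e h \<in> {1..n * n}"
| "hsafe n (Arr t a b c d) h \<longleftrightarrow> t < 32 \<and> hsafe n a h \<and> hsafe n b h \<and> hsafe n c h \<and> hsafe n d h \<and>
    hval n a h < index_bound n \<and> hval n b h < index_bound n \<and> hval n c h < index_bound n \<and>
    hval n d h < index_bound n"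
| "hsafe n (Plus a b) h \<longleftrightarrow> hsafe n a h \<and> hsafe n b h"
| "hsafe n (Minus a b) h \<longleftrightarrow> hsafe n a h \<and> hsafe n b h"
| "hsafe n (Times a b) h \<longleftrightarrow> hsafe n a h \<and> hsafe n b h"
| "hsafe n (Div a b) h \<longleftrightarrow> hsafe n a h \<and> hsafe n b h"

abbreviation "cell0 \<equiv> Cell (Lit 0)"

definition bound_expr :: aexp where
  "bound_expr = Add (Mul (Lit 9) cell0) (Lit 9)"

definition address_expr :: "nat \<Rightarrow> aexp \<Rightarrow> aexp \<Rightarrow> aexp \<Rightarrow> aexp \<Rightarrow> aexp" where
  "address_expr t a b c d = Add (Add (Mul cell0 cell0) (Lit 1))
     (Add (Lit t) (Mul (Lit 32) (Add a (Mul bound_expr (Add b (Mul bound_expr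
       (Add c (Mul bound_expr d))))))))"

abbreviation "counter_expr r \<equiv> address_expr r (Lit 0) (Lit 0) (Lit 0) (Lit 0)"

fun compile_exp :: "hexp \<Rightarrow> aexp" where
  "compile_exp (Num m) = Lit m"
| "compile_exp Size = cell0"
| "compile_exp (Inp e) = Cell (compile_exp e)"
| "compile_exp (Arr t a b c d) =
    Cell (address_expr t (compile_exp a) (compile_exp b) (compile_exp c) (compile_exp d))"
| "compile_exp (Plus a b) = Add (compile_exp a) (compile_exp b)"
| "compile_exp (Minus a b) = Sub (compile_exp a) (compile_exp b)"
| "compile_exp (Times a b) = Mul (compile_exp a) (compile_exp b)"
| "compile_exp (Div a b) = Quot (compile_exp a) (compile_exp b)"

abbreviation "for_cond r q \<equiv> Sub (Mul (Lit q) cell0) (Cell (counter_expr r))"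
abbreviation "for_step r \<equiv> Add (Cell (counter_expr r)) (Lit 1)"

fun compile :: "cmd \<Rightarrow> prog" where
  "compile (Assign t a b c d e) =
    Store (address_expr t (compile_exp a) (compile_exp b) (compile_exp c) (compile_exp d)) (compile_exp e)"
| "compile (Output a e) = Store (compile_exp a) (compile_exp e)"
| "compile Nop = Skip"
| "compile (Then p q) = Seq (compile p) (compile q)"
| "compile (If e p q) = Cond (compile_exp e) (compile p) (compile q)"
| "compile (For r q p) = Seq (Store (counter_expr r) (Lit 0))
    (Loop (for_cond r q) (Seq (compile p) (Store (counter_expr r) (for_step r))))"

fun cost :: "nat \<Rightarrow> cmd \<Rightarrow> nat" where
  "cost n (Assign t a b c d e) =
    acost (address_expr t (compile_exp a) (compile_exp b) (compile_exp c) (compile_exp d)) +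
    acost (compile_exp e) + 1"
| "cost n (Output a e) = acost (compile_exp a) + acost (compile_exp e) + 1"
| "cost n Nop = 1"
| "cost n (Then p q) = cost n p + cost n q"
| "cost n (If e p q) = acost (compile_exp e) + 1 + (cost n p + cost n q)"
| "cost n (For r q p) = (acost (counter_expr r) + 2) +
    (q * n * (acost (for_cond r q) + 1 + (cost n p + (acost (counter_expr r) + acost (for_step r) + 1))) +
     (acost (for_cond r q) + 1))"

section \<open>Running time of compiled programs\<close>

fun depth :: "cmd \<Rightarrow> nat" where
  "depth (Then p q) = max (depth p) (depth q)"
| "depth (If e p q) = max (depth p) (depth q)"
| "depth (For r q p) = Suc (depth p)"
| "depth _ = 0"

text \<open>Every loop makes \<open>q * n\<close> rounds and a conditional is charged for both
  branches, so the degree is the nesting depth of loops, a property of the program text.\<close>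

lemma cost_polynomial: "\<exists>C. \<forall>n. cost n c \<le> C * (n + 1) ^ depth c"
proof (induction c)
  case (Then p q)
  then obtain C D where CD: "\<forall>n. cost n p \<le> C * (n + 1) ^ depth p" "\<forall>n. cost n q \<le> D * (n + 1) ^ depth q"
    by blast
  have "cost n (Then p q) \<le> (C + D) * (n + 1) ^ depth (Then p q)" for n
  proof -
    have "C * (n + 1) ^ depth p \<le> C * (n + 1) ^ max (depth p) (depth q)"
      "D * (n + 1) ^ depth q \<le> D * (n + 1) ^ max (depth p) (depth q)"
      by (intro mult_left_mono power_increasing; simp)+
    then show ?thesis using CD[THEN spec[of _ n]] unfolding cost.simps depth.simps distrib_right
      by linarith
  qed
  then show ?case by blast
next
  case (If e p q)
  then obtain C D where CD: "\<forall>n. cost n p \<le> C * (n + 1) ^ depth p" "\<forall>n. cost n q \<le> D * (n + 1) ^ depth q"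
    by blast
  define K where "K = acost (compile_exp e) + 1"
  have "cost n (If e p q) \<le> (K + (C + D)) * (n + 1) ^ depth (If e p q)" for n
  proof -
    have "C * (n + 1) ^ depth p \<le> C * (n + 1) ^ max (depth p) (depth q)"
      "D * (n + 1) ^ depth q \<le> D * (n + 1) ^ max (depth p) (depth q)"
      by (intro mult_left_mono power_increasing; simp)+
    moreover have "K * 1 \<le> K * (n + 1) ^ max (depth p) (depth q)" by (intro mult_left_mono) simp_all
    ultimately show ?thesis using CD[THEN spec[of _ n]] unfolding cost.simps depth.simps distrib_right K_def[symmetric]
      by linarith
  qed
  then show ?case by blast
next
  case (For r q p)
  then obtain C where C: "\<forall>n. cost n p \<le> C * (n + 1) ^ depth p" by blast
  define K L where "K = acost (counter_expr r) + 2 + (acost (for_cond r q) + 1)"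
    and "L = acost (for_cond r q) + 1 + (acost (counter_expr r) + acost (for_step r) + 1)"
  have "cost n (For r q p) \<le> (K + q * (L + C)) * (n + 1) ^ depth (For r q p)" for n
  proof -
    let ?P = "(n + 1) ^ depth p"
    have P: "1 \<le> ?P" by simp
    have "cost n (For r q p) = K + q * n * (L + cost n p)"
      by (simp add: K_def L_def algebra_simps)
    also have "\<dots> \<le> K * ((n + 1) * ?P) + q * (n + 1) * ((L + C) * ?P)"
    proof (intro add_mono mult_mono)
      have "K * 1 \<le> K * ((n + 1) * ?P)" using mult_le_mono[OF _ P, of 1 "n + 1"] by (intro mult_left_mono) simp_all
      then show "K \<le> K * ((n + 1) * ?P)" by simp
      have "L * 1 \<le> L * ?P" using P by (intro mult_left_mono) simp_all
      then show "L + cost n p \<le> (L + C) * ?P" using C by (simp add: distrib_right add_mono)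
    qed simp_all
    finally show ?thesis by (simp add: algebra_simps)
  qed
  then show ?case by blast
qed (simp_all only: depth.simps cost.simps power_0 mult_1_right; blast)+

section \<open>Word sizes\<close>

fun asize :: "aexp \<Rightarrow> nat" where
  "asize (Lit m) = m + 1"
| "asize (Cell a) = asize a + 1"
| "asize (Add a b) = asize a + asize b"
| "asize (Sub a b) = asize a + asize b"
| "asize (Mul a b) = asize a + asize b"
| "asize (Quot a b) = asize a + asize b"

lemma asize_pos: "0 < asize a"
  by (induction a) auto

text \<open>\<open>asize\<close> is an exponent independent of the memory. A literal
  \<open>m\<close> costs \<open>m + 1\<close> because \<open>m < 2 ^ m\<close>. Sums as well as
  products add exponents, since a sum of numbers that are at least 2 is at most their
  product.\<close>

lemma fits_bounded:
  assumes X: "4 \<le> X" and s: "\<forall>i. s i < X"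
  shows "X ^ asize a \<le> B \<Longrightarrow> aval a s < X ^ asize a \<and> fits B a s"
proof (induction a arbitrary: B)
  case (Lit m)
  have "m < 2 ^ m" by (rule less_exp)
  also have "\<dots> \<le> X ^ m" using X by (intro power_mono) auto
  also have "\<dots> \<le> X ^ (m + 1)" using X by (intro power_increasing) auto
  finally show ?case using Lit by simp
next
  case (Cell a)
  have le: "X ^ asize a \<le> X ^ (asize a + 1)" "X ^ 1 \<le> X ^ (asize a + 1)"
    using X by (intro power_increasing; simp)+
  then have "X ^ asize a \<le> B" "X \<le> B" using order_trans[OF le(1)] order_trans[OF le(2)] Cell.prems by simp_all
  then have "fits B a s" "s (aval a s) < B" "s (aval a s) < X" using Cell.IH s less_le_trans by blast+
  then show ?case using le(2) by (auto intro: less_le_trans)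
next
  case (Add a b)
  have le: "X ^ asize a \<le> X ^ (asize a + asize b)" "X ^ asize b \<le> X ^ (asize a + asize b)"
    using X by (intro power_increasing; simp)+
  have "X ^ 1 \<le> X ^ asize a" "X ^ 1 \<le> X ^ asize b"
    using X asize_pos[of a] asize_pos[of b] by (intro power_increasing; simp)+
  then have "2 \<le> X ^ asize a" "2 \<le> X ^ asize b" using X by auto
  then have "X ^ asize a + X ^ asize b \<le> X ^ asize a * X ^ asize b"
    by (auto simp: le_iff_add algebra_simps)
  then have "aval a s + aval b s < X ^ (asize a + asize b)"
    using Add.IH(1)[of "X ^ asize a"] Add.IH(2)[of "X ^ asize b"] by (simp add: power_add)
  then show ?case using Add le by auto
next
  case (Sub a b)
  have le: "X ^ asize a \<le> X ^ (asize a + asize b)" "X ^ asize b \<le> X ^ (asize a + asize b)"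
    using X by (intro power_increasing; simp)+
  then show ?case using Sub.IH(1)[of B] Sub.IH(2)[of B] Sub.prems by auto
next
  case (Mul a b)
  have le: "X ^ asize a \<le> X ^ (asize a + asize b)" "X ^ asize b \<le> X ^ (asize a + asize b)"
    using X by (intro power_increasing; simp)+
  have "aval a s * aval b s < X ^ (asize a + asize b)"
    using Mul.IH(1)[of "X ^ asize a"] Mul.IH(2)[of "X ^ asize b"] unfolding power_add
    by (intro mult_strict_mono) (use X in auto)
  then show ?case using Mul le by auto
next
  case (Quot a b)
  have le: "X ^ asize a \<le> X ^ (asize a + asize b)" "X ^ asize b \<le> X ^ (asize a + asize b)"
    using X by (intro power_increasing; simp)+
  have "aval a s div aval b s \<le> aval a s" by simp
  then show ?case
    using Quot.IH(1)[of B] Quot.IH(2)[of B] Quot.prems le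
    by (auto intro: le_less_trans[OF div_le_dividend])
qed

lemma value_bound_ge: "4 \<le> value_bound n" "n < value_bound n" "9 * n < value_bound n"
proof -
  have "2 ^ 19 \<le> (n + 2) ^ 19" by (rule power_mono) simp_all
  then have "2 ^ 19 * (n + 2) \<le> (n + 2) ^ 19 * (n + 2)" by (rule mult_right_mono) simp
  also have "\<dots> = value_bound n"
    unfolding value_bound_def by (metis power_Suc2 eval_nat_numeral(2,3) semiring_norm(26,27,28))
  finally have "2 ^ 19 * (n + 2) \<le> value_bound n" .
  then show "4 \<le> value_bound n" "n < value_bound n" "9 * n < value_bound n" by auto
qed

fun word_exponent :: "cmd \<Rightarrow> nat" where
  "word_exponent (Assign t a b c d e) =
    asize (address_expr t (compile_exp a) (compile_exp b) (compile_exp c) (compile_exp d)) +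
    asize (compile_exp e)"
| "word_exponent (Output a e) = asize (compile_exp a) + asize (compile_exp e)"
| "word_exponent Nop = 0"
| "word_exponent (Then p q) = word_exponent p + word_exponent q"
| "word_exponent (If e p q) = asize (compile_exp e) + word_exponent p + word_exponent q"
| "word_exponent (For r q p) = asize (counter_expr r) + asize (Lit 0) + asize (for_cond r q) +
    word_exponent p + asize (for_step r)"

section \<open>Addresses in mixed radix and memories representing arrays\<close>

lemma digit_eq:
  fixes a b c d M :: nat
  assumes "a < M" "c < M"
  shows "a + M * b = c + M * d \<longleftrightarrow> a = c \<and> b = d"
proof
  assume "a + M * b = c + M * d"
  then have "(a + M * b) mod M = (c + M * d) mod M" "(a + M * b) div M = (c + M * d) div M" by simp_all
  then show "a = c \<and> b = d" using assms by simp
qed simp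

lemma address_eq:
  assumes "t < 32" "t' < 32"
    "a < index_bound n" "b < index_bound n" "c < index_bound n"
    "a' < index_bound n" "b' < index_bound n" "c' < index_bound n"
  shows "address n t a b c d = address n t' a' b' c' d' \<longleftrightarrow> (t, a, b, c, d) = (t', a', b', c', d')"
  unfolding address_def add_left_cancel using assms by (simp only: digit_eq prod.inject)

lemma aval_address_expr:
  "aval (address_expr t a b c d) s = address (s 0) t (aval a s) (aval b s) (aval c s) (aval d s)"
  by (simp add: address_expr_def bound_expr_def address_def index_bound_def)

lemma aval_compile_exp:
  "represents n s h \<Longrightarrow> hsafe n e h \<Longrightarrow> aval (compile_exp e) s = hval n e h"
  by (induction e) (auto simp: represents_def aval_address_expr)

lemma represents_update:
  assumes "represents n s h" "t < 32" "a < index_bound n" "b < index_bound n" "c < index_bound n"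
    "d < index_bound n" "x < value_bound n"
  shows "represents n (s(address n t a b c d := x)) (h((t, a, b, c, d) := x))"
proof -
  have [simp]: "address n t a b c d \<noteq> 0" "\<And>i. i \<le> n * n \<Longrightarrow> address n t a b c d \<noteq> i"
    "\<And>i. i \<le> n * n \<Longrightarrow> i \<noteq> address n t a b c d"
    by (auto simp: address_def)
  show ?thesis
    using assms unfolding represents_def by (auto simp: address_eq)
qed

lemma represents_output:
  assumes "represents n s h" "a \<in> {1..n * n}" "x < value_bound n"
  shows "represents n (s(a := x)) (h((32, a, 0, 0, 0) := x))"
proof -
  have [simp]: "address n t b c d e \<noteq> a" for t b c d e
    using assms(2) by (auto simp: address_def)
  show ?thesis
    using assms unfolding represents_def by auto
qed

text \<open>Total correctness with time and word size included. Both are determined by the command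
  and \<open>n\<close>, so postconditions speak of arrays only and the rules compose without
  resource bookkeeping.\<close>

definition wp :: "nat \<Rightarrow> cmd \<Rightarrow> (arrays \<Rightarrow> bool) \<Rightarrow> arrays \<Rightarrow> bool" where
  "wp n c Q h \<longleftrightarrow> (\<forall>B s. value_bound n ^ word_exponent c \<le> B \<longrightarrow> represents n s h \<longrightarrow>
     (\<exists>t s' h'. exec B (compile c) s t s' \<and> t \<le> cost n c \<and> represents n s' h' \<and> Q h'))"

lemma wpD:
  assumes "wp n c Q h" "value_bound n ^ word_exponent c \<le> B" "represents n s h"
  obtains t s' h' where "exec B (compile c) s t s'" "t \<le> cost n c" "represents n s' h'" "Q h'"
  using assms unfolding wp_def by blast

lemma power_exponent_mono: "value_bound n ^ b \<le> B \<Longrightarrow> a \<le> b \<Longrightarrow> value_bound n ^ a \<le> B"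
  using power_increasing[of a b "value_bound n"] value_bound_ge(1)[of n] by linarith

lemma represents_fits:
  assumes "represents n s h" "value_bound n ^ k \<le> B" "asize a \<le> k"
  shows "fits B a s"
  using fits_bounded[OF value_bound_ge(1), of s n a B] assms power_exponent_mono
  unfolding represents_def by blast

lemma wp_mono: "wp n c P h \<Longrightarrow> (\<And>h'. P h' \<Longrightarrow> Q h') \<Longrightarrow> wp n c Q h"
  unfolding wp_def by meson

lemma wp_Assign:
  assumes "hsafe n (Arr t a b c d) h" "hsafe n e h" "hval n e h < value_bound n"
    and "Q (h((t, hval n a h, hval n b h, hval n c h, hval n d h) := hval n e h))"
  shows "wp n (Assign t a b c d e) Q h"
  unfolding wp_def
proof (intro allI impI)
  fix B s
  assume B: "value_bound n ^ word_exponent (Assign t a b c d e) \<le> B" and s: "represents n s h"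
  let ?A = "address_expr t (compile_exp a) (compile_exp b) (compile_exp c) (compile_exp d)"
  have "exec B (Store ?A (compile_exp e)) s (acost ?A + acost (compile_exp e) + 1)
    (s(aval ?A s := aval (compile_exp e) s))"
    by (intro exec.Store represents_fits[OF s B]) simp_all
  moreover have "aval ?A s = address n t (hval n a h) (hval n b h) (hval n c h) (hval n d h)"
    using assms(1) s aval_compile_exp[OF s] by (simp add: aval_address_expr represents_def)
  moreover have "aval (compile_exp e) s = hval n e h" using aval_compile_exp[OF s assms(2)] .
  ultimately have "exec B (compile (Assign t a b c d e)) s (cost n (Assign t a b c d e))
      (s(address n t (hval n a h) (hval n b h) (hval n c h) (hval n d h) := hval n e h))"
    by simp
  moreover have "represents n (s(address n t (hval n a h) (hval n b h) (hval n c h) (hval n d h) := hval n e h))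
      (h((t, hval n a h, hval n b h, hval n c h, hval n d h) := hval n e h))"
    using assms by (intro represents_update[OF s]) simp_all
  ultimately show "\<exists>t' s' h'. exec B (compile (Assign t a b c d e)) s t' s' \<and>
      t' \<le> cost n (Assign t a b c d e) \<and> represents n s' h' \<and> Q h'"
    using assms(4) by blast
qed

lemma wp_Output:
  assumes "hsafe n (Inp a) h" "hsafe n e h" "hval n e h < value_bound n"
    and "Q (h((32, hval n a h, 0, 0, 0) := hval n e h))"
  shows "wp n (Output a e) Q h"
  unfolding wp_def
proof (intro allI impI)
  fix B s
  assume B: "value_bound n ^ word_exponent (Output a e) \<le> B" and s: "represents n s h"
  have "exec B (Store (compile_exp a) (compile_exp e)) s (acost (compile_exp a) + acost (compile_exp e) + 1)
    (s(aval (compile_exp a) s := aval (compile_exp e) s))"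
    by (intro exec.Store represents_fits[OF s B]) simp_all
  moreover have "aval (compile_exp a) s = hval n a h" "aval (compile_exp e) s = hval n e h"
    using aval_compile_exp[OF s] assms by simp_all
  ultimately have "exec B (compile (Output a e)) s (cost n (Output a e)) (s(hval n a h := hval n e h))"
    by simp
  moreover have "represents n (s(hval n a h := hval n e h)) (h((32, hval n a h, 0, 0, 0) := hval n e h))"
    using assms by (intro represents_output[OF s]) simp_all
  ultimately show "\<exists>t' s' h'. exec B (compile (Output a e)) s t' s' \<and>
      t' \<le> cost n (Output a e) \<and> represents n s' h' \<and> Q h'"
    using assms(4) by blast
qed

lemma wp_Nop: "Q h \<Longrightarrow> wp n Nop Q h"
  unfolding wp_def by (auto intro!: exI exec.Skip)

lemma wp_Then:
  assumes "wp n p (\<lambda>h'. wp n q Q h') h"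
  shows "wp n (Then p q) Q h"
  unfolding wp_def
proof (intro allI impI)
  fix B s
  assume B: "value_bound n ^ word_exponent (Then p q) \<le> B" and s: "represents n s h"
  have Bp: "value_bound n ^ word_exponent p \<le> B" and Bq: "value_bound n ^ word_exponent q \<le> B"
    using power_exponent_mono[OF B] by simp_all
  obtain t s' h' where 1: "exec B (compile p) s t s'" "t \<le> cost n p" "represents n s' h'" "wp n q Q h'"
    using wpD[OF assms Bp s] .
  obtain u s'' h'' where 2: "exec B (compile q) s' u s''" "u \<le> cost n q" "represents n s'' h''" "Q h''"
    using wpD[OF 1(4) Bq 1(3)] .
  show "\<exists>t s' h'. exec B (compile (Then p q)) s t s' \<and> t \<le> cost n (Then p q) \<and> represents n s' h' \<and> Q h'"
    using exec.Seq[OF 1(1) 2(1)] 1(2) 2 by (fastforce intro: add_mono)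
qed

lemma wp_If:
  assumes "hsafe n e h" "hval n e h \<noteq> 0 \<Longrightarrow> wp n p Q h" "hval n e h = 0 \<Longrightarrow> wp n q Q h"
  shows "wp n (If e p q) Q h"
  unfolding wp_def
proof (intro allI impI)
  fix B s
  assume B: "value_bound n ^ word_exponent (If e p q) \<le> B" and s: "represents n s h"
  have Bp: "value_bound n ^ word_exponent p \<le> B" and Bq: "value_bound n ^ word_exponent q \<le> B"
    using power_exponent_mono[OF B] by simp_all
  have fits: "fits B (compile_exp e) s" by (rule represents_fits[OF s B]) simp
  have val: "aval (compile_exp e) s = hval n e h" using aval_compile_exp[OF s assms(1)] .
  show "\<exists>t s' h'. exec B (compile (If e p q)) s t s' \<and> t \<le> cost n (If e p q) \<and> represents n s' h' \<and> Q h'"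
  proof (cases "hval n e h = 0")
    case True
    obtain t s' h' where 1: "exec B (compile q) s t s'" "t \<le> cost n q" "represents n s' h'" "Q h'"
      using wpD[OF assms(3)[OF True] Bq s] .
    show ?thesis
      using exec.CondFalse[OF fits _ 1(1)] val True 1
      by (intro exI[of _ "acost (compile_exp e) + 1 + t"] exI[of _ s'] exI[of _ h']) simp
  next
    case False
    obtain t s' h' where 1: "exec B (compile p) s t s'" "t \<le> cost n p" "represents n s' h'" "Q h'"
      using wpD[OF assms(2)[OF False] Bp s] .
    show ?thesis
      using exec.CondTrue[OF fits _ 1(1)] val False 1
      by (intro exI[of _ "acost (compile_exp e) + 1 + t"] exI[of _ s'] exI[of _ h']) simp
  qed
qed

text \<open>\<open>I i\<close> speaks about the arrays whose counter has already been set to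
  \<open>i\<close>, so the body establishes \<open>I (Suc i)\<close> for the incremented counter and
  must itself leave the counter alone. The bound 9 on \<open>q\<close> keeps counters below
  \<open>value_bound n\<close>.\<close>

lemma wp_For:
  assumes r: "r < 32" and q: "q \<le> 9"
    and init: "I 0 (h((r, 0, 0, 0, 0) := 0))"
    and step: "\<And>i h. i < q * n \<Longrightarrow> I i h \<Longrightarrow> h (r, 0, 0, 0, 0) = i \<Longrightarrow>
      wp n p (\<lambda>h'. h' (r, 0, 0, 0, 0) = i \<and> I (Suc i) (h'((r, 0, 0, 0, 0) := Suc i))) h"
    and final: "\<And>h. I (q * n) h \<Longrightarrow> Q h"
  shows "wp n (For r q p) Q h"
  unfolding wp_def
proof (intro allI impI)
  fix B s
  assume B: "value_bound n ^ word_exponent (For r q p) \<le> B" and s: "represents n s h"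
  let ?L = "Loop (for_cond r q) (Seq (compile p) (Store (counter_expr r) (for_step r)))"
  let ?r = "(r, 0, 0, 0, 0)"
  define K where "K = acost (for_cond r q) + 1 + (cost n p + (acost (counter_expr r) + acost (for_step r) + 1))"
  have Bp: "value_bound n ^ word_exponent p \<le> B"
    using power_exponent_mono[OF B] by simp
  have counter: "aval (counter_expr r) s = address n r 0 0 0 0" if "represents n s h" for s h
    using that by (simp add: aval_address_expr represents_def)
  have count: "s (address n r 0 0 0 0) = h ?r" if "represents n s h" for s h
    using that r by (simp add: represents_def index_bound_def)
  have upd: "represents n (s(address n r 0 0 0 0 := x)) (h(?r := x))"
    if "represents n s h" "x \<le> q * n" for s h x
  proof -
    have "q * n \<le> 9 * n" using q by (rule mult_right_mono) simp
    then have "x < value_bound n" using that(2) value_bound_ge(3)[of n] by linarith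
    then show ?thesis using that(1) r by (intro represents_update) (simp_all add: index_bound_def)
  qed
  \<comment> \<open>Induction on the number \<open>m\<close> of rounds left, the counter being
    \<open>q * n - m\<close>.\<close>
  have loop: "\<exists>t s' h'. exec B ?L s t s' \<and> t \<le> m * K + (acost (for_cond r q) + 1) \<and> represents n s' h' \<and> Q h'"
    if "represents n s h" "I (q * n - m) h" "h ?r = q * n - m" "m \<le> q * n" for m s h
    using that
  proof (induction m arbitrary: s h)
    case 0
    have fits: "fits B (for_cond r q) s" by (rule represents_fits[OF 0(1) B]) simp
    have "aval (for_cond r q) s = 0" using counter[OF 0(1)] count[OF 0(1)] 0 by (simp add: represents_def)
    from exec.LoopFalse[OF fits this] show ?case
      using 0 final by (intro exI[of _ "acost (for_cond r q) + 1"] exI[of _ s] exI[of _ h]) simp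
  next
    case (Suc m)
    let ?i = "q * n - Suc m"
    have i: "?i < q * n" "Suc ?i = q * n - m" using Suc.prems(4) by auto
    have fits: "fits B (for_cond r q) s" by (rule represents_fits[OF Suc.prems(1) B]) simp
    have nz: "aval (for_cond r q) s \<noteq> 0"
      using counter[OF Suc.prems(1)] count[OF Suc.prems(1)] Suc.prems i by (simp add: represents_def)
    obtain t1 s1 h1 where 1: "exec B (compile p) s t1 s1" "t1 \<le> cost n p" "represents n s1 h1"
      "h1 ?r = ?i" "I (Suc ?i) (h1(?r := Suc ?i))"
      using wpD[OF step[OF i(1) Suc.prems(2,3)] Bp Suc.prems(1)] by metis
    let ?s2 = "s1(address n r 0 0 0 0 := Suc ?i)"
    have "exec B (Store (counter_expr r) (for_step r)) s1 (acost (counter_expr r) + acost (for_step r) + 1)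
        (s1(aval (counter_expr r) s1 := aval (for_step r) s1))"
      by (intro exec.Store represents_fits[OF 1(3) B]) simp_all
    then have 2: "exec B (Store (counter_expr r) (for_step r)) s1 (acost (counter_expr r) + acost (for_step r) + 1) ?s2"
      using counter[OF 1(3)] count[OF 1(3)] 1(4) by simp
    have "represents n ?s2 (h1(?r := Suc ?i))" using upd[OF 1(3)] i by simp
    then obtain u s3 h3 where 3: "exec B ?L ?s2 u s3" "u \<le> m * K + (acost (for_cond r q) + 1)"
        "represents n s3 h3" "Q h3"
      using Suc.IH[of ?s2 "h1(?r := Suc ?i)"] 1(5) i Suc.prems(4) by fastforce
    let ?t = "acost (for_cond r q) + 1 + (t1 + (acost (counter_expr r) + acost (for_step r) + 1)) + u"
    show ?case
    proof (intro exI conjI)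
      show "exec B ?L s ?t s3" by (rule exec.LoopTrue[OF fits nz exec.Seq[OF 1(1) 2] 3(1)])
      show "?t \<le> Suc m * K + (acost (for_cond r q) + 1)" using 1(2) 3(2) unfolding K_def by simp
    qed fact+
  qed
  have "exec B (Store (counter_expr r) (Lit 0)) s (acost (counter_expr r) + acost (Lit 0) + 1)
      (s(aval (counter_expr r) s := aval (Lit 0) s))"
    by (intro exec.Store represents_fits[OF s B]) simp_all
  then have 1: "exec B (Store (counter_expr r) (Lit 0)) s (acost (counter_expr r) + 2) (s(address n r 0 0 0 0 := 0))"
    using counter[OF s] by simp
  have "represents n (s(address n r 0 0 0 0 := 0)) (h(?r := 0))" using upd[OF s] by simp
  then obtain t s' h' where 2: "exec B ?L (s(address n r 0 0 0 0 := 0)) t s'"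
      "t \<le> q * n * K + (acost (for_cond r q) + 1)" "represents n s' h'" "Q h'"
    using loop[of _ "h(?r := 0)" "q * n"] init by fastforce
  show "\<exists>t s' h'. exec B (compile (For r q p)) s t s' \<and> t \<le> cost n (For r q p) \<and> represents n s' h' \<and> Q h'"
    using exec.Seq[OF 1 2(1)] 2 unfolding K_def compile.simps cost.simps by (metis add_left_mono)
qed

section \<open>Conflict-free colorings as weighted constraints\<close>

type_synonym weights = "nat \<Rightarrow> nat \<Rightarrow> nat \<Rightarrow> nat \<Rightarrow> nat"

text \<open>Ordered pairs with the diagonal: the cost of a single vertex sits at
  \<open>W u x u x\<close>, and an edge may carry its weight in either orientation.\<close>

definition total :: "nat set \<Rightarrow> weights \<Rightarrow> (nat \<Rightarrow> nat) \<Rightarrow> nat" where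
  "total S W \<sigma> = (\<Sum>u\<in>S. \<Sum>v\<in>S. W u (\<sigma> u) v (\<sigma> v))"

text \<open>All summands of \<open>total\<close> that involve \<open>v\<close>, when
  \<open>v\<close> has value \<open>z\<close> and its only neighbors \<open>a\<close> and
  \<open>b\<close> have values \<open>x\<close> and \<open>y\<close>. A single neighbor,
  \<open>a = b\<close>, is counted once.\<close>

definition local_cost :: "weights \<Rightarrow> nat \<Rightarrow> nat \<Rightarrow> nat \<Rightarrow> nat \<Rightarrow> nat \<Rightarrow> nat \<Rightarrow> nat" where
  "local_cost W v a b x y z = W v z v z + W a x v z + W v z a x +
     (if a = b then 0 else W b y v z + W v z b y)"

lemma total_remove:
  assumes "finite S" "v \<in> S" "a \<in> S - {v}" "b \<in> S - {v}"
    and zero: "\<And>u. u \<in> S - {v, a, b} \<Longrightarrow> W u (\<sigma> u) v (\<sigma> v) = 0 \<and> W v (\<sigma> v) u (\<sigma> u) = 0"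
  shows "total S W \<sigma> = total (S - {v}) W \<sigma> + local_cost W v a b (\<sigma> a) (\<sigma> b) (\<sigma> v)"
proof -
  let ?T = "S - {v}" and ?w = "\<lambda>u u'. W u (\<sigma> u) u' (\<sigma> u')"
  have ins: "(\<Sum>u\<in>S. f u) = f v + (\<Sum>u\<in>?T. f u)" for f :: "nat \<Rightarrow> nat"
    using assms(1,2) by (rule sum.remove)
  have "total S W \<sigma> = ?w v v + (\<Sum>u\<in>?T. ?w v u) + (\<Sum>u\<in>?T. ?w u v + (\<Sum>u'\<in>?T. ?w u u'))"
    unfolding total_def by (simp add: ins)
  also have "\<dots> = total ?T W \<sigma> + (?w v v + (\<Sum>u\<in>?T. ?w u v + ?w v u))"
    unfolding total_def by (simp add: sum.distrib)
  also have "(\<Sum>u\<in>?T. ?w u v + ?w v u) = (\<Sum>u\<in>{a, b}. ?w u v + ?w v u)"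
    using assms by (intro sum.mono_neutral_right) auto
  finally show ?thesis
    by (simp add: local_cost_def)
qed

lemma total_add:
  assumes "finite S" "a \<in> S" "b \<in> S"
    and W': "\<And>u v. u \<in> S \<Longrightarrow> v \<in> S \<Longrightarrow>
      W' u (\<sigma> u) v (\<sigma> v) = W u (\<sigma> u) v (\<sigma> v) + (if u = a \<and> v = b then m else 0)"
  shows "total S W' \<sigma> = total S W \<sigma> + m"
proof -
  have "total S W' \<sigma> = (\<Sum>u\<in>S. \<Sum>v\<in>S. W u (\<sigma> u) v (\<sigma> v) + (if u = a then if v = b then m else 0 else 0))"
    unfolding total_def by (intro sum.cong refl) (auto simp: W')
  also have "\<dots> = total S W \<sigma> + (\<Sum>u\<in>S. \<Sum>v\<in>S. if u = a then if v = b then m else 0 else 0)"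
    unfolding total_def by (simp add: sum.distrib)
  also have "(\<Sum>u\<in>S. \<Sum>v\<in>S. if u = a then if v = b then m else 0 else 0) = (\<Sum>u\<in>S. if u = a then m else 0)"
    using assms(1,3) by (intro sum.cong refl) (simp add: sum.delta)
  also have "\<dots> = m" using assms(1,2) by (simp add: sum.delta)
  finally show ?thesis .
qed

text \<open>The source of all bounds on stored weights: summands are natural numbers.\<close>

lemma entry_le_total:
  assumes "finite S" "u \<in> S" "v \<in> S"
  shows "W u (\<sigma> u) v (\<sigma> v) \<le> total S W \<sigma>"
proof -
  have "W u (\<sigma> u) v (\<sigma> v) \<le> (\<Sum>v\<in>S. W u (\<sigma> u) v (\<sigma> v))" using assms by (intro member_le_sum) auto
  also have "\<dots> \<le> total S W \<sigma>" unfolding total_def using assms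
    by (intro member_le_sum[where f = "\<lambda>u. \<Sum>v\<in>S. W u (\<sigma> u) v (\<sigma> v)"]) auto
  finally show ?thesis .
qed

text \<open>A value \<open>9 * w + 3 * c + d\<close> of a vertex \<open>v\<close> stands for the color \<open>c\<close> of \<open>v\<close>, the vertex \<open>w\<close>
  whose color is unique in the closed neighborhood of \<open>v\<close>, and that color \<open>d\<close>. Storing \<open>d\<close> with
  \<open>v\<close> turns the conflict-free condition into constraints on pairs of adjacent vertices.\<close>

definition witness :: "nat \<Rightarrow> nat" where "witness x = x div 9"
text \<open>A remainder modulo 3, expressed by division and truncated subtraction as the machine
  will compute it.\<close>

definition color :: "nat \<Rightarrow> nat" where "color x = x div 3 - 3 * (x div 9)"
definition witness_color :: "nat \<Rightarrow> nat" where "witness_color x = x - 3 * (x div 3)"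

lemma color_lt: "color x < 3" and witness_color_lt: "witness_color x < 3"
  unfolding color_def witness_color_def by linarith+

lemma decode [simp]:
  assumes "c < 3" "d < 3"
  shows "witness (9 * w + 3 * c + d) = w" "color (9 * w + 3 * c + d) = c"
    "witness_color (9 * w + 3 * c + d) = d"
proof -
  have "(9 * w + 3 * c + d) div 9 = w" "(9 * w + 3 * c + d) div 3 = 3 * w + c"
    using assms by auto
  then show "witness (9 * w + 3 * c + d) = w" "color (9 * w + 3 * c + d) = c"
    "witness_color (9 * w + 3 * c + d) = d"
    by (simp_all add: witness_def color_def witness_color_def)
qed

text \<open>Truncated subtraction charges colors above \<open>k\<close>. The fourth term is the pair
  condition of \<open>u\<close> with itself, as \<open>u\<close> belongs to its own closed
  neighborhood; the fifth charges a witness outside that neighborhood.\<close>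

definition violations :: "nat \<Rightarrow> nat set set \<Rightarrow> nat \<Rightarrow> nat \<Rightarrow> nat" where
  "violations k E u x = of_bool (witness_color x = 0) + (witness_color x - k) + (color x - k) +
     of_bool ((witness x = u) \<noteq> (color x = witness_color x)) +
     of_bool (witness x \<noteq> u \<and> {u, witness x} \<notin> E)"

text \<open>The penalty \<open>n + 1\<close> exceeds the number of colored vertices.\<close>

definition pair_weight :: "nat \<Rightarrow> nat \<Rightarrow> nat set set \<Rightarrow> weights" where
  "pair_weight k n E u x v y =
    (if u \<ge> n \<or> v \<ge> n then 0
     else if u = v then
       of_bool (color x \<noteq> 0) + (n + 1) * violations k E u x
     else of_bool ({u, v} \<in> E) * ((n + 1) * of_bool ((witness y = u) \<noteq> (color x = witness_color y))))"

text \<open>Even without vertices the dummy \<open>n\<close> must take a value, so there is at least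
  one.\<close>

definition num_values :: "nat \<Rightarrow> nat" where
  "num_values n = max 1 (9 * n)"

definition assignment :: "nat \<Rightarrow> (nat \<Rightarrow> nat) \<Rightarrow> bool" where
  "assignment n \<sigma> \<longleftrightarrow> (\<forall>u\<le>n. \<sigma> u < num_values n)"

definition coloring_of :: "nat \<Rightarrow> (nat \<Rightarrow> nat) \<Rightarrow> nat \<Rightarrow> nat option" where
  "coloring_of n \<sigma> v = (if v < n \<and> color (\<sigma> v) \<noteq> 0 then Some (color (\<sigma> v)) else None)"

lemma pair_weight_le: "pair_weight k n E u x v y \<le> 8 * (n + 1)"
proof -
  have "color x - k \<le> 2" "witness_color x - k \<le> 2"
    using color_lt[of x] witness_color_lt[of x] by linarith+
  then have "violations k E u x \<le> 7" unfolding violations_def by (auto simp: of_bool_def)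
  then have "(n + 1) * violations k E u x \<le> (n + 1) * 7" by (rule mult_left_mono) simp
  then have "of_bool (color x \<noteq> 0) + (n + 1) * violations k E u x \<le> 8 * (n + 1)"
    by (simp add: of_bool_def)
  then show ?thesis unfolding pair_weight_def by (auto simp: of_bool_def)
qed

lemma total_pair_weight_le: "total {..n} (pair_weight k n E) \<sigma> \<le> (n + 1) * ((n + 1) * (8 * (n + 1)))"
proof -
  have "total {..n} (pair_weight k n E) \<sigma> \<le> (\<Sum>u\<in>{..n}. \<Sum>v\<in>{..n}. 8 * (n + 1))"
    unfolding total_def by (rule sum_mono, rule sum_mono, rule pair_weight_le)
  also have "\<dots> = (n + 1) * ((n + 1) * (8 * (n + 1)))" unfolding sum_constant card_atMost by simp
  finally show ?thesis .
qed

section \<open>Colorings and assignments without penalties\<close>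

context
  fixes k n :: nat and E :: "nat set set"
  assumes sg: "simple_graph {..<n} E" and k: "k \<le> 2"
begin

lemma edge_lt: "{u, v} \<in> E \<Longrightarrow> u < n \<and> v < n \<and> u \<noteq> v"
proof -
  assume "{u, v} \<in> E"
  from sg[unfolded simple_graph_def, THEN conjunct2, THEN bspec, OF this]
  have "{u, v} \<subseteq> {..<n}" "card {u, v} = 2" by simp_all
  then show ?thesis by (auto simp: card_insert_if split: if_splits)
qed

text \<open>A single penalty already exceeds \<open>n\<close>, so no constraint is violated. Then
  the witness is the only vertex in the closed neighborhood of \<open>v\<close> that has the
  announced color, which is nonzero. Each colored vertex contributes 1 on the diagonal.\<close>

lemma coloring_of_total:
  assumes "total {..n} (pair_weight k n E) \<sigma> \<le> n"
  shows "cf_coloring k {..<n} E (coloring_of n \<sigma>)"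
    and "card (dom (coloring_of n \<sigma>)) \<le> total {..n} (pair_weight k n E) \<sigma>"
proof -
  let ?W = "pair_weight k n E"
  have le: "?W u (\<sigma> u) v (\<sigma> v) \<le> n" if "u \<le> n" "v \<le> n" for u v
    using entry_le_total[of "{..n}" u v ?W \<sigma>] that assms by auto
  have "violations k E v (\<sigma> v) = 0" if "v < n" for v
    using le[of v v] that by (cases "violations k E v (\<sigma> v)") (auto simp: pair_weight_def)
  then have diag: "witness_color (\<sigma> v) \<noteq> 0 \<and> witness_color (\<sigma> v) \<le> k \<and> color (\<sigma> v) \<le> k \<and>
      ((witness (\<sigma> v) = v) = (color (\<sigma> v) = witness_color (\<sigma> v))) \<and>
      (witness (\<sigma> v) = v \<or> {v, witness (\<sigma> v)} \<in> E)" if "v < n" for v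
    using that unfolding violations_def by simp blast
  have off: "(witness (\<sigma> v) = u) = (color (\<sigma> u) = witness_color (\<sigma> v))" if "{u, v} \<in> E" for u v
  proof (rule ccontr)
    assume "\<not> ?thesis"
    then have "?W u (\<sigma> u) v (\<sigma> v) = n + 1"
      using edge_lt[OF that] that unfolding pair_weight_def by simp
    moreover have "u \<le> n" "v \<le> n" using edge_lt[OF that] by simp_all
    ultimately show False using le[of u v] by linarith
  qed
  have both: "(witness (\<sigma> v) = u) = (color (\<sigma> u) = witness_color (\<sigma> v))"
    if "v < n" "u \<in> closed_nbhd E v" for u v
    using that diag[of v] off[of u v] unfolding closed_nbhd_def by auto
  have lt: "u < n" if "v < n" "u \<in> closed_nbhd E v" for u v
    using that edge_lt unfolding closed_nbhd_def by auto
  have wit: "witness (\<sigma> v) \<in> closed_nbhd E v" if "v < n" for v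
    using diag[OF that] unfolding closed_nbhd_def by (auto simp: insert_commute)
  show "cf_coloring k {..<n} E (coloring_of n \<sigma>)"
    unfolding cf_coloring_def
  proof (intro conjI ballI)
    show "dom (coloring_of n \<sigma>) \<subseteq> {..<n}" by (auto simp: coloring_of_def split: if_splits)
    show "ran (coloring_of n \<sigma>) \<subseteq> {1..k}"
      using diag by (fastforce simp: coloring_of_def ran_def split: if_splits)
  next
    fix v assume "v \<in> {..<n}"
    then have v: "v < n" by simp
    let ?w = "witness (\<sigma> v)"
    have cw: "color (\<sigma> ?w) = witness_color (\<sigma> v)" using both[OF v wit[OF v]] by simp
    have col: "coloring_of n \<sigma> ?w = Some (witness_color (\<sigma> v))"
      using cw diag[OF v] lt[OF v wit[OF v]] by (simp add: coloring_of_def)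
    show "\<exists>w\<in>closed_nbhd E v \<inter> dom (coloring_of n \<sigma>).
        \<forall>u\<in>closed_nbhd E v \<inter> dom (coloring_of n \<sigma>). u \<noteq> w \<longrightarrow> coloring_of n \<sigma> u \<noteq> coloring_of n \<sigma> w"
    proof (intro bexI[of _ ?w] ballI impI)
      fix u assume u: "u \<in> closed_nbhd E v \<inter> dom (coloring_of n \<sigma>)" "u \<noteq> ?w"
      then have "color (\<sigma> u) \<noteq> witness_color (\<sigma> v)" using both[OF v] by auto
      then show "coloring_of n \<sigma> u \<noteq> coloring_of n \<sigma> ?w"
        unfolding col by (simp add: coloring_of_def)
    qed (use col wit[OF v] in auto)
  qed
  have "dom (coloring_of n \<sigma>) = {v \<in> {..n}. v < n \<and> color (\<sigma> v) \<noteq> 0}"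
    by (auto simp: coloring_of_def split: if_splits)
  then have "card (dom (coloring_of n \<sigma>)) = (\<Sum>v\<in>{..n}. of_bool (v < n \<and> color (\<sigma> v) \<noteq> 0))"
    by (simp add: of_bool_def sum.If_cases Int_def)
  also have "\<dots> \<le> (\<Sum>v\<in>{..n}. ?W v (\<sigma> v) v (\<sigma> v))"
    by (intro sum_mono) (auto simp: pair_weight_def of_bool_def)
  also have "\<dots> \<le> total {..n} ?W \<sigma>"
    unfolding total_def by (intro sum_mono member_le_sum) auto
  finally show "card (dom (coloring_of n \<sigma>)) \<le> total {..n} ?W \<sigma>" .
qed

text \<open>A coloring encoded with a chosen witness for every vertex violates nothing, which leaves
  one unit per colored vertex. The value 0 of the dummy selects the entry where the program finds
  the optimum.\<close>

lemma total_of_coloring: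
  assumes "cf_coloring k {..<n} E col"
  shows "\<exists>\<sigma>. assignment n \<sigma> \<and> \<sigma> n = 0 \<and> total {..n} (pair_weight k n E) \<sigma> = card (dom col)"
proof -
  have dom: "dom col \<subseteq> {..<n}" and ran: "ran col \<subseteq> {1..k}"
    and ex: "\<forall>v\<in>{..<n}. \<exists>w \<in> closed_nbhd E v \<inter> dom col.
        \<forall>u \<in> closed_nbhd E v \<inter> dom col. u \<noteq> w \<longrightarrow> col u \<noteq> col w"
    using assms unfolding cf_coloring_def by blast+
  define w where "w v = (SOME w. w \<in> closed_nbhd E v \<inter> dom col \<and>
      (\<forall>u \<in> closed_nbhd E v \<inter> dom col. u \<noteq> w \<longrightarrow> col u \<noteq> col w))" for v
  have "w v \<in> closed_nbhd E v \<inter> dom col \<and>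
      (\<forall>u \<in> closed_nbhd E v \<inter> dom col. u \<noteq> w v \<longrightarrow> col u \<noteq> col (w v))" if "v < n" for v
    unfolding w_def by (rule someI_ex) (use ex that in blast)
  then have w: "\<And>v. v < n \<Longrightarrow> w v \<in> closed_nbhd E v \<inter> dom col"
    and uniq: "\<And>v u. v < n \<Longrightarrow> u \<in> closed_nbhd E v \<Longrightarrow> u \<in> dom col \<Longrightarrow> u \<noteq> w v \<Longrightarrow> col u \<noteq> col (w v)"
    by blast+
  define c where "c v = (case col v of None \<Rightarrow> 0 | Some a \<Rightarrow> a)" for v
  have c: "c v \<le> k" "c v < 3" "v \<in> dom col \<longleftrightarrow> c v \<noteq> 0" for v
    using ran k unfolding c_def ran_def by (auto split: option.splits)
  have eq: "col u = col v \<longleftrightarrow> c u = c v" if "u \<in> dom col" "v \<in> dom col" for u v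
    using that unfolding c_def by (auto split: option.splits)
  define \<sigma> where "\<sigma> v = (if v < n then 9 * w v + 3 * c v + c (w v) else 0)" for v
  have \<sigma>: "witness (\<sigma> v) = w v" "color (\<sigma> v) = c v" "witness_color (\<sigma> v) = c (w v)" if "v < n" for v
    using that c by (simp_all add: \<sigma>_def)
  have wn: "w v < n" if "v < n" for v using w[OF that] dom by auto
  have both: "(w v = u) = (c u = c (w v))" if "v < n" "u \<in> closed_nbhd E v" for u v
    using uniq[OF that] w[OF that(1)] c(3) eq by (metis IntD2)
  have "pair_weight k n E u (\<sigma> u) v (\<sigma> v) = (if u = v then of_bool (u < n \<and> c u \<noteq> 0) else 0)"
    if "u \<le> n" "v \<le> n" for u v
  proof (cases "u < n \<and> v < n")
    case True
    show ?thesis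
    proof (cases "u = v")
      case uv: True
      have "u \<in> closed_nbhd E u" by (simp add: closed_nbhd_def)
      then have b: "(w u = u) = (c u = c (w u))" using both True by blast
      have d: "c (w u) \<noteq> 0" using w True c(3) by auto
      have m: "w u = u \<or> {u, w u} \<in> E" using w True by (auto simp: closed_nbhd_def insert_commute)
      have "violations k E u (\<sigma> u) = 0"
        unfolding violations_def using \<sigma>[of u] True b d m c(1) by auto
      then show ?thesis using True uv \<sigma>(2)[of v] by (simp add: pair_weight_def)
    next
      case False
      have "u \<in> closed_nbhd E v" if "{u, v} \<in> E" using that by (simp add: closed_nbhd_def)
      then have "(w v = u) = (c u = c (w v))" if "{u, v} \<in> E" using both True that by blast
      then show ?thesis
        using True False \<sigma>[of u] \<sigma>[of v] by (cases "{u, v} \<in> E") (simp_all add: pair_weight_def)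
    qed
  qed (auto simp: pair_weight_def)
  then have "total {..n} (pair_weight k n E) \<sigma> = (\<Sum>u\<in>{..n}. \<Sum>v\<in>{..n}. if u = v then of_bool (u < n \<and> c u \<noteq> 0) else 0)"
    unfolding total_def by (intro sum.cong refl) auto
  also have "\<dots> = (\<Sum>u\<in>{..n}. of_bool (u < n \<and> c u \<noteq> 0))"
    by (intro sum.cong refl) (simp add: sum.delta)
  also have "\<dots> = card {u \<in> {..n}. u < n \<and> c u \<noteq> 0}"
    by (simp add: of_bool_def sum.If_cases Int_def)
  also have "{u \<in> {..n}. u < n \<and> c u \<noteq> 0} = dom col" using dom c(3) by auto
  finally have "total {..n} (pair_weight k n E) \<sigma> = card (dom col)" .
  moreover have "assignment n \<sigma>"
    unfolding assignment_def
  proof (intro allI impI)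
    fix u assume "u \<le> n"
    show "\<sigma> u < num_values n"
    proof (cases "u < n")
      case True
      have "9 * w u + 3 * c u + c (w u) < 9 * n" using wn[OF True] c(2)[of u] c(2)[of "w u"] by linarith
      then show ?thesis using True by (simp add: \<sigma>_def num_values_def)
    qed (simp add: \<sigma>_def num_values_def)
  qed
  ultimately show ?thesis by (intro exI[of _ \<sigma>]) (simp add: \<sigma>_def)
qed

end

text \<open>The least number of colors is attained because distinct colors on all vertices are
  conflict-free; and a coloring remains valid when more colors are allowed.\<close>

lemma cf_chromatic_le_iff:
  assumes "simple_graph V E"
  shows "cf_chromatic V E \<le> k \<longleftrightarrow> (\<exists>col. cf_coloring k V E col)"
proof
  have mono: "cf_coloring k V E col" if "cf_coloring j V E col" "j \<le> k" for j k col
  proof -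
    have "{1..j} \<subseteq> {1..k}" using that(2) by simp
    then have "ran col \<subseteq> {1..k}" using that(1) unfolding cf_coloring_def by blast
    then show ?thesis using that(1) unfolding cf_coloring_def by simp
  qed
  obtain f where f: "inj_on f V" "f ` V = {0..<card V}"
    using assms ex_bij_betw_finite_nat[of V] unfolding simple_graph_def bij_betw_def by blast
  define col where "col v = (if v \<in> V then Some (Suc (f v)) else None)" for v
  have "f v < card V" if "v \<in> V" for v using f(2) that by auto
  then have "ran col \<subseteq> {1..card V}" by (auto simp: col_def ran_def Suc_le_eq)
  moreover have "dom col = V" by (auto simp: col_def split: if_splits)
  moreover have "col u \<noteq> col v" if "u \<in> V" "v \<in> V" "u \<noteq> v" for u v
    using that f(1) by (auto simp: col_def dest: inj_onD)
  moreover have "v \<in> closed_nbhd E v" for v by (simp add: closed_nbhd_def)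
  ultimately have "cf_coloring (card V) V E col"
    unfolding cf_coloring_def by blast
  then have ex: "\<exists>k col. cf_coloring k V E col" by blast
  assume "cf_chromatic V E \<le> k"
  then show "\<exists>col. cf_coloring k V E col"
    using LeastI_ex[OF ex] mono unfolding cf_chromatic_def by blast
next
  assume "\<exists>col. cf_coloring k V E col"
  then show "cf_chromatic V E \<le> k" unfolding cf_chromatic_def by (rule Least_le)
qed

section \<open>Variable elimination on the machine\<close>

notation Then (infixr ";;" 60)

section \<open>The elimination program\<close>

abbreviation "reg r \<equiv> Arr r (Num 0) (Num 0) (Num 0) (Num 0)"
abbreviation "set_reg r e \<equiv> Assign r (Num 0) (Num 0) (Num 0) (Num 0) e"
abbreviation "Arr1 t a \<equiv> Arr t a (Num 0) (Num 0) (Num 0)"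
abbreviation "Arr2 t a b \<equiv> Arr t a b (Num 0) (Num 0)"
abbreviation "val h r \<equiv> h (r, 0, 0, 0, 0)"

text \<open>The two truncated differences add up to the distance of \<open>a\<close> and
  \<open>b\<close>. One minus it tests equality, and on truth values 0 and 1 the distance itself is
  exclusive or.\<close>

definition "Eq a b = Minus (Num 1) (Plus (Minus a b) (Minus b a))"
definition "Xor a b = Plus (Minus a b) (Minus b a)"
definition "Witness e = Div e (Num 9)"
definition "Color e = Minus (Div e (Num 3)) (Times (Num 3) (Div e (Num 9)))"
definition "Witness_Color e = Minus e (Times (Num 3) (Div e (Num 3)))"
definition "Edge u v = Inp (Plus (Num 1) (Plus (Times u Size) v))"

lemma hval_simps [simp]:
  "hval n (Eq a b) h = of_bool (hval n a h = hval n b h)"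
  "hval n (Witness a) h = witness (hval n a h)"
  "hval n (Color a) h = color (hval n a h)"
  "hval n (Witness_Color a) h = witness_color (hval n a h)"
  "hval n (Edge a b) h = h (32, 1 + (hval n a h * n + hval n b h), 0, 0, 0)"
  by (auto simp: Eq_def Witness_def Color_def Witness_Color_def Edge_def witness_def color_def
      witness_color_def)

lemma hval_Xor [simp]:
  "hval n a h = of_bool P \<Longrightarrow> hval n b h = of_bool Q \<Longrightarrow> hval n (Xor a b) h = of_bool (P \<noteq> Q)"
  by (auto simp: Xor_def)

lemma hsafe_simps [simp]:
  "hsafe n (Eq a b) h \<longleftrightarrow> hsafe n a h \<and> hsafe n b h"
  "hsafe n (Xor a b) h \<longleftrightarrow> hsafe n a h \<and> hsafe n b h"
  "hsafe n (Witness a) h \<longleftrightarrow> hsafe n a h"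
  "hsafe n (Color a) h \<longleftrightarrow> hsafe n a h"
  "hsafe n (Witness_Color a) h \<longleftrightarrow> hsafe n a h"
  by (auto simp: Eq_def Xor_def Witness_def Color_def Witness_Color_def)

lemma hsafe_Edge [simp]:
  assumes "hval n a h < n" "hval n b h < n"
  shows "hsafe n (Edge a b) h \<longleftrightarrow> hsafe n a h \<and> hsafe n b h"
proof -
  have "hval n a h * n + hval n b h < n * n"
    using assms mult_le_mono1[of "Suc (hval n a h)" n n] by simp
  then show ?thesis by (auto simp: Edge_def)
qed

lemma index_boundI [simp]:
  "x \<le> n \<Longrightarrow> x < index_bound n" "x < 9 * n \<Longrightarrow> x < index_bound n" "0 < index_bound n"
  by (auto simp: index_bound_def)

lemma value_boundI: "x \<le> 1000 * (n + 1) ^ 4 \<Longrightarrow> x < value_bound n"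
proof -
  assume x: "x \<le> 1000 * (n + 1) ^ 4"
  have "2 ^ 16 * (n + 1) ^ 4 \<le> (n + 2) ^ 16 * (n + 2) ^ 4"
    by (intro mult_mono power_mono) simp_all
  also have "\<dots> = value_bound n" unfolding value_bound_def by (simp flip: power_add)
  finally have "65536 * (n + 1) ^ 4 \<le> value_bound n" by simp
  moreover have "1 \<le> (n + 1) ^ 4" by simp
  ultimately show ?thesis using x by linarith
qed

lemma value_bound_small [simp]: "x \<le> 9 * n + 3 \<Longrightarrow> x < value_bound n"
proof (rule value_boundI)
  assume "x \<le> 9 * n + 3"
  also have "\<dots> \<le> 1000 * (n + 1) ^ 1" by simp
  also have "\<dots> \<le> 1000 * (n + 1) ^ 4" by (intro mult_left_mono power_increasing) simp_all
  finally show "x \<le> 1000 * (n + 1) ^ 4" .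
qed

definition frame :: "nat set \<Rightarrow> arrays \<Rightarrow> arrays \<Rightarrow> bool" where
  "frame T h h' \<longleftrightarrow> (\<forall>t p. t \<notin> T \<longrightarrow> h' (t, p) = h (t, p))"

lemma frame_refl [simp]: "frame T h h"
  by (simp add: frame_def)

lemma frame_update: "frame T h h' \<Longrightarrow> t \<in> T \<Longrightarrow> frame T h (h'((t, p) := x))"
  by (auto simp: frame_def)

lemma frame_trans: "frame T h h' \<Longrightarrow> frame U h' h'' \<Longrightarrow> T \<union> U \<subseteq> R \<Longrightarrow> frame R h h''"
  unfolding frame_def by (metis Un_iff subsetD)

lemma frameD: "frame T h h' \<Longrightarrow> t \<notin> T \<Longrightarrow> h' (t, p) = h (t, p)"
  unfolding frame_def by blast

text \<open>Arrays: \<open>16\<close> weights, \<open>17\<close> optimal values of eliminated vertices, \<open>18\<close> adjacency matrix of the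
  current graph, \<open>19\<close> eliminated vertices, \<open>20\<close> elimination order, \<open>21\<close> and \<open>22\<close> the neighbors of a
  vertex at its elimination, \<open>23\<close> solution.\<close>

definition "Own_Weight k u x =
  Plus (Minus (Num 1) (Eq (Color x) (Num 0))) (Times (Plus Size (Num 1))
    (Plus (Plus (Plus (Plus (Eq (Witness_Color x) (Num 0)) (Minus (Witness_Color x) (Num k)))
      (Minus (Color x) (Num k)))
      (Xor (Eq (Witness x) u) (Eq (Color x) (Witness_Color x))))
      (Minus (Num 1) (Plus (Eq (Witness x) u) (Edge u (Witness x))))))"

definition "Pair_Weight u x v y =
  Times (Edge u v) (Times (Plus Size (Num 1)) (Xor (Eq (Witness y) u) (Eq (Color x) (Witness_Color y))))"

definition "initialize k =
  For 14 1 (For 2 1 (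
    Assign 18 (reg 14) (reg 2) (Num 0) (Num 0) (Edge (reg 14) (reg 2)) ;;
    For 3 9 (For 4 9 (If (Eq (reg 14) (reg 2))
      (Assign 16 (reg 14) (reg 3) (reg 2) (reg 4) (Own_Weight k (reg 14) (reg 3)))
      (Assign 16 (reg 14) (reg 3) (reg 2) (reg 4) (Pair_Weight (reg 14) (reg 3) (reg 2) (reg 4)))))))"

text \<open>Register 8 counts the live neighbors of the vertex in register 2, while 11 keeps the
  first and 12 the last of them. A single neighbor ends up in both; for an isolated vertex both keep
  the dummy \<open>n\<close>.\<close>

definition "scan =
  set_reg 11 Size ;; set_reg 12 Size ;; set_reg 8 (Num 0) ;;
  For 14 1 (If (Arr1 19 (reg 14)) Nop (If (Eq (reg 14) (reg 2)) Nop (If (Arr2 18 (reg 14) (reg 2))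
    ((If (reg 8) Nop (set_reg 11 (reg 14))) ;; set_reg 12 (reg 14) ;; set_reg 8 (Plus (reg 8) (Num 1)))
    Nop)))"

text \<open>Loops have no early exit, so the last suitable vertex is taken. The truncated difference
  is zero for degree at most two.\<close>

definition "find_vertex =
  For 2 1 (If (Arr1 19 (reg 2)) Nop
    (scan ;; If (Minus (reg 8) (Num 2)) Nop
      (set_reg 10 (reg 2) ;; set_reg 6 (reg 11) ;; set_reg 7 (reg 12))))"

definition "Local_Cost =
  Plus (Plus (Plus (Arr 16 (reg 10) (reg 5) (reg 10) (reg 5)) (Arr 16 (reg 6) (reg 3) (reg 10) (reg 5)))
      (Arr 16 (reg 10) (reg 5) (reg 6) (reg 3)))
      (Times (Minus (Num 1) (Eq (reg 6) (reg 7)))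
        (Plus (Arr 16 (reg 7) (reg 4) (reg 10) (reg 5)) (Arr 16 (reg 10) (reg 5) (reg 7) (reg 4))))"

text \<open>The guard vanishes in round 0, so the first cost is stored unconditionally, in place of
  an infinite start value. Later it vanishes exactly when the new cost is below the best one in
  register 9.\<close>

definition "minimize =
  For 5 9 (
    set_reg 13 Local_Cost ;;
    If (Times (reg 5) (Minus (Plus (reg 13) (Num 1)) (reg 9))) Nop
      (set_reg 9 (reg 13) ;; Assign 17 (reg 10) (reg 3) (reg 4) (Num 0) (reg 5)))"

text \<open>One orientation of the edge suffices, since \<open>total\<close> adds up both. If
  registers 6 and 7 agree, the cost goes to the diagonal.\<close>

definition "update =
  For 3 9 (For 4 9 (minimize ;; Assign 16 (reg 6) (reg 3) (reg 7) (reg 4)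
    (Plus (Arr 16 (reg 6) (reg 3) (reg 7) (reg 4)) (reg 9))))"

text \<open>Deletion is recorded in array 19 alone; the adjacencies of a deleted vertex remain in
  array 18 and are masked.\<close>

definition "eliminate =
  For 0 1 (find_vertex ;;
    Assign 19 (reg 10) (Num 0) (Num 0) (Num 0) (Num 1) ;;
    Assign 20 (reg 0) (Num 0) (Num 0) (Num 0) (reg 10) ;;
    Assign 21 (reg 10) (Num 0) (Num 0) (Num 0) (reg 6) ;;
    Assign 22 (reg 10) (Num 0) (Num 0) (Num 0) (reg 7) ;;
    (If (Eq (reg 6) (reg 7)) Nop
      (Assign 18 (reg 6) (reg 7) (Num 0) (Num 0) (Num 1) ;;
       Assign 18 (reg 7) (reg 6) (Num 0) (Num 0) (Num 1))) ;;
    update)"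

text \<open>Backwards through the elimination order: the recorded neighbors were alive when the
  vertex was deleted, so their values are fixed by now. The dummy keeps the value 0.\<close>

definition "backtrack =
  For 0 1 (set_reg 2 (Arr1 20 (Minus (Minus Size (Num 1)) (reg 0))) ;;
    Assign 23 (reg 2) (Num 0) (Num 0) (Num 0)
      (Arr 17 (reg 2) (Arr1 23 (Arr1 21 (reg 2))) (Arr1 23 (Arr1 22 (reg 2))) (Num 0)))"

text \<open>The colors overwrite the input cells. Vertex 0 is left to the final store, as its cell
  still holds \<open>n\<close>.\<close>

definition "write_colors =
  For 0 1 (If (reg 0) (Output (reg 0) (Color (Arr1 23 (reg 0)))) Nop)"

text \<open>\<open>D\<close> and \<open>A\<close> mark the entries of the weights and of the
  adjacency matrix written so far, so the four nested loops share one invariant.\<close>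

definition initialized ::
  "nat \<Rightarrow> nat \<Rightarrow> nat set set \<Rightarrow> arrays \<Rightarrow> (nat \<Rightarrow> nat \<Rightarrow> nat \<Rightarrow> nat \<Rightarrow> bool) \<Rightarrow> (nat \<Rightarrow> nat \<Rightarrow> bool) \<Rightarrow> arrays \<Rightarrow> bool"
where
  "initialized k n E h0 D A h \<longleftrightarrow> frame {2, 3, 4, 14, 16, 18} h0 h \<and>
     (\<forall>u x v y. h (16, u, x, v, y) = (if D u x v y then pair_weight k n E u x v y else 0)) \<and>
     (\<forall>u v. h (18, u, v, 0, 0) = (if A u v then of_bool ({u, v} \<in> E) else 0))"

lemma initialized_reg:
  "initialized k n E h0 D A h \<Longrightarrow> r \<in> {2, 3, 4, 14} \<Longrightarrow> initialized k n E h0 D A (h((r, p) := x))"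
  unfolding initialized_def by (auto intro!: frame_update)

lemma initialized_cong:
  "initialized k n E h0 D A h \<Longrightarrow> (\<And>u x v y. D u x v y = D' u x v y) \<Longrightarrow> (\<And>u v. A u v = A' u v) \<Longrightarrow>
    initialized k n E h0 D' A' h"
  unfolding initialized_def by simp

lemma pair_weight_bound [simp]: "pair_weight k n E u x v y < value_bound n"
proof (rule value_boundI)
  have "pair_weight k n E u x v y \<le> 1000 * (n + 1) ^ 1" using pair_weight_le[of k n E u x v y] by simp
  also have "\<dots> \<le> 1000 * (n + 1) ^ 4" by (intro mult_left_mono power_increasing) simp_all
  finally show "pair_weight k n E u x v y \<le> 1000 * (n + 1) ^ 4" .
qed

lemma witness_less: "x < 9 * n \<Longrightarrow> witness x < n"
  unfolding witness_def by auto

lemma wp_initialize: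
  assumes zero: "\<And>t p. t < 32 \<Longrightarrow> h0 (t, p) = 0"
    and inp: "\<And>u v. u < n \<Longrightarrow> v < n \<Longrightarrow> h0 (32, 1 + (u * n + v), 0, 0, 0) = of_bool ({u, v} \<in> E)"
  shows "wp n (initialize k) (initialized k n E h0 (\<lambda>u x v y. u < n \<and> v < n \<and> x < 9 * n \<and> y < 9 * n)
      (\<lambda>u v. u < n \<and> v < n)) h0"
proof -
  \<comment> \<open>The entries lexicographically before \<open>(i, j, l, m)\<close> in the loop
    order, which is \<open>u\<close>, \<open>v\<close>, \<open>x\<close>, \<open>y\<close>.\<close>
  let ?D = "\<lambda>i j l m u x v y. x < 9 * n \<and> y < 9 * n \<and> v < n \<and> (u < i \<or> u = i \<and> (v < j \<or> v = j \<and> (x < l \<or> x = l \<and> y < m)))"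
  let ?A = "\<lambda>i j u v. v < n \<and> (u < i \<or> u = i \<and> v < j)"
  let ?I = "\<lambda>i j l m i' j'. initialized k n E h0 (?D i j l m) (?A i' j')"
  have input: "h (32, Suc (u * n + v), 0, 0, 0) = of_bool ({u, v} \<in> E)"
    if "initialized k n E h0 D A h" "u < n" "v < n" for h D A u v
    using frameD[of "{2, 3, 4, 14, 16, 18}" h0 h 32] inp[OF that(2,3)] that(1) unfolding initialized_def by simp
  have store: "?I i j l (Suc m) i' j' (h((16, i, l, j, m) := pair_weight k n E i l j m))"
    if "?I i j l m i' j' h" "l < 9 * n" "m < 9 * n" "j < n" for i j l m i' j' h
    using that unfolding initialized_def by (auto intro!: frame_update simp: less_Suc_eq)
  show ?thesis
    unfolding initialize_def
  proof (rule wp_For[where I = "\<lambda>i. ?I i 0 0 0 i 0"], goal_cases)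
    case 3
    show ?case using zero unfolding initialized_def by (auto intro!: frame_update)
  next
    case (5 h)
    then show ?case by (rule initialized_cong) auto
  next
    case (4 i h)
    note i = 4
    show ?case
    proof (rule wp_For[where I = "\<lambda>j h. ?I i j 0 0 i j h \<and> val h 14 = i"], goal_cases)
      case 3
      then show ?case using initialized_reg[OF i(2), of 2] i by simp
    next
      case (5 h)
      then have "?I i (1 * n) 0 0 i (1 * n) (h((14, 0, 0, 0, 0) := Suc i))" by (auto intro!: initialized_reg)
      then have "?I (Suc i) 0 0 0 (Suc i) 0 (h((14, 0, 0, 0, 0) := Suc i))"
        by (rule initialized_cong) (auto simp: less_Suc_eq)
      then show ?case using 5 by simp
    next
      case (4 j h)
      note j = 4
      have ij: "i < n" "j < n" "val h 14 = i" "val h 2 = j" using i j by auto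
      have adj: "?I i j 0 0 i (Suc j) (h((18, i, j, 0, 0) := of_bool ({i, j} \<in> E)))"
        using j i(1) unfolding initialized_def by (auto intro!: frame_update simp: less_Suc_eq)
      have "h (32, Suc (i * n + j), 0, 0, 0) = of_bool ({i, j} \<in> E)"
        using input[OF _ ij(1,2)] j by blast
      then have edge: "hval n (Edge (reg 14) (reg 2)) h = of_bool ({i, j} \<in> E)" using ij by simp
      show ?case
      proof (rule wp_Then, rule wp_Assign, goal_cases)
        case 4
        have eq: "h((18, hval n (reg 14) h, hval n (reg 2) h, hval n (Num 0) h, hval n (Num 0) h) :=
           hval n (Edge (reg 14) (reg 2)) h) = h((18, i, j, 0, 0) := of_bool ({i, j} \<in> E))"
          unfolding edge using ij by simp
        show ?case
          unfolding eq
        proof (rule wp_For[where I = "\<lambda>l h. ?I i j l 0 i (Suc j) h \<and> val h 14 = i \<and> val h 2 = j"], goal_cases)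
          case 3
          then show ?case using initialized_reg[OF adj, of 3] j by simp
        next
          case (5 h)
          then have "?I i j (9 * n) 0 i (Suc j) (h((2, 0, 0, 0, 0) := Suc j))" by (auto intro!: initialized_reg)
          then have "?I i (Suc j) 0 0 i (Suc j) (h((2, 0, 0, 0, 0) := Suc j))"
            by (rule initialized_cong) (use j in \<open>auto simp: less_Suc_eq\<close>)
          then show ?case using 5 by simp
        next
          case (4 l h)
          show ?case
          proof (rule wp_For[where I = "\<lambda>m h. ?I i j l m i (Suc j) h \<and> val h 14 = i \<and> val h 2 = j \<and> val h 3 = l"], goal_cases)
            case 3
            then show ?case using 4 by (auto intro!: initialized_reg)
          next
            case (5 h)
            then have "?I i j l (9 * n) i (Suc j) (h((3, 0, 0, 0, 0) := Suc l))" by (auto intro!: initialized_reg)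
            then have "?I i j (Suc l) 0 i (Suc j) (h((3, 0, 0, 0, 0) := Suc l))"
              by (rule initialized_cong) (use 4 in \<open>auto simp: less_Suc_eq\<close>)
            then show ?case using 5 by simp
          next
            case (4 m h)
            have b: "l < 9 * n" "m < 9 * n" using 4 \<open>l < 9 * n\<close> by auto
            have inv: "?I i j l m i (Suc j) h" and regs: "val h 14 = i" "val h 2 = j" "val h 3 = l" "val h 4 = m"
              using 4 by auto
            let ?h = "h((16, i, l, j, m) := pair_weight k n E i l j m)"
            have post: "val ?h 4 = m \<and> ?I i j l (Suc m) i (Suc j) (?h((4, 0, 0, 0, 0) := Suc m)) \<and>
              val (?h((4, 0, 0, 0, 0) := Suc m)) 14 = i \<and> val (?h((4, 0, 0, 0, 0) := Suc m)) 2 = j \<and>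
              val (?h((4, 0, 0, 0, 0) := Suc m)) 3 = l"
              using initialized_reg[OF store[OF inv b ij(2)], of 4] regs by simp
            have w: "witness l < n" using b(1) by (rule witness_less)
            note ins = input[OF inv ij(1,2)] input[OF inv ij(1) w]
            show ?case
            proof (rule wp_If, goal_cases)
              case 1
              then show ?case using ij regs by simp
            next
              case 2
              then have eq: "i = j" using regs by simp
              have v: "hval n (Own_Weight k (reg 14) (reg 3)) h = pair_weight k n E i l j m"
                using ij eq regs ins by (simp add: Own_Weight_def pair_weight_def violations_def of_bool_def)
              show ?case
                by (rule wp_Assign, unfold v) (use ij b regs w post in \<open>simp_all add: Own_Weight_def\<close>)
            next
              case 3
              then have ne: "i \<noteq> j" using regs by simp
              have v: "hval n (Pair_Weight (reg 14) (reg 3) (reg 2) (reg 4)) h = pair_weight k n E i l j m"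
                using ij ne regs ins by (simp add: Pair_Weight_def pair_weight_def)
              show ?case
                by (rule wp_Assign, unfold v) (use ij b regs w post in \<open>simp_all add: Pair_Weight_def\<close>)
            qed
          qed simp_all
        qed simp_all
      qed (use ij edge in auto)
    qed simp_all
  qed simp_all
qed

section \<open>Finding a vertex of degree at most two\<close>

definition live_nbrs :: "nat \<Rightarrow> arrays \<Rightarrow> nat \<Rightarrow> nat set" where
  "live_nbrs n h v = {u. u < n \<and> h (19, u, 0, 0, 0) = 0 \<and> u \<noteq> v \<and> h (18, u, v, 0, 0) \<noteq> 0}"

definition scanned :: "nat \<Rightarrow> nat set \<Rightarrow> arrays \<Rightarrow> bool" where
  "scanned n N h \<longleftrightarrow> val h 8 = card N \<and>
     (if N = {} then val h 11 = n \<and> val h 12 = n else val h 11 \<in> N \<and> val h 12 \<in> N) \<and>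
     (card N = 2 \<longrightarrow> val h 11 \<noteq> val h 12)"

lemma scanned_update: "t \<notin> {8, 11, 12} \<Longrightarrow> scanned n N (h((t, p) := x)) = scanned n N h"
  by (auto simp: scanned_def)

lemma scanned_insert:
  assumes "finite N" "i \<notin> N" "val h 8 = Suc (card N)" "val h 12 = i"
    "if N = {} then val h 11 = i else val h 11 \<in> N"
  shows "scanned n (insert i N) h"
proof -
  have "N \<noteq> {}" if "card (insert i N) = 2" using that by auto
  then show ?thesis using assms unfolding scanned_def by (auto split: if_splits)
qed

lemma live_nbrs_frame: "frame T h h' \<Longrightarrow> 18 \<notin> T \<Longrightarrow> 19 \<notin> T \<Longrightarrow> live_nbrs n h' v = live_nbrs n h v"
  unfolding live_nbrs_def by (simp add: frameD)

lemma wp_scan: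
  assumes v: "val h0 2 = v" "v < n"
  shows "wp n scan (\<lambda>h. frame {8, 11, 12, 14} h0 h \<and> scanned n (live_nbrs n h0 v) h) h0"
proof -
  let ?N = "live_nbrs n h0 v" and ?F = "frame {8, 11, 12, 14} h0"
  let ?Ni = "\<lambda>i. {u \<in> ?N. u < i}"
  have fin: "finite ?N" unfolding live_nbrs_def by simp
  have N0: "?Ni 0 = {}" by simp
  have Nn: "?Ni n = ?N" unfolding live_nbrs_def by auto
  have NS: "?Ni (Suc i) = (if i \<in> ?N then insert i (?Ni i) else ?Ni i)" for i
    by (auto simp: less_Suc_eq)
  have small: "card (?Ni i) \<le> i" for i
    using card_mono[of "{..<i}" "?Ni i"] by auto
  have skip: "wp n Nop (\<lambda>h'. val h' 14 = i \<and> ?F (h'((14, 0, 0, 0, 0) := Suc i)) \<and> scanned n (?Ni (Suc i)) (h'((14, 0, 0, 0, 0) := Suc i))) h"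
    if "?F h" "scanned n (?Ni i) h" "val h 14 = i" "i \<notin> ?N" for i h
    using that by (intro wp_Nop) (simp add: NS scanned_update frame_update)
  show ?thesis
    unfolding scan_def
  proof (rule wp_Then, rule wp_Assign, goal_cases)
    case 4
    show ?case
    proof (rule wp_Then, rule wp_Assign, goal_cases)
      case 4
      show ?case
      proof (rule wp_Then, rule wp_Assign, goal_cases)
        case 4
        show ?case
        proof (rule wp_For[where I = "\<lambda>i h. ?F h \<and> scanned n (?Ni i) h"], goal_cases)
          case 3
          show ?case by (auto simp: scanned_def intro!: frame_update)
        next
          case (5 h)
          then show ?case using Nn by simp
        next
          case (4 i h)
          then have i: "i < n" and F: "?F h" and sc: "scanned n (?Ni i) h" and r: "val h 14 = i" by auto
          have v': "val h 2 = v" using frameD[OF F, of 2] v by simp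
          have live: "h (19, i, 0, 0, 0) = h0 (19, i, 0, 0, 0)" "h (18, i, v, 0, 0) = h0 (18, i, v, 0, 0)"
            using frameD[OF F] by simp_all
          show ?case
          proof (rule wp_If, goal_cases)
            case 1 then show ?case using i r by simp
          next
            case 2
            then show ?case using r live by (intro skip F sc r) (simp add: live_nbrs_def)
          next
            case 3
            note a = 3
            show ?case
            proof (rule wp_If, goal_cases)
              case 1 then show ?case using i r v' by simp
            next
              case 2
              then show ?case using r v' by (intro skip F sc r) (simp add: live_nbrs_def)
            next
              case 3
              note b = 3
              show ?case
              proof (rule wp_If, goal_cases)
                case 1 then show ?case using i r v' v by simp
              next
                case 3
                then show ?case using r v' live by (intro skip F sc r) (simp add: live_nbrs_def)
              next
                case 2
                have iN: "i \<in> ?N" using a b 2 i r v' live by (simp add: live_nbrs_def)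
                have Ni: "?Ni (Suc i) = insert i (?Ni i)" using NS iN by simp
                have card: "card (?Ni (Suc i)) = Suc (card (?Ni i))"
                  unfolding Ni using fin by (subst card_insert_disjoint) auto
                have c: "val h 8 = card (?Ni i)" using sc unfolding scanned_def by simp
                have bd: "i < value_bound n" "Suc (card (?Ni i)) < value_bound n"
                  using i small[of i] by (auto intro!: value_bound_small)
                have e0: "card (?Ni i) = 0 \<longleftrightarrow> ?Ni i = {}" using fin by simp
                have fin': "wp n (set_reg 12 (reg 14) ;; set_reg 8 (Plus (reg 8) (Num 1)))
                  (\<lambda>h'. val h' 14 = i \<and> ?F (h'((14, 0, 0, 0, 0) := Suc i)) \<and>
                    scanned n (?Ni (Suc i)) (h'((14, 0, 0, 0, 0) := Suc i))) h'"
                  if h': "?F h'" "val h' 14 = i" "val h' 8 = card (?Ni i)"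
                    "if ?Ni i = {} then val h' 11 = i else val h' 11 \<in> ?Ni i" for h' :: arrays
                proof (rule wp_Then, rule wp_Assign, goal_cases)
                  case 4
                  show ?case
                  proof (rule wp_Assign, goal_cases)
                    case 4
                    let ?g = "h'((12, 0, 0, 0, 0) := i, (8, 0, 0, 0, 0) := Suc (card (?Ni i)), (14, 0, 0, 0, 0) := Suc i)"
                    have "scanned n (insert i (?Ni i)) ?g"
                    proof (rule scanned_insert)
                      show "finite (?Ni i)" using fin by simp
                      have "val ?g 11 = val h' 11" by simp
                      then show "if ?Ni i = {} then val ?g 11 = i else val ?g 11 \<in> ?Ni i"
                        using h'(4) by (simp only:)
                    qed simp_all
                    moreover have "?F ?g" using h'(1) by (intro frame_update) simp_all
                    ultimately show ?case using h'(2,3) unfolding Ni by simp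
                  qed (use h'(3) bd(2) in simp_all)
                qed (use h'(2) bd(1) in simp_all)
                show ?case
                proof (rule wp_Then, rule wp_If, goal_cases)
                  case 1 then show ?case by simp
                next
                  case 2
                  then have "?Ni i \<noteq> {}" using c e0 by simp
                  then have p: "if ?Ni i = {} then val h 11 = i else val h 11 \<in> ?Ni i"
                    using sc unfolding scanned_def by (simp only: if_False)
                  show ?case by (rule wp_Nop, rule fin'[OF F r c p])
                next
                  case 3
                  then have "?Ni i = {}" using c e0 by simp
                  show ?case
                  proof (rule wp_Assign, goal_cases)
                    case 4
                    show ?case
                      by (rule fin') (use F r c \<open>?Ni i = {}\<close> in \<open>simp_all add: frame_update\<close>)
                  qed (use r bd(1) in simp_all)
                qed
              qed
            qed
          qed
        qed simp_all
      qed simp_all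
    qed simp_all
  qed simp_all
qed

definition low_degree :: "nat \<Rightarrow> arrays \<Rightarrow> nat \<Rightarrow> bool" where
  "low_degree n h v \<longleftrightarrow> v < n \<and> h (19, v, 0, 0, 0) = 0 \<and> card (live_nbrs n h v) \<le> 2"

text \<open>An isolated vertex is treated as attached to the dummy, so that its optimal cost has a
  place to go.\<close>

definition eliminable :: "nat \<Rightarrow> arrays \<Rightarrow> nat \<Rightarrow> nat \<Rightarrow> nat \<Rightarrow> bool" where
  "eliminable n h v a b \<longleftrightarrow> v < n \<and> h (19, v, 0, 0, 0) = 0 \<and>
     (live_nbrs n h v = {} \<and> a = n \<and> b = n \<or> live_nbrs n h v = {a, b})"

text \<open>The first and the last neighbor found form a subset of the live neighbors; for degree
  one or two it has as many elements and so is all of them.\<close>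

lemma scanned_eliminable:
  assumes "scanned n (live_nbrs n h v) h'" "low_degree n h v"
  shows "eliminable n h v (val h' 11) (val h' 12)"
proof (cases "live_nbrs n h v = {}")
  case True
  then show ?thesis using assms unfolding eliminable_def low_degree_def scanned_def by simp
next
  case False
  let ?N = "live_nbrs n h v" and ?M = "{val h' 11, val h' 12}"
  have fin: "finite ?N" unfolding live_nbrs_def by simp
  have sub: "?M \<subseteq> ?N" using assms(1) False unfolding scanned_def by simp
  have "card ?N \<noteq> 0" using False fin by simp
  then have "card ?N = 1 \<or> card ?N = 2" using assms(2) unfolding low_degree_def by linarith
  moreover have "1 \<le> card ?M" by (simp add: Suc_le_eq card_gt_0_iff)
  ultimately have "card ?N \<le> card ?M" using assms(1) unfolding scanned_def by auto
  then have "?M = ?N" using card_seteq[OF fin sub] by blast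
  then show ?thesis using assms(2) unfolding eliminable_def low_degree_def by simp
qed

lemma wp_find_vertex:
  assumes "\<exists>v. low_degree n h0 v"
  shows "wp n find_vertex (\<lambda>h. frame {2, 6, 7, 8, 10, 11, 12, 14} h0 h \<and>
    eliminable n h0 (val h 10) (val h 6) (val h 7)) h0"
proof -
  let ?F = "frame {2, 6, 7, 8, 10, 11, 12, 14} h0"
  let ?I = "\<lambda>i h. ?F h \<and> ((\<exists>v<i. low_degree n h0 v) \<longrightarrow> eliminable n h0 (val h 10) (val h 6) (val h 7))"
  have skip: "val h 2 = i \<and> ?I (Suc i) (h((2, 0, 0, 0, 0) := Suc i))"
    if "?I i h" "val h 2 = i" "\<not> low_degree n h0 i" for i h
    using that by (auto simp: less_Suc_eq intro!: frame_update)
  show ?thesis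
    unfolding find_vertex_def
  proof (rule wp_For[where I = ?I], goal_cases)
    case 3
    show ?case by (auto intro!: frame_update)
  next
    case (5 h)
    moreover have "\<exists>v<n. low_degree n h0 v" using assms unfolding low_degree_def by blast
    ultimately show ?case by simp
  next
    case (4 i h)
    then have i: "i < n" and I: "?I i h" and r: "val h 2 = i" by auto
    have live: "h (19, i, 0, 0, 0) = h0 (19, i, 0, 0, 0)" "live_nbrs n h i = live_nbrs n h0 i"
      using I frameD[of _ h0 h 19] live_nbrs_frame[of _ h0 h] by auto
    show ?case
    proof (rule wp_If, goal_cases)
      case 1 then show ?case using i r by simp
    next
      case 2
      then have "\<not> low_degree n h0 i" using r live by (simp add: low_degree_def)
      then show ?case using skip[OF I r] by (intro wp_Nop)
    next
      case 3
      note a = 3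
      show ?case
      proof (rule wp_Then, rule wp_mono[OF wp_scan[of h i n, OF r i]], elim conjE, goal_cases)
        case (1 h')
        have F: "?F h'" using I frame_trans[OF _ 1(1)] by blast
        have same: "val h' 2 = i" "val h' 10 = val h 10" "val h' 6 = val h 6" "val h' 7 = val h 7"
          using frameD[OF 1(1)] r by simp_all
        have sc: "scanned n (live_nbrs n h0 i) h'" using 1(2) live by simp
        show ?case
        proof (rule wp_If, goal_cases)
          case 1 then show ?case by simp
        next
          case 2
          then have "\<not> low_degree n h0 i" using sc by (simp add: low_degree_def scanned_def)
          moreover have "?I i h'" using I F same by simp
          ultimately show ?case using skip same(1) by (intro wp_Nop) blast
        next
          case 3
          then have "low_degree n h0 i"
            using sc a i r live by (simp add: low_degree_def scanned_def)
          then have el: "eliminable n h0 i (val h' 11) (val h' 12)" using scanned_eliminable[OF sc] by blast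
          then have "val h' 11 = n \<or> val h' 11 \<in> live_nbrs n h0 i" "val h' 12 = n \<or> val h' 12 \<in> live_nbrs n h0 i"
            unfolding eliminable_def by blast+
          then have le: "val h' 11 \<le> n" "val h' 12 \<le> n" unfolding live_nbrs_def by force+
          show ?case
          proof (rule wp_Then, rule wp_Assign, goal_cases)
            case 4
            show ?case
            proof (rule wp_Then, rule wp_Assign, goal_cases)
              case 4
              show ?case
                using F same le i el by (intro wp_Assign) (auto intro!: frame_update)
            qed (use le in simp_all)
          qed (use i same in simp_all)
        qed
      qed
    qed
  qed simp_all
qed

section \<open>Moving the optimal contribution of a vertex onto an edge\<close>

abbreviation "weights_of h \<equiv> (\<lambda>u x v y. (h :: arrays) (16, u, x, v, y))"

lemma wp_minimize:
  fixes h0 :: arrays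
  assumes regs: "val h0 10 = v" "val h0 3 = x" "val h0 4 = y" "val h0 6 = a" "val h0 7 = b"
    and lt: "v < n" "x < 9 * n" "y < 9 * n" "a \<le> n" "b \<le> n"
    and L: "\<And>z. L z = local_cost (weights_of h0) v a b x y z"
    and bound: "\<And>z. z < 9 * n \<Longrightarrow> L z \<le> 40 * (n + 1) ^ 4"
  shows "wp n minimize (\<lambda>h. frame {5, 9, 13, 17} h0 h \<and>
     (\<forall>p. p \<noteq> (v, x, y, 0) \<longrightarrow> h (17, p) = h0 (17, p)) \<and>
     h (17, v, x, y, 0) < 9 * n \<and> val h 9 = L (h (17, v, x, y, 0)) \<and> (\<forall>z<9 * n. L (h (17, v, x, y, 0)) \<le> L z)) h0"
proof -
  let ?F = "\<lambda>h. frame {5, 9, 13, 17} h0 h \<and> (\<forall>p. p \<noteq> (v, x, y, 0) \<longrightarrow> h (17, p) = h0 (17, p))"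
  \<comment> \<open>Before round 0 no minimizer has been stored, hence the guard
    \<open>0 < i\<close>.\<close>
  let ?M = "\<lambda>i h. 0 < i \<longrightarrow> h (17, v, x, y, 0) < i \<and> val h 9 = L (h (17, v, x, y, 0)) \<and> (\<forall>z<i. L (h (17, v, x, y, 0)) \<le> L z)"
  have F_upd: "?F (h((t, p) := w))" if "?F h" "t \<in> {5, 9, 13, 17}" "t = 17 \<longrightarrow> p = (v, x, y, 0)" for h t p w
    using that by (auto intro!: frame_update)
  show ?thesis
    unfolding minimize_def
  proof (rule wp_For[where I = "\<lambda>i h. ?F h \<and> ?M i h"], goal_cases)
    case 3
    show ?case using F_upd[of h0 5 "(0, 0, 0, 0)" 0] by simp
  next
    case (5 h)
    moreover have "0 < 9 * n" using lt(1) by simp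
    ultimately show ?case by blast
  next
    case (4 i h)
    then have i: "i < 9 * n" "val h 5 = i" and F: "?F h" and M: "?M i h" by auto
    have same: "h (t, p) = h0 (t, p)" if "t \<notin> {5, 9, 13, 17}" for t p
      using F frameD that by blast
    have r: "val h 10 = v" "val h 3 = x" "val h 4 = y" "val h 6 = a" "val h 7 = b"
      using same regs by simp_all
    have v: "hval n Local_Cost h = L i"
      using r i same by (cases "a = b") (simp_all add: local_cost_def L Local_Cost_def)
    have Li: "L i < value_bound n" using bound[OF i(1)] by (intro value_boundI) linarith
    show ?case
    proof (rule wp_Then, rule wp_Assign, goal_cases)
      case 2
      then show ?case using r lt i by (simp add: Local_Cost_def)
    next
      case 4
      let ?h = "h((13, 0, 0, 0, 0) := L i)"
      have eq: "h((13, hval n (Num 0) h, hval n (Num 0) h, hval n (Num 0) h, hval n (Num 0) h) :=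
        hval n Local_Cost h) = ?h"
        unfolding v by simp
      have F1: "?F ?h" using F_upd[OF F, of 13] by simp
      have M1: "?M i ?h" using M by auto
      show ?case
        unfolding eq
      proof (rule wp_If, goal_cases)
        case 1 then show ?case by simp
      next
        case 2
        then have "0 < i" "val h 9 \<le> L i" using i by auto
        then have "?M (Suc i) (?h((5, 0, 0, 0, 0) := Suc i))" using M by (auto simp: less_Suc_eq)
        then show ?case using F_upd[OF F1, of 5] i by (intro wp_Nop) simp
      next
        case 3
        then have new: "i = 0 \<or> L i < val h 9" using i by auto
        let ?g = "?h((9, 0, 0, 0, 0) := L i, (17, v, x, y, 0) := i)"
        have "L i \<le> L z" if "z < Suc i" for z
        proof (cases "z = i")
          case False
          then have "z < i" "0 < i" using that by auto
          then have "val h 9 \<le> L z" "L i < val h 9" using M new by auto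
          then show ?thesis by simp
        qed simp
        then have M2: "?M (Suc i) (?g((5, 0, 0, 0, 0) := Suc i))" by simp
        have F2: "?F (?g((5, 0, 0, 0, 0) := Suc i))"
          by (intro F_upd) (use F in simp_all)
        show ?case
        proof (rule wp_Then, rule wp_Assign, goal_cases)
          case 4
          show ?case
          proof (rule wp_Assign, goal_cases)
            case 4
            show ?case using M2 F2 r i by simp
          qed (use r lt i in simp_all)
        qed (use Li in simp_all)
      qed
    qed (use v Li in simp_all)
  qed simp_all
qed

definition updated ::
  "nat \<Rightarrow> arrays \<Rightarrow> nat \<Rightarrow> nat \<Rightarrow> nat \<Rightarrow> (nat \<Rightarrow> nat \<Rightarrow> bool) \<Rightarrow> arrays \<Rightarrow> bool" where
  "updated n h0 v a b D h \<longleftrightarrow> frame {3, 4, 5, 9, 13, 16, 17} h0 h \<and>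
     (\<forall>u x w y. h (16, u, x, w, y) = h0 (16, u, x, w, y) +
       (if u = a \<and> w = b \<and> D x y then local_cost (weights_of h0) v a b x y (h (17, v, x, y, 0)) else 0)) \<and>
     (\<forall>x y. D x y \<longrightarrow> h (17, v, x, y, 0) < 9 * n \<and> (\<forall>z<9 * n.
        local_cost (weights_of h0) v a b x y (h (17, v, x, y, 0)) \<le> local_cost (weights_of h0) v a b x y z)) \<and>
     (\<forall>w p. w \<noteq> v \<longrightarrow> h (17, w, p) = h0 (17, w, p))"

lemma updated_reg: "updated n h0 v a b D h \<Longrightarrow> r \<in> {3, 4, 5, 9, 13} \<Longrightarrow> updated n h0 v a b D (h((r, p) := c))"
  unfolding updated_def by (auto intro!: frame_update)

lemma updated_cong: "updated n h0 v a b D h \<Longrightarrow> (\<And>x y. D x y = D' x y) \<Longrightarrow> updated n h0 v a b D' h"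
  unfolding updated_def by simp

text \<open>Local costs only read entries involving \<open>v\<close>, whereas the updates only write
  entries between \<open>a\<close> and \<open>b\<close>. So the costs may be read while the weights
  are being changed.\<close>

lemma updated_local_cost:
  assumes "updated n h0 v a b D h" "v \<noteq> a" "v \<noteq> b"
  shows "local_cost (weights_of h) v a b x y z = local_cost (weights_of h0) v a b x y z"
  using assms unfolding updated_def local_cost_def by simp

lemma wp_update:
  fixes h0 :: arrays
  assumes regs: "val h0 10 = v" "val h0 6 = a" "val h0 7 = b"
    and lt: "v < n" "a \<le> n" "b \<le> n" and ne: "v \<noteq> a" "v \<noteq> b"
    and bound: "\<And>u w x y. u \<in> {v, a, b} \<Longrightarrow> w \<in> {v, a, b} \<Longrightarrow> x < 9 * n \<Longrightarrow> y < 9 * n \<Longrightarrow>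
      h0 (16, u, x, w, y) \<le> 8 * (n + 1) ^ 4"
  shows "wp n update (updated n h0 v a b (\<lambda>x y. x < 9 * n \<and> y < 9 * n)) h0"
proof -
  let ?D = "\<lambda>i j x y. y < 9 * n \<and> (x < i \<or> x = i \<and> y < j)"
  let ?I = "\<lambda>i j. updated n h0 v a b (?D i j)"
  let ?L = "local_cost (weights_of h0) v a b"
  \<comment> \<open>At most five entries, each bounded by \<open>8 * (n + 1) ^ 4\<close>.\<close>
  have Lb: "?L x y z \<le> 40 * (n + 1) ^ 4" if "x < 9 * n" "y < 9 * n" "z < 9 * n" for x y z
    using bound[of v v z z] bound[of a v x z] bound[of v a z x] bound[of b v y z] bound[of v b z y] that
    unfolding local_cost_def by (cases "a = b") simp_all
  show ?thesis
    unfolding update_def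
  proof (rule wp_For[where I = "\<lambda>i. ?I i 0"], goal_cases)
    case 3
    show ?case unfolding updated_def by (auto intro!: frame_update)
  next
    case (5 h)
    then show ?case by (rule updated_cong) auto
  next
    case (4 i h)
    note i = 4
    show ?case
    proof (rule wp_For[where I = "\<lambda>j h. ?I i j h \<and> val h 3 = i"], goal_cases)
      case 3
      then show ?case using updated_reg[OF i(2), of 4] i(3) by simp
    next
      case (5 h)
      then have "?I i (9 * n) (h((3, 0, 0, 0, 0) := Suc i))" by (auto intro!: updated_reg)
      then have "?I (Suc i) 0 (h((3, 0, 0, 0, 0) := Suc i))"
        by (rule updated_cong) (auto simp: less_Suc_eq)
      then show ?case using 5 by simp
    next
      case (4 j h)
      then have ij: "i < 9 * n" "j < 9 * n" and I: "?I i j h" and r: "val h 3 = i" "val h 4 = j" using i by auto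
      have F: "frame {3, 4, 5, 9, 13, 16, 17} h0 h" using I unfolding updated_def by blast
      have r': "val h 10 = v" "val h 6 = a" "val h 7 = b" using frameD[OF F] regs by simp_all
      have L: "?L i j z = local_cost (weights_of h) v a b i j z" for z
        using updated_local_cost[OF I ne] by simp
      have wab: "h (16, a, i, b, j) = h0 (16, a, i, b, j)" using I unfolding updated_def by simp
      show ?case
      proof (rule wp_Then, rule wp_mono[OF wp_minimize[OF r'(1) r r'(2,3) lt(1) ij lt(2,3) L Lb[OF ij]]],
          assumption, elim conjE, goal_cases)
        case (1 h')
        let ?z = "h' (17, v, i, j, 0)"
        let ?g = "h'((16, a, i, b, j) := h' (16, a, i, b, j) + val h' 9)"
        have F': "frame {3, 4, 5, 9, 13, 16, 17} h0 h'" using frame_trans[OF F 1(1)] by blast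
        have same: "h' (16, p) = h (16, p)" for p using frameD[OF 1(1)] by simp
        have rr: "val h' 3 = i" "val h' 4 = j" "val h' 6 = a" "val h' 7 = b"
          using frameD[OF 1(1)] r r' by simp_all
        have Z: "h' (17, w, p) = h (17, w, p)" if "(w, p) \<noteq> (v, i, j, 0)" for w p using 1(2) that by blast
        have "?L i j ?z \<le> 40 * (n + 1) ^ 4" using Lb[OF ij 1(3)] .
        moreover have "h' (16, a, i, b, j) \<le> 8 * (n + 1) ^ 4" using bound[of a b i j] ij same wab by simp
        ultimately have vb: "h' (16, a, i, b, j) + val h' 9 < value_bound n"
          using 1(4) by (intro value_boundI) linarith
        have "?I i (Suc j) ?g"
          unfolding updated_def
        proof (intro conjI allI impI)
          show "frame {3, 4, 5, 9, 13, 16, 17} h0 ?g" using F' by (intro frame_update) simp_all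
        next
          fix u x w y
          show "?g (16, u, x, w, y) = h0 (16, u, x, w, y) +
            (if u = a \<and> w = b \<and> ?D i (Suc j) x y then ?L x y (?g (17, v, x, y, 0)) else 0)"
          proof (cases "u = a \<and> x = i \<and> w = b \<and> y = j")
            case True
            then show ?thesis using same wab 1(4) ij by simp
          next
            case False
            then have "?g (16, u, x, w, y) = h (16, u, x, w, y)" using same by auto
            also have "\<dots> = h0 (16, u, x, w, y) +
              (if u = a \<and> w = b \<and> ?D i j x y then ?L x y (h (17, v, x, y, 0)) else 0)"
              using I unfolding updated_def by blast
            also have "\<dots> = h0 (16, u, x, w, y) +
              (if u = a \<and> w = b \<and> ?D i (Suc j) x y then ?L x y (?g (17, v, x, y, 0)) else 0)"
            proof -
              have "?D i j x y = ?D i (Suc j) x y" if "u = a" "w = b" using False that by (auto simp: less_Suc_eq)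
              moreover have "h (17, v, x, y, 0) = ?g (17, v, x, y, 0)" if "u = a" "w = b"
                using False that Z[of v "(x, y, 0)"] by auto
              ultimately show ?thesis by auto
            qed
            finally show ?thesis .
          qed
        next
          fix x y assume D: "?D i (Suc j) x y"
          have "h' (17, v, x, y, 0) < 9 * n \<and> (\<forall>z<9 * n. ?L x y (h' (17, v, x, y, 0)) \<le> ?L x y z)"
          proof (cases "x = i \<and> y = j")
            case True
            then show ?thesis using 1(3-5) by simp
          next
            case False
            then have "?D i j x y" "h' (17, v, x, y, 0) = h (17, v, x, y, 0)"
              using D Z[of v "(x, y, 0)"] by (auto simp: less_Suc_eq)
            then show ?thesis using I unfolding updated_def by simp
          qed
          then show "?g (17, v, x, y, 0) < 9 * n"
            "\<And>z. z < 9 * n \<Longrightarrow> ?L x y (?g (17, v, x, y, 0)) \<le> ?L x y z" by simp_all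
        next
          fix w p assume "w \<noteq> v"
          then show "?g (17, w, p) = h0 (17, w, p)" using Z[of w p] I unfolding updated_def by simp
        qed
        then have "?I i (Suc j) (?g((4, 0, 0, 0, 0) := Suc j))" by (rule updated_reg) simp
        then show ?case
          using rr ij lt vb by (intro wp_Assign) simp_all
      qed
    qed simp_all
  qed simp_all
qed

section \<open>Correctness of the elimination\<close>

definition alive :: "nat \<Rightarrow> arrays \<Rightarrow> nat set" where
  "alive n h = {v. v < n \<and> h (19, v, 0, 0, 0) = 0}"

definition live_graph :: "nat \<Rightarrow> arrays \<Rightarrow> nat set set" where
  "live_graph n h = {{u, v} |u v. u \<in> alive n h \<and> v \<in> alive n h \<and> u \<noteq> v \<and> h (18, u, v, 0, 0) \<noteq> 0}"

text \<open>The vertex deleted last is assigned first, because it may be a recorded neighbor of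
  vertices deleted before it.\<close>

fun extend :: "arrays \<Rightarrow> nat \<Rightarrow> (nat \<Rightarrow> nat) \<Rightarrow> nat \<Rightarrow> nat" where
  "extend h 0 \<sigma> = \<sigma>"
| "extend h (Suc i) \<sigma> = extend h i (\<sigma>(h (20, i, 0, 0, 0) := h (17, h (20, i, 0, 0, 0),
     \<sigma> (h (21, h (20, i, 0, 0, 0), 0, 0, 0)), \<sigma> (h (22, h (20, i, 0, 0, 0), 0, 0, 0)), 0)))"

lemma extend_cong:
  assumes "\<And>j. j < i \<Longrightarrow> h' (20, j, 0, 0, 0) = h (20, j, 0, 0, 0)"
    and "\<And>j t p. j < i \<Longrightarrow> t \<in> {17, 21, 22} \<Longrightarrow> h' (t, h (20, j, 0, 0, 0), p) = h (t, h (20, j, 0, 0, 0), p)"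
  shows "extend h' i \<sigma> = extend h i \<sigma>"
  using assms
proof (induction i arbitrary: \<sigma>)
  case (Suc i)
  have IH: "extend h' i \<tau> = extend h i \<tau>" for \<tau>
    by (rule Suc.IH) (use Suc.prems in \<open>simp_all add: less_Suc_eq\<close>)
  show ?case
    unfolding extend.simps IH Suc.prems(1)[OF lessI] using Suc.prems(2)[OF lessI] by simp
qed simp

text \<open>The vertex \<open>n\<close> is a dummy which is never eliminated and collects the cost of components that
  have been eliminated completely.\<close>

definition elim_inv :: "nat \<Rightarrow> nat \<Rightarrow> nat set set \<Rightarrow> nat \<Rightarrow> arrays \<Rightarrow> bool" where
  "elim_inv k n E i h \<longleftrightarrow>
     card (alive n h) + i = n \<and>
     (\<forall>j<i. h (20, j, 0, 0, 0) < n \<and> h (20, j, 0, 0, 0) \<notin> alive n h) \<and>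
     (\<forall>v<n. v \<notin> alive n h \<longrightarrow> h (21, v, 0, 0, 0) \<le> n \<and> h (22, v, 0, 0, 0) \<le> n \<and>
        (\<forall>x<9 * n. \<forall>y<9 * n. h (17, v, x, y, 0) < 9 * n)) \<and>
     outerplanar (alive n h) (live_graph n h) \<and>
     (\<forall>u<n. \<forall>v<n. h (18, u, v, 0, 0) = 0 \<longrightarrow> h (18, v, u, 0, 0) = 0) \<and>
     (\<forall>u\<in>insert n (alive n h). \<forall>v\<in>insert n (alive n h). u \<noteq> v \<longrightarrow>
        u = n \<or> v = n \<or> h (18, u, v, 0, 0) = 0 \<longrightarrow> (\<forall>x<9 * n. \<forall>y<9 * n. h (16, u, x, v, y) = 0)) \<and>
     (\<forall>u\<in>insert n (alive n h). \<forall>x<9 * n. \<forall>y<9 * n. h (16, u, x, u, y) = h (16, u, x, u, x)) \<and>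
     (\<forall>\<sigma>. assignment n \<sigma> \<longrightarrow>
        total (insert n (alive n h)) (weights_of h) \<sigma> \<le> total {..n} (pair_weight k n E) \<sigma> \<and>
        total {..n} (pair_weight k n E) (extend h i \<sigma>) \<le> total (insert n (alive n h)) (weights_of h) \<sigma>) \<and>
     (\<forall>p. h (23, p) = 0)"

lemma elim_inv_frame:
  assumes "frame T h h'" "\<And>t. t \<in> T \<Longrightarrow> t < 16" "elim_inv k n E i h"
  shows "elim_inv k n E i h'"
proof -
  have eq: "h' (t, p) = h (t, p)" if "16 \<le> t" for t p
    using frameD[OF assms(1)] assms(2) that by (meson not_less)
  have eqs: "\<And>p. h' (16, p) = h (16, p)" "\<And>p. h' (17, p) = h (17, p)" "\<And>p. h' (18, p) = h (18, p)"
    "\<And>p. h' (19, p) = h (19, p)" "\<And>p. h' (20, p) = h (20, p)" "\<And>p. h' (21, p) = h (21, p)"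
    "\<And>p. h' (22, p) = h (22, p)" "\<And>p. h' (23, p) = h (23, p)"
    by (simp_all add: eq)
  have al: "alive n h' = alive n h" unfolding alive_def eqs ..
  have lg: "live_graph n h' = live_graph n h" unfolding live_graph_def al eqs ..
  have ex: "extend h' i \<sigma> = extend h i \<sigma>" for \<sigma>
    by (rule extend_cong) (auto simp: eqs)
  show ?thesis using assms(3) unfolding elim_inv_def al lg ex eqs .
qed

lemma finite_alive [simp]: "finite (alive n h)"
  unfolding alive_def by simp

lemma simple_live_graph: "simple_graph (alive n h) (live_graph n h)"
  unfolding simple_graph_def live_graph_def by auto

section \<open>One elimination step\<close>

context
  fixes k n :: nat and E :: "nat set set" and i :: nat and h :: arrays
  assumes inv: "elim_inv k n E i h"
begin

lemmas inv_conjuncts = inv[unfolded elim_inv_def]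
lemmas inv_card = inv_conjuncts[THEN conjunct1]
lemmas inv_order = inv_conjuncts[THEN conjunct2, THEN conjunct1]
lemmas inv_stored = inv_conjuncts[THEN conjunct2, THEN conjunct2, THEN conjunct1]
lemmas inv_outerplanar = inv_conjuncts[THEN conjunct2, THEN conjunct2, THEN conjunct2, THEN conjunct1]
lemmas inv_sym = inv_conjuncts[THEN conjunct2, THEN conjunct2, THEN conjunct2, THEN conjunct2, THEN conjunct1]
lemmas inv_zero = inv_conjuncts[THEN conjunct2, THEN conjunct2, THEN conjunct2, THEN conjunct2, THEN conjunct2, THEN conjunct1]
lemmas inv_diag = inv_conjuncts[THEN conjunct2, THEN conjunct2, THEN conjunct2, THEN conjunct2, THEN conjunct2, THEN conjunct2, THEN conjunct1]
lemmas inv_cost = inv_conjuncts[THEN conjunct2, THEN conjunct2, THEN conjunct2, THEN conjunct2, THEN conjunct2, THEN conjunct2, THEN conjunct2, THEN conjunct1]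
lemmas inv_solution = inv_conjuncts[THEN conjunct2, THEN conjunct2, THEN conjunct2, THEN conjunct2, THEN conjunct2, THEN conjunct2, THEN conjunct2, THEN conjunct2]

lemma adjacent_sym: "u < n \<Longrightarrow> v < n \<Longrightarrow> h (18, u, v, 0, 0) = 0 \<longleftrightarrow> h (18, v, u, 0, 0) = 0"
  using inv_sym by blast

lemma live_graph_nbrs:
  assumes v: "v \<in> alive n h"
  shows "{u. {u, v} \<in> live_graph n h} = live_nbrs n h v"
proof (intro set_eqI iffI)
  fix u assume "u \<in> {u. {u, v} \<in> live_graph n h}"
  then obtain u' v' where e: "{u, v} = {u', v'}" "u' \<in> alive n h" "v' \<in> alive n h" "u' \<noteq> v'" "h (18, u', v', 0, 0) \<noteq> 0"
    unfolding live_graph_def by auto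
  then have "u = u' \<and> v = v' \<or> u = v' \<and> v = u'" by (simp add: doubleton_eq_iff)
  then show "u \<in> live_nbrs n h v"
    using e(2-5) adjacent_sym[of u' v'] unfolding live_nbrs_def alive_def by auto
next
  fix u assume "u \<in> live_nbrs n h v"
  then show "u \<in> {u. {u, v} \<in> live_graph n h}"
    using v unfolding live_graph_def live_nbrs_def alive_def by blast
qed

lemma ex_low_degree:
  assumes "i < n"
  shows "\<exists>v. low_degree n h v"
proof -
  have "card (alive n h) \<noteq> 0" using inv_card assms by linarith
  then have "alive n h \<noteq> {}" by auto
  then obtain v where v: "v \<in> alive n h" "card {u. {u, v} \<in> live_graph n h} \<le> 2"
    using outerplanar_low_degree[OF simple_live_graph inv_outerplanar] by blast
  then have "low_degree n h v"
    using live_graph_nbrs[OF v(1)] unfolding low_degree_def by (simp add: alive_def)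
  then show ?thesis by blast
qed

text \<open>Repeated additions do not make the weights grow: an entry is a summand of the reduced
  total of a suitable assignment, and the invariant bounds that total by the original one, which is
  at most \<open>8 * (n + 1) ^ 3\<close>.\<close>

lemma weight_le:
  assumes "u \<in> insert n (alive n h)" "v \<in> insert n (alive n h)" "x < 9 * n" "y < 9 * n"
  shows "h (16, u, x, v, y) \<le> 8 * (n + 1) ^ 4"
proof -
  have *: "h (16, u, \<sigma> u, v, \<sigma> v) \<le> 8 * (n + 1) ^ 4" if "assignment n \<sigma>" for \<sigma>
  proof -
    have "h (16, u, \<sigma> u, v, \<sigma> v) \<le> total (insert n (alive n h)) (weights_of h) \<sigma>"
      using entry_le_total[of "insert n (alive n h)" u v "weights_of h" \<sigma>] assms by simp
    also have "\<dots> \<le> total {..n} (pair_weight k n E) \<sigma>"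
      using inv_cost that by blast
    also have "\<dots> \<le> (n + 1) * ((n + 1) * (8 * (n + 1)))" by (rule total_pair_weight_le)
    also have "\<dots> = 8 * (n + 1) ^ 3" by (simp only: power3_eq_cube ac_simps)
    also have "\<dots> \<le> 8 * (n + 1) ^ 4" by (intro mult_left_mono power_increasing) simp_all
    finally show ?thesis .
  qed
  show ?thesis
  proof (cases "u = v")
    case True
    \<comment> \<open>A diagonal entry with \<open>x \<noteq> y\<close> is a summand of no total;
      the invariant equates it with one that is.\<close>
    have "assignment n ((\<lambda>_. 0)(u := x))" using assms by (simp add: assignment_def num_values_def)
    then have "h (16, u, x, u, x) \<le> 8 * (n + 1) ^ 4" using * True by fastforce
    moreover have "h (16, u, x, u, y) = h (16, u, x, u, x)"
      using inv_diag assms True by blast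
    ultimately show ?thesis using True by simp
  next
    case False
    have "assignment n ((\<lambda>_. 0)(u := x, v := y))" using assms by (simp add: assignment_def num_values_def)
    then show ?thesis using *[of "(\<lambda>_. 0)(u := x, v := y)"] False by simp
  qed
qed

text \<open>The totals are compared by two inequalities. The reduced total stays below the original
  on every assignment, because the contribution of \<open>v\<close> is replaced by its minimum.
  Conversely, giving \<open>v\<close> the stored minimizer realizes exactly the cost that was added
  between \<open>a\<close> and \<open>b\<close>, so an extended assignment pays at most the reduced
  total.\<close>

lemma elim_inv_step:
  assumes el: "eliminable n h v a b" and i: "i < n"
    and h19: "\<And>u. h' (19, u, 0, 0, 0) = (if u = v then 1 else h (19, u, 0, 0, 0))"
    and h20: "\<And>j. h' (20, j, 0, 0, 0) = (if j = i then v else h (20, j, 0, 0, 0))"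
    and h21: "h' (21, v, 0, 0, 0) = a" and h22: "h' (22, v, 0, 0, 0) = b"
    and other: "\<And>t w p. t \<in> {17, 21, 22} \<Longrightarrow> w \<noteq> v \<Longrightarrow> h' (t, w, p) = h (t, w, p)"
    and h18: "\<And>u w. h' (18, u, w, 0, 0) =
      (if a \<noteq> b \<and> ((u, w) = (a, b) \<or> (u, w) = (b, a)) then 1 else h (18, u, w, 0, 0))"
    and h16: "\<And>u x w y. h' (16, u, x, w, y) = h (16, u, x, w, y) +
       (if u = a \<and> w = b \<and> x < 9 * n \<and> y < 9 * n
        then local_cost (weights_of h) v a b x y (h' (17, v, x, y, 0)) else 0)"
    and h17: "\<And>x y. x < 9 * n \<Longrightarrow> y < 9 * n \<Longrightarrow> h' (17, v, x, y, 0) < 9 * n"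
    and opt: "\<And>x y z. x < 9 * n \<Longrightarrow> y < 9 * n \<Longrightarrow> z < 9 * n \<Longrightarrow>
      local_cost (weights_of h) v a b x y (h' (17, v, x, y, 0)) \<le> local_cost (weights_of h) v a b x y z"
    and h23: "\<And>p. h' (23, p) = h (23, p)"
  shows "elim_inv k n E (Suc i) h'"
proof -
  let ?A = "alive n h" and ?G = "live_graph n h" and ?N = "live_nbrs n h v"
  let ?S = "insert n ?A" and ?L = "local_cost (weights_of h) v a b"
  let ?S' = "insert n (alive n h')"
  have vn: "v < n" and vA: "v \<in> ?A" using el unfolding eliminable_def alive_def by auto
  have "v \<noteq> n" using vn by simp
  have cases: "?N = {} \<and> a = n \<and> b = n \<or> ?N = {a, b}" using el unfolding eliminable_def by blast
  have NA: "?N \<subseteq> ?A - {v}" unfolding live_nbrs_def alive_def by blast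
  have ab: "a \<in> ?S - {v}" "b \<in> ?S - {v}" using cases NA \<open>v \<noteq> n\<close> by blast+
  have abn: "a \<le> n" "b \<le> n" using ab unfolding alive_def by auto
  have A': "alive n h' = ?A - {v}" unfolding alive_def using h19 by auto
  have S': "?S' = ?S - {v}" unfolding A' using vn by auto
  have D: "num_values n = 9 * n" using i unfolding num_values_def by simp
  have diag: "h (16, u, x, u, y) = h (16, u, x, u, x)" if "u \<in> ?S" "x < 9 * n" "y < 9 * n" for u x y
    using inv_diag that by blast
  have zero: "h (16, u, x, w, y) = 0"
    if "u \<in> ?S" "w \<in> ?S" "u \<noteq> w" "u = n \<or> w = n \<or> h (18, u, w, 0, 0) = 0" "x < 9 * n" "y < 9 * n" for u w x y
    by (rule inv_zero[rule_format, OF that])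
  have nonadj: "h (16, u, x, v, y) = 0 \<and> h (16, v, y, u, x) = 0"
    if u: "u \<in> ?S - {v, a, b}" and xy: "x < 9 * n" "y < 9 * n" for u x y
  proof -
    have "u = n \<or> h (18, u, v, 0, 0) = 0"
    proof (rule ccontr)
      assume "\<not> ?thesis"
      then have "u \<in> ?N" using u unfolding live_nbrs_def alive_def by auto
      then show False using cases u by blast
    qed
    moreover from this have "u = n \<or> h (18, v, u, 0, 0) = 0"
      using adjacent_sym[of u v] vn u unfolding alive_def by auto
    ultimately show ?thesis using u xy vA by (intro conjI zero) auto
  qed
  have remove: "total ?S (weights_of h) \<sigma> = total ?S' (weights_of h) \<sigma> + ?L (\<sigma> a) (\<sigma> b) (\<sigma> v)"
    if "assignment n \<sigma>" for \<sigma>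
    unfolding S'
  proof (rule total_remove)
    fix u assume u: "u \<in> ?S - {v, a, b}"
    then have "u \<le> n" unfolding alive_def by auto
    then show "h (16, u, \<sigma> u, v, \<sigma> v) = 0 \<and> h (16, v, \<sigma> v, u, \<sigma> u) = 0"
      using nonadj[OF u] that vn unfolding assignment_def D by simp
  qed (use vA ab in auto)
  have add: "total ?S' (weights_of h') \<sigma> = total ?S' (weights_of h) \<sigma> + ?L (\<sigma> a) (\<sigma> b) (h' (17, v, \<sigma> a, \<sigma> b, 0))"
    if "assignment n \<sigma>" for \<sigma>
  proof (rule total_add)
    have "\<sigma> a < 9 * n" "\<sigma> b < 9 * n" using that abn unfolding assignment_def D by auto
    then show "h' (16, u, \<sigma> u, w, \<sigma> w) = h (16, u, \<sigma> u, w, \<sigma> w) +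
      (if u = a \<and> w = b then ?L (\<sigma> a) (\<sigma> b) (h' (17, v, \<sigma> a, \<sigma> b, 0)) else 0)" for u w
      unfolding h16 by auto
  qed (use ab S' in auto)
  have ext: "extend h' i \<sigma> = extend h i \<sigma>" for \<sigma>
  proof (rule extend_cong)
    fix j assume j: "j < i"
    then have ne: "h (20, j, 0, 0, 0) \<noteq> v" using inv_order vA by blast
    show "h' (20, j, 0, 0, 0) = h (20, j, 0, 0, 0)" using h20 j by simp
    show "h' (t, h (20, j, 0, 0, 0), p) = h (t, h (20, j, 0, 0, 0), p)" if "t \<in> {17, 21, 22}" for t p
      using other[OF that ne] .
  qed
  \<comment> \<open>The value \<open>\<sigma> v\<close> is one of the candidates over which the
    added cost was minimized.\<close>
  have lower: "total ?S' (weights_of h') \<sigma> \<le> total {..n} (pair_weight k n E) \<sigma>" if "assignment n \<sigma>" for \<sigma>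
  proof -
    have "\<sigma> a < 9 * n" "\<sigma> b < 9 * n" "\<sigma> v < 9 * n" using that abn vn unfolding assignment_def D by auto
    then have "total ?S' (weights_of h') \<sigma> \<le> total ?S (weights_of h) \<sigma>"
      unfolding add[OF that] remove[OF that] using opt by simp
    also have "\<dots> \<le> total {..n} (pair_weight k n E) \<sigma>" using inv_cost that by blast
    finally show ?thesis .
  qed
  have upper: "total {..n} (pair_weight k n E) (extend h' (Suc i) \<sigma>) \<le> total ?S' (weights_of h') \<sigma>"
    if "assignment n \<sigma>" for \<sigma>
  proof -
    let ?z = "h' (17, v, \<sigma> a, \<sigma> b, 0)"
    let ?\<tau> = "\<sigma>(v := ?z)"
    have "\<sigma> a < 9 * n" "\<sigma> b < 9 * n" using that abn unfolding assignment_def D by auto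
    then have \<tau>: "assignment n ?\<tau>" using that h17 unfolding assignment_def D by simp
    have "extend h' (Suc i) \<sigma> = extend h i ?\<tau>" using ext by (simp add: h20 h21 h22)
    then have "total {..n} (pair_weight k n E) (extend h' (Suc i) \<sigma>) \<le> total ?S (weights_of h) ?\<tau>"
      using inv_cost \<tau> by simp
    also have "\<dots> = total ?S' (weights_of h) ?\<tau> + ?L (\<sigma> a) (\<sigma> b) ?z"
      using remove[OF \<tau>] ab by simp
    also have "total ?S' (weights_of h) ?\<tau> = total ?S' (weights_of h) \<sigma>"
      unfolding total_def S' by (intro sum.cong refl) auto
    finally show ?thesis unfolding add[OF that] .
  qed
  have "card (alive n h') + Suc i = n"
    using inv_card card_Suc_Diff1[OF finite_alive vA] unfolding A' by linarith
  moreover have "\<forall>j<Suc i. h' (20, j, 0, 0, 0) < n \<and> h' (20, j, 0, 0, 0) \<notin> alive n h'"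
    using inv_order vn unfolding A' h20 by (auto simp: less_Suc_eq)
  moreover have "\<forall>u<n. u \<notin> alive n h' \<longrightarrow> h' (21, u, 0, 0, 0) \<le> n \<and> h' (22, u, 0, 0, 0) \<le> n \<and>
        (\<forall>x<9 * n. \<forall>y<9 * n. h' (17, u, x, y, 0) < 9 * n)"
  proof (intro allI impI)
    fix u assume u: "u < n" "u \<notin> alive n h'"
    show "h' (21, u, 0, 0, 0) \<le> n \<and> h' (22, u, 0, 0, 0) \<le> n \<and>
        (\<forall>x<9 * n. \<forall>y<9 * n. h' (17, u, x, y, 0) < 9 * n)"
    proof (cases "u = v")
      case True
      then show ?thesis using abn h17 by (simp add: h21 h22)
    next
      case False
      then have "u \<notin> ?A" using u A' by simp
      then have "h (21, u, 0, 0, 0) \<le> n \<and> h (22, u, 0, 0, 0) \<le> n \<and>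
        (\<forall>x<9 * n. \<forall>y<9 * n. h (17, u, x, y, 0) < 9 * n)" using inv_stored u(1) by blast
      then show ?thesis using False by (simp add: other)
    qed
  qed
  moreover have "outerplanar (alive n h') (live_graph n h')"
    unfolding A'
  proof (rule outerplanar_eliminate[OF simple_live_graph])
    show "outerplanar ?A ?G" by (rule inv_outerplanar)
    show "live_graph n h' \<subseteq> {e \<in> ?G. v \<notin> e} \<union> {e. \<exists>a b. e = {a, b} \<and> a \<noteq> b \<and> {u. {u, v} \<in> ?G} = {a, b}}"
    proof
      fix e assume "e \<in> live_graph n h'"
      then obtain u w where e: "e = {u, w}" "u \<in> ?A - {v}" "w \<in> ?A - {v}" "u \<noteq> w" "h' (18, u, w, 0, 0) \<noteq> 0"
        unfolding live_graph_def A' by blast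
      show "e \<in> {e \<in> ?G. v \<notin> e} \<union> {e. \<exists>a b. e = {a, b} \<and> a \<noteq> b \<and> {u. {u, v} \<in> ?G} = {a, b}}"
      proof (cases "h (18, u, w, 0, 0) = 0")
        case True
        then have "a \<noteq> b" "e = {a, b}" using e h18[of u w] by (auto split: if_splits)
        moreover from this have "?N = {a, b}" using cases by blast
        ultimately show ?thesis using live_graph_nbrs[OF vA] by blast
      next
        case False
        then have "e \<in> ?G" using e unfolding live_graph_def by blast
        then show ?thesis using e by blast
      qed
    qed
  qed
  moreover have "\<forall>u<n. \<forall>w<n. h' (18, u, w, 0, 0) = 0 \<longrightarrow> h' (18, w, u, 0, 0) = 0"
    using adjacent_sym unfolding h18 by auto
  moreover have "\<forall>u\<in>?S'. \<forall>w\<in>?S'. u \<noteq> w \<longrightarrow> u = n \<or> w = n \<or> h' (18, u, w, 0, 0) = 0 \<longrightarrow>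
      (\<forall>x<9 * n. \<forall>y<9 * n. h' (16, u, x, w, y) = 0)"
  proof (intro ballI impI allI)
    fix u w x y
    assume uw: "u \<in> ?S'" "w \<in> ?S'" "u \<noteq> w" "u = n \<or> w = n \<or> h' (18, u, w, 0, 0) = 0" "x < 9 * n" "y < 9 * n"
    \<comment> \<open>Different \<open>a\<close> and \<open>b\<close> are genuine vertices that have
      just become adjacent, so their entry is not among those required to vanish.\<close>
    have "\<not> (u = a \<and> w = b)"
    proof
      assume uv: "u = a \<and> w = b"
      then have "?N = {a, b}" using cases uw(3) by blast
      then have "a < n" "b < n" unfolding live_nbrs_def by blast+
      then show False using uw(3,4) uv h18[of a b] by simp
    qed
    moreover have "h (16, u, x, w, y) = 0"
    proof -
      have "u = n \<or> w = n \<or> h (18, u, w, 0, 0) = 0" using uw(4) h18[of u w] by (auto split: if_splits)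
      then show ?thesis using uw unfolding S' by (intro zero) auto
    qed
    ultimately show "h' (16, u, x, w, y) = 0" unfolding h16 by auto
  qed
  moreover have "\<forall>u\<in>?S'. \<forall>x<9 * n. \<forall>y<9 * n. h' (16, u, x, u, y) = h' (16, u, x, u, x)"
  proof (intro ballI allI impI)
    fix u x y assume u: "u \<in> ?S'" "x < 9 * n" "y < 9 * n"
    \<comment> \<open>With a single neighbor the local cost ignores \<open>y\<close>. The minimizers
      stored for \<open>(x, y)\<close> and \<open>(x, x)\<close> may differ, but their costs agree
      by optimality.\<close>
    have "?L x y (h' (17, v, x, y, 0)) = ?L x x (h' (17, v, x, x, 0))" if "a = b"
    proof -
      have "?L x y z = ?L x x z" for z using that by (simp add: local_cost_def)
      then show ?thesis using opt h17 u by (metis order_antisym)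
    qed
    then show "h' (16, u, x, u, y) = h' (16, u, x, u, x)"
      using diag[of u x y] u unfolding S' h16 by auto
  qed
  moreover have "\<forall>\<sigma>. assignment n \<sigma> \<longrightarrow>
      total ?S' (weights_of h') \<sigma> \<le> total {..n} (pair_weight k n E) \<sigma> \<and>
      total {..n} (pair_weight k n E) (extend h' (Suc i) \<sigma>) \<le> total ?S' (weights_of h') \<sigma>"
    using lower upper by blast
  moreover have "\<forall>p. h' (23, p) = 0" using inv_solution h23 by simp
  ultimately show ?thesis unfolding elim_inv_def by (intro conjI)
qed

end

section \<open>The elimination loop\<close>

lemma eliminable_frame:
  "frame T h h' \<Longrightarrow> 18 \<notin> T \<Longrightarrow> 19 \<notin> T \<Longrightarrow> eliminable n h' v a b = eliminable n h v a b"
  unfolding eliminable_def by (simp add: live_nbrs_frame frameD)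

lemma eliminable_bounds:
  assumes "eliminable n h v a b"
  shows "v \<in> alive n h" "v < n" "a \<in> insert n (alive n h)" "b \<in> insert n (alive n h)" "a \<le> n" "b \<le> n"
    "v \<noteq> a" "v \<noteq> b"
proof -
  show v: "v \<in> alive n h" "v < n" using assms unfolding eliminable_def alive_def by auto
  have "live_nbrs n h v \<subseteq> alive n h - {v}" unfolding live_nbrs_def alive_def by blast
  then have "a = n \<or> a \<in> alive n h - {v}" "b = n \<or> b \<in> alive n h - {v}"
    using assms unfolding eliminable_def by blast+
  then show "a \<in> insert n (alive n h)" "b \<in> insert n (alive n h)" "a \<le> n" "b \<le> n" "v \<noteq> a" "v \<noteq> b"
    using v(2) unfolding alive_def by auto
qed

lemma wp_eliminate:
  assumes "elim_inv k n E 0 h0"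
  shows "wp n eliminate (elim_inv k n E n) h0"
  unfolding eliminate_def
proof (rule wp_For[where I = "elim_inv k n E"], goal_cases)
  case 3
  show ?case by (rule elim_inv_frame[of "{0}", OF _ _ assms]) (auto intro!: frame_update)
next
  case (5 h)
  then show ?case by simp
next
  case (4 i h)
  then have i: "i < n" and inv: "elim_inv k n E i h" and r: "val h 0 = i" by auto
  show ?case
  proof (rule wp_Then, rule wp_mono[OF wp_find_vertex[OF ex_low_degree[OF inv i]]], elim conjE)
    fix h1
    assume F1: "frame {2, 6, 7, 8, 10, 11, 12, 14} h h1"
      and "eliminable n h (val h1 10) (val h1 6) (val h1 7)"
    moreover define v a b where vab: "v = val h1 10" "a = val h1 6" "b = val h1 7"
    ultimately have el: "eliminable n h1 v a b" by (simp add: eliminable_frame[OF F1])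
    have inv1: "elim_inv k n E i h1" by (rule elim_inv_frame[OF F1 _ inv]) auto
    have r1: "val h1 0 = i" using frameD[OF F1] r by simp
    note bounds = eliminable_bounds[OF el]
    define h2 where "h2 = h1((19, v, 0, 0, 0) := 1, (20, i, 0, 0, 0) := v, (21, v, 0, 0, 0) := a, (22, v, 0, 0, 0) := b)"
    let ?Q = "\<lambda>h'. val h' 0 = i \<and> elim_inv k n E (Suc i) (h'((0, 0, 0, 0, 0) := Suc i))"
    \<comment> \<open>Both branches of the conditional lead to such an \<open>h3\<close>: for
      \<open>a = b\<close> it is \<open>h2\<close> itself, otherwise the edge has been entered in
      both directions.\<close>
    have rest: "wp n update ?Q h3"
      if F3: "frame {18} h2 h3"
        and adj: "\<And>u w. h3 (18, u, w, 0, 0) =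
          (if a \<noteq> b \<and> ((u, w) = (a, b) \<or> (u, w) = (b, a)) then 1 else h1 (18, u, w, 0, 0))" for h3
    proof -
      have same: "h3 (t, p) = h1 (t, p)" if "t \<notin> {18, 19, 20, 21, 22}" for t p
        using frameD[OF F3] that by (simp add: h2_def)
      have w3: "weights_of h3 = weights_of h1" using same by simp
      show ?thesis
      proof (rule wp_mono[OF wp_update[of h3 v a b n]])
        show "val h3 10 = v" "val h3 6 = a" "val h3 7 = b" using same vab by simp_all
        show "v < n" "a \<le> n" "b \<le> n" "v \<noteq> a" "v \<noteq> b" using bounds by simp_all
        show "h3 (16, u, x, w, y) \<le> 8 * (n + 1) ^ 4"
          if "u \<in> {v, a, b}" "w \<in> {v, a, b}" "x < 9 * n" "y < 9 * n" for u w x y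
          using weight_le[OF inv1, of u w x y] that bounds same by auto
      next
        fix h' assume up: "updated n h3 v a b (\<lambda>x y. x < 9 * n \<and> y < 9 * n) h'"
        then have F': "frame {3, 4, 5, 9, 13, 16, 17} h3 h'" unfolding updated_def by blast
        have stable: "h' (t, p) = h3 (t, p)" if "t \<notin> {3, 4, 5, 9, 13, 16, 17}" for t p
          using frameD[OF F'] that by blast
        have h2: "h3 (t, p) = h2 (t, p)" if "t \<noteq> 18" for t p using frameD[OF F3] that by simp
        note up' = up[unfolded updated_def w3]
        have "elim_inv k n E (Suc i) h'"
        proof (rule elim_inv_step[OF inv1 el i])
          show "h' (19, u, 0, 0, 0) = (if u = v then 1 else h1 (19, u, 0, 0, 0))" for u
            using stable h2 by (simp add: h2_def)
          show "h' (20, j, 0, 0, 0) = (if j = i then v else h1 (20, j, 0, 0, 0))" for j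
            using stable h2 by (simp add: h2_def)
          show "h' (21, v, 0, 0, 0) = a" "h' (22, v, 0, 0, 0) = b"
            using stable h2 by (simp_all add: h2_def)
          show "h' (t, w, p) = h1 (t, w, p)" if "t \<in> {17, 21, 22}" "w \<noteq> v" for t w p
          proof -
            have "h' (t, w, p) = h3 (t, w, p)"
            proof (cases "t = 17")
              case True
              then show ?thesis
                using up[unfolded updated_def, THEN conjunct2, THEN conjunct2, THEN conjunct2] that(2) by blast
            next
              case False
              then show ?thesis by (intro stable) (use that(1) in auto)
            qed
            also have "\<dots> = h2 (t, w, p)" using that(1) by (intro h2) auto
            also have "\<dots> = h1 (t, w, p)" using that by (auto simp: h2_def)
            finally show ?thesis .
          qed
          show "h' (18, u, w, 0, 0) = (if a \<noteq> b \<and> ((u, w) = (a, b) \<or> (u, w) = (b, a)) then 1 else h1 (18, u, w, 0, 0))" for u w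
            using stable adj by simp
          show "h' (16, u, x, w, y) = h1 (16, u, x, w, y) + (if u = a \<and> w = b \<and> x < 9 * n \<and> y < 9 * n
            then local_cost (weights_of h1) v a b x y (h' (17, v, x, y, 0)) else 0)" for u x w y
            using up' same by simp
          show "h' (17, v, x, y, 0) < 9 * n" if "x < 9 * n" "y < 9 * n" for x y
            using up' that by simp
          show "local_cost (weights_of h1) v a b x y (h' (17, v, x, y, 0)) \<le> local_cost (weights_of h1) v a b x y z"
            if "x < 9 * n" "y < 9 * n" "z < 9 * n" for x y z
            using up' that by simp
          show "h' (23, p) = h1 (23, p)" for p using stable same by simp
        qed
        then have "elim_inv k n E (Suc i) (h'((0, 0, 0, 0, 0) := Suc i))"
          by (rule elim_inv_frame[of "{0}", rotated 2]) (auto intro!: frame_update)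
        then show "?Q h'" using stable same r1 by simp
      qed
    qed
    have ab_le: "a < index_bound n" "b < index_bound n" "v < index_bound n" "i < index_bound n"
      "a < value_bound n" "b < value_bound n" "v < value_bound n"
      using bounds i by (auto intro!: value_bound_small)
    have small: "1 < value_bound n" by (intro value_bound_small) simp
    have r2: "val h2 10 = v" "val h2 6 = a" "val h2 7 = b" using vab by (simp_all add: h2_def)
    show "wp n (Assign 19 (reg 10) (Num 0) (Num 0) (Num 0) (Num 1) ;;
        Assign 20 (reg 0) (Num 0) (Num 0) (Num 0) (reg 10) ;;
        Assign 21 (reg 10) (Num 0) (Num 0) (Num 0) (reg 6) ;;
        Assign 22 (reg 10) (Num 0) (Num 0) (Num 0) (reg 7) ;;
        (If (Eq (reg 6) (reg 7)) Nop
          (Assign 18 (reg 6) (reg 7) (Num 0) (Num 0) (Num 1) ;;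
           Assign 18 (reg 7) (reg 6) (Num 0) (Num 0) (Num 1))) ;;
        update) ?Q h1"
    proof (rule wp_Then, rule wp_Assign, goal_cases)
      case 4
      show ?case
      proof (rule wp_Then, rule wp_Assign, goal_cases)
        case 4
        show ?case
        proof (rule wp_Then, rule wp_Assign, goal_cases)
          case 4
          show ?case
          proof (rule wp_Then, rule wp_Assign, goal_cases)
            case 4
            have "wp n ((If (Eq (reg 6) (reg 7)) Nop
              (Assign 18 (reg 6) (reg 7) (Num 0) (Num 0) (Num 1) ;;
               Assign 18 (reg 7) (reg 6) (Num 0) (Num 0) (Num 1))) ;; update) ?Q h2"
            proof (rule wp_Then, rule wp_If, goal_cases)
              case 1 then show ?case by simp
            next
              case 2
              then have "a = b" using r2 by simp
              then show ?case by (intro wp_Nop rest) (simp_all add: h2_def)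
            next
              case 3
              then have ne: "a \<noteq> b" using r2 by simp
              define h3 where "h3 = h2((18, a, b, 0, 0) := 1, (18, b, a, 0, 0) := 1)"
              have "wp n update ?Q h3"
              proof (rule rest)
                show "frame {18} h2 h3" unfolding h3_def by (intro frame_update) simp_all
                show "h3 (18, u, w, 0, 0) = (if a \<noteq> b \<and> ((u, w) = (a, b) \<or> (u, w) = (b, a)) then 1
                  else h1 (18, u, w, 0, 0))" for u w
                  using ne by (auto simp: h3_def h2_def)
              qed
              then show ?case
                using ab_le small r2 by (intro wp_Then wp_Assign) (simp_all add: h3_def)
            qed
            then show ?case using vab r1 by (simp add: h2_def)
          qed (use ab_le small vab r1 in simp_all)
        qed (use ab_le small vab r1 in simp_all)
      qed (use ab_le small vab r1 in simp_all)
    qed (use ab_le small vab r1 in simp_all)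
  qed
qed simp_all

section \<open>From the input to an optimal assignment\<close>

lemma assignment_zero: "assignment n (\<lambda>_. 0)"
  by (simp add: assignment_def num_values_def less_max_iff_disj)

lemma elim_inv_initialized:
  assumes sg: "simple_graph {..<n} E" and op: "outerplanar {..<n} E" and k: "k \<le> 2"
    and h: "initialized k n E h0 (\<lambda>u x v y. u < n \<and> v < n \<and> x < 9 * n \<and> y < 9 * n) (\<lambda>u v. u < n \<and> v < n) h"
    and zero: "\<And>t p. t < 32 \<Longrightarrow> h0 (t, p) = 0"
  shows "elim_inv k n E 0 h"
proof -
  have F: "frame {2, 3, 4, 14, 16, 18} h0 h" using h unfolding initialized_def by blast
  have w: "h (16, u, x, v, y) = (if u < n \<and> v < n \<and> x < 9 * n \<and> y < 9 * n then pair_weight k n E u x v y else 0)" for u x v y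
    using h unfolding initialized_def by blast
  have adj: "h (18, u, v, 0, 0) = (if u < n \<and> v < n then of_bool ({u, v} \<in> E) else 0)" for u v
    using h unfolding initialized_def by blast
  have al: "alive n h = {..<n}" unfolding alive_def using frameD[OF F, of 19] zero by auto
  have S: "insert n {..<n} = {..n}" by auto
  have G: "live_graph n h = E"
  proof
    show "live_graph n h \<subseteq> E" unfolding live_graph_def al using adj by (auto split: if_splits)
    show "E \<subseteq> live_graph n h"
    proof
      fix e assume e: "e \<in> E"
      then have sub: "e \<subseteq> {..<n}" and "card e = 2" using sg unfolding simple_graph_def by auto
      then obtain u v where "e = {u, v}" "u \<noteq> v" by (auto simp: card_2_iff)
      then show "e \<in> live_graph n h"
        unfolding live_graph_def al using e sub adj[of u v] by (intro CollectI exI[of _ u] exI[of _ v]) simp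
    qed
  qed
  have pw: "h (16, u, x, v, y) = pair_weight k n E u x v y" if "x < 9 * n" "y < 9 * n" for u x v y
    using w that by (auto simp: pair_weight_def)
  have pw': "h (16, u, \<sigma> u, v, \<sigma> v) = pair_weight k n E u (\<sigma> u) v (\<sigma> v)"
    if "assignment n \<sigma>" "u \<le> n" "v \<le> n" for \<sigma> u v
  \<comment> \<open>For \<open>n = 0\<close> no weight is written, but the dummy still has the value
    0; both sides are zero then.\<close>
  proof (cases "n = 0")
    case True
    then show ?thesis using w that by (simp add: pair_weight_def)
  next
    case False
    then show ?thesis using pw that by (simp add: assignment_def num_values_def)
  qed
  have tot: "total {..n} (weights_of h) \<sigma> = total {..n} (pair_weight k n E) \<sigma>" if "assignment n \<sigma>" for \<sigma>
    unfolding total_def using pw'[OF that] by (intro sum.cong refl) simp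
  show ?thesis
    unfolding elim_inv_def al G S
  proof (intro conjI)
    show "\<forall>u<n. \<forall>v<n. h (18, u, v, 0, 0) = 0 \<longrightarrow> h (18, v, u, 0, 0) = 0"
      using adj by (simp add: insert_commute)
    show "\<forall>u\<in>{..n}. \<forall>v\<in>{..n}. u \<noteq> v \<longrightarrow> u = n \<or> v = n \<or> h (18, u, v, 0, 0) = 0 \<longrightarrow>
      (\<forall>x<9 * n. \<forall>y<9 * n. h (16, u, x, v, y) = 0)"
      using adj pw by (auto simp: pair_weight_def)
    show "\<forall>u\<in>{..n}. \<forall>x<9 * n. \<forall>y<9 * n. h (16, u, x, u, y) = h (16, u, x, u, x)"
      using pw by (simp add: pair_weight_def)
    show "\<forall>\<sigma>. assignment n \<sigma> \<longrightarrow> total {..n} (weights_of h) \<sigma> \<le> total {..n} (pair_weight k n E) \<sigma> \<and>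
        total {..n} (pair_weight k n E) (extend h 0 \<sigma>) \<le> total {..n} (weights_of h) \<sigma>"
      using tot by simp
    show "\<forall>p. h (23, p) = 0" using frameD[OF F, of 23] zero by simp
  qed (use op in auto)
qed

text \<open>The invariant is that extending the current values by the remaining \<open>n - i\<close>
  steps yields the same final assignment throughout. Array 23 starts as zero, which is the seed of
  \<open>extend\<close>.\<close>

lemma wp_backtrack:
  assumes inv: "elim_inv k n E n h0"
  shows "wp n backtrack (\<lambda>h. frame {0, 2, 23} h0 h \<and>
    assignment n (extend h0 n (\<lambda>_. 0)) \<and>
    (\<forall>v. h (23, v, 0, 0, 0) = extend h0 n (\<lambda>_. 0) v)) h0"
proof -
  note I = inv[unfolded elim_inv_def]
  let ?\<sigma> = "\<lambda>(h :: arrays) v. h (23, v, 0, 0, 0)"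
  let ?I = "\<lambda>i h. frame {0, 2, 23} h0 h \<and> assignment n (?\<sigma> h) \<and>
      extend h0 (n - i) (?\<sigma> h) = extend h0 n (\<lambda>_. 0)"
  have upd: "?I i (h((r, p) := x))" if "?I i h" "r \<in> {0, 2}" for i h r p x
    using that by (auto intro!: frame_update)
  show ?thesis
    unfolding backtrack_def
  proof (rule wp_For[where I = ?I], goal_cases)
    case 3
    have "?\<sigma> h0 = (\<lambda>_. 0)" using I by simp
    then have "?I 0 h0" using assignment_zero by simp
    then show ?case by (rule upd) simp
  next
    case (5 h)
    then have "extend h0 n (\<lambda>_. 0) = ?\<sigma> h" by simp
    then show ?case using 5 by simp
  next
    case (4 i h)
    then have i: "i < n" and Ih: "?I i h" and r: "val h 0 = i" by auto
    define j v a b where "j = n - 1 - i" and v: "v = h0 (20, j, 0, 0, 0)"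
      and a: "a = h0 (21, v, 0, 0, 0)" and b: "b = h0 (22, v, 0, 0, 0)"
    have j: "j < n" "n - i = Suc j" "n - Suc i = j" using i unfolding j_def by auto
    have al: "alive n h0 = {}" using I by simp
    have vn: "v < n" using I j v by simp
    then have ab: "a \<le> n" "b \<le> n" "\<And>x y. x < 9 * n \<Longrightarrow> y < 9 * n \<Longrightarrow> h0 (17, v, x, y, 0) < 9 * n"
      using I al unfolding a b by simp_all
    have same: "h (t, p) = h0 (t, p)" if "t \<notin> {0, 2, 23}" for t p using Ih frameD that by blast
    have nv: "num_values n = 9 * n" using i by (simp add: num_values_def)
    have \<sigma>: "?\<sigma> h a < 9 * n" "?\<sigma> h b < 9 * n" using Ih ab unfolding assignment_def nv by simp_all
    define z where "z = h0 (17, v, ?\<sigma> h a, ?\<sigma> h b, 0)"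
    have z: "z < 9 * n" unfolding z_def using ab \<sigma> by simp
    let ?h = "h((2, 0, 0, 0, 0) := v, (23, v, 0, 0, 0) := z)"
    have "?\<sigma> ?h = (?\<sigma> h)(v := z)" by auto
    moreover have "assignment n ((?\<sigma> h)(v := z))" using Ih z unfolding assignment_def nv by simp
    moreover have "extend h0 (n - i) (?\<sigma> h) = extend h0 (n - Suc i) ((?\<sigma> h)(v := z))"
      unfolding j(2,3) z_def extend.simps a b v ..
    ultimately have "?I (Suc i) ?h" using Ih by (auto intro!: frame_update)
    then have post: "?I (Suc i) (?h((0, 0, 0, 0, 0) := Suc i))" by (rule upd) simp
    show ?case
    proof (rule wp_Then, rule wp_Assign, goal_cases)
      case 4
      have "h (20, n - Suc i, 0, 0, 0) = v" using same v j by simp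
      then show ?case
        using post same vn ab \<sigma> z r i
        by (intro wp_Assign) (simp_all add: a[symmetric] b[symmetric] z_def[symmetric])
    qed (use r i vn same v j in simp_all)
  qed simp_all
qed

lemma wp_write_colors:
  "wp n write_colors (\<lambda>h. frame {0, 32} h0 h \<and>
    (\<forall>v. 0 < v \<and> v < n \<longrightarrow> h (32, v, 0, 0, 0) = color (h0 (23, v, 0, 0, 0)))) h0"
  unfolding write_colors_def
proof (rule wp_For[where I = "\<lambda>i h. frame {0, 32} h0 h \<and>
    (\<forall>v. 0 < v \<and> v < i \<longrightarrow> h (32, v, 0, 0, 0) = color (h0 (23, v, 0, 0, 0)))"], goal_cases)
  case 3
  show ?case by (auto intro!: frame_update)
next
  case (5 h)
  then show ?case by simp
next
  case (4 i h)
  then have i: "i < n" "val h 0 = i" and F: "frame {0, 32} h0 h"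
    and col: "\<And>v. 0 < v \<Longrightarrow> v < i \<Longrightarrow> h (32, v, 0, 0, 0) = color (h0 (23, v, 0, 0, 0))" by auto
  have same: "h (23, i, 0, 0, 0) = h0 (23, i, 0, 0, 0)" using frameD[OF F] by simp
  show ?case
  proof (rule wp_If, goal_cases)
    case 1 then show ?case by simp
  next
    case 3
    then show ?case using i F col by (intro wp_Nop) (auto intro!: frame_update)
  next
    case 2
    have sq: "i \<le> n * n" using i(1) by (metis le_square le_trans less_imp_le)
    have "color (h0 (23, i, 0, 0, 0)) < value_bound n"
      using color_lt[of "h0 (23, i, 0, 0, 0)"] by (intro value_bound_small) simp
    then show ?case
      using i F col same 2 sq by (intro wp_Output) (auto simp: less_Suc_eq intro!: frame_update)
  qed
qed simp_all

definition "solve k = initialize k ;; eliminate ;; backtrack ;; write_colors"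

lemma wp_solve:
  assumes sg: "simple_graph {..<n} E" and op: "outerplanar {..<n} E" and k: "k \<le> 2"
    and zero: "\<And>t p. t < 32 \<Longrightarrow> h0 (t, p) = 0"
    and inp: "\<And>u v. u < n \<Longrightarrow> v < n \<Longrightarrow> h0 (32, 1 + (u * n + v), 0, 0, 0) = of_bool ({u, v} \<in> E)"
  shows "wp n (solve k) (\<lambda>h. \<exists>\<sigma>. assignment n \<sigma> \<and>
    total {..n} (pair_weight k n E) \<sigma> \<le> h (16, n, 0, n, 0) \<and>
    (\<forall>\<tau>. assignment n \<tau> \<longrightarrow> \<tau> n = 0 \<longrightarrow> h (16, n, 0, n, 0) \<le> total {..n} (pair_weight k n E) \<tau>) \<and>
    (\<forall>v. h (23, v, 0, 0, 0) = \<sigma> v) \<and>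
    (\<forall>v. 0 < v \<and> v < n \<longrightarrow> h (32, v, 0, 0, 0) = color (\<sigma> v))) h0"
  unfolding solve_def
proof (rule wp_Then, rule wp_mono[OF wp_initialize[OF zero inp]])
  fix h1 assume h1: "initialized k n E h0 (\<lambda>u x v y. u < n \<and> v < n \<and> x < 9 * n \<and> y < 9 * n) (\<lambda>u v. u < n \<and> v < n) h1"
  show "wp n (eliminate ;; backtrack ;; write_colors) (\<lambda>h. \<exists>\<sigma>. assignment n \<sigma> \<and>
    total {..n} (pair_weight k n E) \<sigma> \<le> h (16, n, 0, n, 0) \<and>
    (\<forall>\<tau>. assignment n \<tau> \<longrightarrow> \<tau> n = 0 \<longrightarrow> h (16, n, 0, n, 0) \<le> total {..n} (pair_weight k n E) \<tau>) \<and>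
    (\<forall>v. h (23, v, 0, 0, 0) = \<sigma> v) \<and>
    (\<forall>v. 0 < v \<and> v < n \<longrightarrow> h (32, v, 0, 0, 0) = color (\<sigma> v))) h1"
  proof (rule wp_Then, rule wp_mono[OF wp_eliminate[OF elim_inv_initialized[OF sg op k h1 zero]]])
    fix h2 assume inv: "elim_inv k n E n h2"
    note I = inv[unfolded elim_inv_def]
    have al: "alive n h2 = {}" using I by simp
    \<comment> \<open>Only the dummy is left, so the reduced total is a single entry, and the value
      0 gives the optimum.\<close>
    have tot: "total {n} (weights_of h2) \<tau> = h2 (16, n, \<tau> n, n, \<tau> n)" for \<tau>
      by (simp add: total_def)
    have cost: "total {n} (weights_of h2) \<tau> \<le> total {..n} (pair_weight k n E) \<tau> \<and>
        total {..n} (pair_weight k n E) (extend h2 n \<tau>) \<le> total {n} (weights_of h2) \<tau>"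
      if "assignment n \<tau>" for \<tau>
      using I that unfolding al by blast
    show "wp n (backtrack ;; write_colors) (\<lambda>h. \<exists>\<sigma>. assignment n \<sigma> \<and>
      total {..n} (pair_weight k n E) \<sigma> \<le> h (16, n, 0, n, 0) \<and>
      (\<forall>\<tau>. assignment n \<tau> \<longrightarrow> \<tau> n = 0 \<longrightarrow> h (16, n, 0, n, 0) \<le> total {..n} (pair_weight k n E) \<tau>) \<and>
      (\<forall>v. h (23, v, 0, 0, 0) = \<sigma> v) \<and>
      (\<forall>v. 0 < v \<and> v < n \<longrightarrow> h (32, v, 0, 0, 0) = color (\<sigma> v))) h2"
    proof (rule wp_Then, rule wp_mono[OF wp_backtrack[OF inv]], elim conjE, rule wp_mono[OF wp_write_colors], elim conjE)
      fix h3 h4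
      assume F3: "frame {0, 2, 23} h2 h3" and as: "assignment n (extend h2 n (\<lambda>_. 0))"
        and sol: "\<forall>v. h3 (23, v, 0, 0, 0) = extend h2 n (\<lambda>_. 0) v"
        and F4: "frame {0, 32} h3 h4"
        and out: "\<forall>v. 0 < v \<and> v < n \<longrightarrow> h4 (32, v, 0, 0, 0) = color (h3 (23, v, 0, 0, 0))"
      have w: "h4 (16, n, 0, n, 0) = h2 (16, n, 0, n, 0)" using frameD[OF F3] frameD[OF F4] by simp
      have v: "h4 (23, v, 0, 0, 0) = extend h2 n (\<lambda>_. 0) v" for v using frameD[OF F4] sol by simp
      have "total {..n} (pair_weight k n E) (extend h2 n (\<lambda>_. 0)) \<le> h4 (16, n, 0, n, 0)"
        using cost[OF assignment_zero] unfolding tot w by simp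
      moreover have "h4 (16, n, 0, n, 0) \<le> total {..n} (pair_weight k n E) \<tau>" if "assignment n \<tau>" "\<tau> n = 0" for \<tau>
        using cost[OF that(1)] that(2) unfolding tot w by simp
      ultimately show "\<exists>\<sigma>. assignment n \<sigma> \<and>
        total {..n} (pair_weight k n E) \<sigma> \<le> h4 (16, n, 0, n, 0) \<and>
        (\<forall>\<tau>. assignment n \<tau> \<longrightarrow> \<tau> n = 0 \<longrightarrow> h4 (16, n, 0, n, 0) \<le> total {..n} (pair_weight k n E) \<tau>) \<and>
        (\<forall>v. h4 (23, v, 0, 0, 0) = \<sigma> v) \<and>
        (\<forall>v. 0 < v \<and> v < n \<longrightarrow> h4 (32, v, 0, 0, 0) = color (\<sigma> v))"
        using as v out sol by (intro exI[of _ "extend h2 n (\<lambda>_. 0)"]) simp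
    qed
  qed
qed

section \<open>The compiled solver and its running time\<close>

definition initial_arrays :: "nat \<Rightarrow> nat set set \<Rightarrow> arrays" where
  "initial_arrays n E = (\<lambda>(t, a, _). if t = 32 then graph_input n E a else 0)"

lemma represents_input: "represents n (graph_input n E) (initial_arrays n E)"
proof -
  have "graph_input n E i < value_bound n" for i
    unfolding graph_input_def using value_bound_ge(1,2)[of n] by auto
  moreover have "graph_input n E (address n t a b c d) = 0" for t a b c d
    by (simp add: graph_input_def address_def)
  ultimately show ?thesis
    unfolding represents_def initial_arrays_def by (auto simp: graph_input_def)
qed

lemma initial_arrays_edge:
  assumes "u < n" "v < n"
  shows "initial_arrays n E (32, 1 + (u * n + v), 0, 0, 0) = of_bool ({u, v} \<in> E)"
proof -
  have "u * n + v < n * n" using assms mult_le_mono1[of "Suc u" n n] by simp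
  then show ?thesis using assms by (simp add: initial_arrays_def graph_input_def)
qed

text \<open>Decision and construction share the whole computation and differ only in the expression
  \<open>e\<close> put into cell 0 at the end.\<close>

definition solver :: "nat \<Rightarrow> hexp \<Rightarrow> prog" where
  "solver k e = Seq (compile (solve k)) (Store (Lit 0) (compile_exp e))"

definition solver_time :: "nat \<Rightarrow> hexp \<Rightarrow> nat \<Rightarrow> nat" where
  "solver_time k e n = cost n (solve k) + (acost (compile_exp e) + 2)"

lemma solver_time_bigo:
  assumes "4 \<le> m"
  shows "(\<lambda>n. real (solver_time k e n)) \<in> O(\<lambda>n. real n ^ m)"
proof -
  obtain C where C: "\<forall>n. cost n (solve k) \<le> C * (n + 1) ^ depth (solve k)"
    using cost_polynomial by blast
  \<comment> \<open>The deepest nests have four loops: in the elimination one over the steps, two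
    over neighbor values and one over values of the deleted vertex; in the initialization two over
    vertices and two over values.\<close>
  have depth: "depth (solve k) = 4"
    by (simp add: solve_def initialize_def eliminate_def find_vertex_def scan_def update_def minimize_def
        backtrack_def write_colors_def)
  define K where "K = C + (acost (compile_exp e) + 2)"
  have "solver_time k e n \<le> K * 2 ^ 4 * n ^ m" if "1 \<le> n" for n
  proof -
    have "solver_time k e n \<le> C * (n + 1) ^ 4 + (acost (compile_exp e) + 2) * 1"
      using C[THEN spec[of _ n]] unfolding depth solver_time_def mult_1_right by (rule add_right_mono)
    also have "\<dots> \<le> C * (n + 1) ^ 4 + (acost (compile_exp e) + 2) * (n + 1) ^ 4"
      by (intro add_left_mono mult_left_mono) simp_all
    also have "\<dots> = K * (n + 1) ^ 4" unfolding K_def by (simp only: add_mult_distrib)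
    also have "\<dots> \<le> K * (2 * n) ^ 4" using that by (intro mult_left_mono power_mono) simp_all
    also have "\<dots> = K * 2 ^ 4 * n ^ 4" by (simp only: power_mult_distrib mult.assoc)
    also have "\<dots> \<le> K * 2 ^ 4 * n ^ m" using that assms by (intro mult_left_mono power_increasing) simp_all
    finally show ?thesis .
  qed
  then have "norm (real (solver_time k e n)) \<le> real (K * 2 ^ 4) * norm (real n ^ m)" if "1 \<le> n" for n
    using that by (metis norm_of_nat norm_power of_nat_le_iff of_nat_mult of_nat_power)
  then show ?thesis
    by (intro bigoI[of _ "real (K * 2 ^ 4)"] eventually_sequentiallyI[of 1])
qed

text \<open>The cell \<open>0\<close> is overwritten last, since all addresses are computed from the number of vertices
  stored there.\<close>

lemma solver_correct:
  assumes k: "k \<le> 2" and safe: "\<And>n h. hsafe n e h"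
    and Q: "\<And>n E s h \<sigma>. simple_graph {..<n} E \<Longrightarrow> represents n s h \<Longrightarrow>
      total {..n} (pair_weight k n E) \<sigma> \<le> h (16, n, 0, n, 0) \<Longrightarrow>
      (\<And>\<tau>. assignment n \<tau> \<Longrightarrow> \<tau> n = 0 \<Longrightarrow> h (16, n, 0, n, 0) \<le> total {..n} (pair_weight k n E) \<tau>) \<Longrightarrow>
      (\<And>v. h (23, v, 0, 0, 0) = \<sigma> v) \<Longrightarrow>
      (\<And>v. 0 < v \<Longrightarrow> v < n \<Longrightarrow> h (32, v, 0, 0, 0) = color (\<sigma> v)) \<Longrightarrow> Q n E (s(0 := hval n e h))"
  shows "solves_within (solver_time k e) (solver k e) outerplanar Q"
  unfolding solves_within_def
proof (rule exI, intro allI impI, elim conjE)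
  let ?K = "word_exponent (solve k) + asize (compile_exp e) + 1"
  fix n and E :: "nat set set"
  assume sg: "simple_graph {..<n} E" and op: "outerplanar {..<n} E"
  \<comment> \<open>The factor 20 is the exponent in \<open>value_bound\<close>, and
    \<open>?K\<close> depends only on the program, so one constant serves all graphs.\<close>
  let ?B = "(n + 2) ^ (20 * ?K)"
  have B: "value_bound n ^ ?K \<le> ?B" unfolding value_bound_def power_mult ..
  have Bs: "value_bound n ^ word_exponent (solve k) \<le> ?B"
    by (rule power_exponent_mono[OF B]) simp
  define R where "R h \<longleftrightarrow> (\<exists>\<sigma>. assignment n \<sigma> \<and>
    total {..n} (pair_weight k n E) \<sigma> \<le> h (16, n, 0, n, 0) \<and>
    (\<forall>\<tau>. assignment n \<tau> \<longrightarrow> \<tau> n = 0 \<longrightarrow> h (16, n, 0, n, 0) \<le> total {..n} (pair_weight k n E) \<tau>) \<and>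
    (\<forall>v. h (23, v, 0, 0, 0) = \<sigma> v) \<and>
    (\<forall>v. 0 < v \<and> v < n \<longrightarrow> h (32, v, 0, 0, 0) = color (\<sigma> v)))" for h :: arrays
  have "wp n (solve k) R (initial_arrays n E)"
    unfolding R_def using initial_arrays_edge by (intro wp_solve[OF sg op k]) (simp_all add: initial_arrays_def)
  from this Bs represents_input obtain t s h where ex: "exec ?B (compile (solve k)) (graph_input n E) t s"
    and t: "t \<le> cost n (solve k)" and rep: "represents n s h" and "R h"
    by (rule wpD)
  then obtain \<sigma> where \<sigma>: "total {..n} (pair_weight k n E) \<sigma> \<le> h (16, n, 0, n, 0)"
      "\<And>\<tau>. assignment n \<tau> \<Longrightarrow> \<tau> n = 0 \<Longrightarrow> h (16, n, 0, n, 0) \<le> total {..n} (pair_weight k n E) \<tau>"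
      "\<And>v. h (23, v, 0, 0, 0) = \<sigma> v" "\<And>v. 0 < v \<Longrightarrow> v < n \<Longrightarrow> h (32, v, 0, 0, 0) = color (\<sigma> v)"
    unfolding R_def by blast
  have "exec ?B (Store (Lit 0) (compile_exp e)) s (acost (Lit 0) + acost (compile_exp e) + 1)
      (s(aval (Lit 0) s := aval (compile_exp e) s))"
    by (intro exec.Store represents_fits[OF rep B]) simp_all
  then have "exec ?B (Store (Lit 0) (compile_exp e)) s (acost (compile_exp e) + 2) (s(0 := hval n e h))"
    using aval_compile_exp[OF rep safe] by simp
  from exec.Seq[OF ex this] t Q[OF sg rep \<sigma>]
  show "\<exists>t s. exec ?B (solver k e) (graph_input n E) t s \<and> t \<le> solver_time k e n \<and> Q n E s"
    unfolding solver_def solver_time_def by (metis add_le_mono1)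
qed

section \<open>Reading the answer off the optimum\<close>

context
  fixes k n :: nat and E :: "nat set set" and \<sigma> :: "nat \<Rightarrow> nat" and m :: nat
  assumes sg: "simple_graph {..<n} E" and k: "k \<le> 2"
    and le: "total {..n} (pair_weight k n E) \<sigma> \<le> m"
    and ge: "\<And>\<tau>. assignment n \<tau> \<Longrightarrow> \<tau> n = 0 \<Longrightarrow> m \<le> total {..n} (pair_weight k n E) \<tau>"
begin

lemma optimum_le_card: "cf_coloring k {..<n} E col \<Longrightarrow> m \<le> card (dom col)"
  using total_of_coloring[OF sg k] ge by metis

lemma optimum_le_n: "cf_coloring k {..<n} E col \<Longrightarrow> m \<le> n"
  using optimum_le_card[of col] card_mono[of "{..<n}" "dom col"] unfolding cf_coloring_def by simp

text \<open>A coloring has at most \<open>n\<close> colored vertices and so keeps the optimum at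
  most \<open>n\<close>; conversely such an optimum leaves no room for a penalty.\<close>

lemma chromatic_iff_optimum: "cf_chromatic {..<n} E \<le> k \<longleftrightarrow> m \<le> n"
  using cf_chromatic_le_iff[OF sg] coloring_of_total(1)[OF sg k, of \<sigma>] le optimum_le_n by (meson order_trans)

lemma min_coloring_of_optimum:
  assumes "\<exists>col. cf_coloring k {..<n} E col"
  shows "min_cf_coloring k {..<n} E (coloring_of n \<sigma>)"
proof -
  have "total {..n} (pair_weight k n E) \<sigma> \<le> n" using assms optimum_le_n le by (meson order_trans)
  from coloring_of_total[OF sg k this] show ?thesis
    unfolding min_cf_coloring_def using le optimum_le_card by (meson order_trans)
qed

end

theorem theorem6:
  fixes k :: nat
  assumes "k \<in> {1, 2}"
  shows "(\<exists>p T d. (\<lambda>n. real (T n)) \<in> O(\<lambda>n. real n ^ d) \<and>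
            solves_within T p outerplanar
              (\<lambda>n E s. s 0 = (if cf_chromatic {..<n} E \<le> k then 1 else 0)))
       \<and> (\<exists>p T. (\<lambda>n. real (T n)) \<in> O(\<lambda>n. real n ^ (4 * k + 1)) \<and>
            solves_within T p outerplanar
              (\<lambda>n E s. (\<exists>col. cf_coloring k {..<n} E col) \<longrightarrow>
                 min_cf_coloring k {..<n} E (output_coloring n s)))"
proof (intro conjI)
  have k: "k \<le> 2" using assms by auto
  \<comment> \<open>By truncation this is 1 if the optimum is at most \<open>n\<close>, and 0
    otherwise.\<close>
  let ?e = "Minus (Num 1) (Minus (Arr 16 Size (Num 0) Size (Num 0)) Size)"
  let ?f = "Color (Arr1 23 (Num 0))"
  let ?P = "\<lambda>n E s. s 0 = (if cf_chromatic {..<n} E \<le> k then 1 else 0)"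
  let ?Q = "\<lambda>n E s. (\<exists>col. cf_coloring k {..<n} E col) \<longrightarrow> min_cf_coloring k {..<n} E (output_coloring n s)"
  have "solves_within (solver_time k ?e) (solver k ?e) outerplanar ?P"
  proof (rule solver_correct[OF k])
    fix n E s \<sigma> and h :: arrays
    assume sg: "simple_graph {..<n} E" and \<sigma>: "total {..n} (pair_weight k n E) \<sigma> \<le> h (16, n, 0, n, 0)"
      "\<And>\<tau>. assignment n \<tau> \<Longrightarrow> \<tau> n = 0 \<Longrightarrow> h (16, n, 0, n, 0) \<le> total {..n} (pair_weight k n E) \<tau>"
    show "?P n E (s(0 := hval n ?e h))"
      using chromatic_iff_optimum[OF sg k \<sigma>] by simp
  qed simp
  then show "\<exists>p T d. (\<lambda>n. real (T n)) \<in> O(\<lambda>n. real n ^ d) \<and> solves_within T p outerplanar ?P"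
    using solver_time_bigo[of 4] by blast
  have "solves_within (solver_time k ?f) (solver k ?f) outerplanar ?Q"
  proof (rule solver_correct[OF k])
    fix n E s \<sigma> and h :: arrays
    assume sg: "simple_graph {..<n} E" and rep: "represents n s h"
      and \<sigma>: "total {..n} (pair_weight k n E) \<sigma> \<le> h (16, n, 0, n, 0)"
      "\<And>\<tau>. assignment n \<tau> \<Longrightarrow> \<tau> n = 0 \<Longrightarrow> h (16, n, 0, n, 0) \<le> total {..n} (pair_weight k n E) \<tau>"
      and col: "\<And>v. h (23, v, 0, 0, 0) = \<sigma> v" "\<And>v. 0 < v \<Longrightarrow> v < n \<Longrightarrow> h (32, v, 0, 0, 0) = color (\<sigma> v)"
    have "(s(0 := hval n ?f h)) v = color (\<sigma> v)" if "v < n" for v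
    proof (cases "v = 0")
      case False
      moreover have "v \<le> n * n" using that by (metis le_square le_trans less_imp_le)
      ultimately have "s v = h (32, v, 0, 0, 0)" using rep unfolding represents_def by simp
      then show ?thesis using False col(2) that by simp
    qed (simp add: col)
    then have "output_coloring n (s(0 := hval n ?f h)) v = coloring_of n \<sigma> v" for v
      unfolding output_coloring_def coloring_of_def by (cases "v < n") (simp_all only: simp_thms if_False)
    then have "output_coloring n (s(0 := hval n ?f h)) = coloring_of n \<sigma>" by (rule ext)
    then show "?Q n E (s(0 := hval n ?f h))"
      using min_coloring_of_optimum[OF sg k \<sigma>] by simp
  qed simp
  \<comment> \<open>Since \<open>k\<close> is at least 1, the exponent \<open>4 * k + 1\<close> is
    at least 4.\<close>
  then show "\<exists>p T. (\<lambda>n. real (T n)) \<in> O(\<lambda>n. real n ^ (4 * k + 1)) \<and> solves_within T p outerplanar ?Q"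
    using solver_time_bigo[of "4 * k + 1"] assms by fastforce
qed

end
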